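(* Let $k$ be a field of characteristic zero, let $R$ be a commutative $k$-algebra, let $I\subsetneq R$ be a proper ideal, and assume that the quotient ring $A=R/I$ is Noetherian. Let $f\in R$ and write $a=[f]\in A$ for its class. If $a$ is nilpotent and $d_{A/k}a=0$ in $\Omega_{A/k}$, then $$I:f\not\subseteq (I,f).$$
   Context: $I:f=\{g\in R: gf\in I\}$ is the colon ideal, and $(I,f)=I+fR$. $d_{A/k}:A\to\Omega_{A/k}$ denotes the universal Kähler derivation of the $k$-algebra $A$. *)

theory Defs
  imports "HOL-Algebra.Algebra"
begin

text \<open>
  Algebras and modules over a ring are those of \<^theory>\<open>HOL-Algebra.Module\<close>: both are records
  of type \<open>module\<close>, and the fields \<open>mult\<close> and \<open>one\<close> are ignored by the locale \<open>module\<close>.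
\<close>

definition char_zero :: "('c, 'm) ring_scheme \<Rightarrow> bool"
  where "char_zero k \<longleftrightarrow> (\<forall>n::nat. 0 < n \<longrightarrow> add_pow k n \<one>\<^bsub>k\<^esub> \<noteq> \<zero>\<^bsub>k\<^esub>)"

definition nilpotent_elem :: "('a, 'm) ring_scheme \<Rightarrow> 'a \<Rightarrow> bool"
  where "nilpotent_elem A a \<longleftrightarrow> (\<exists>n::nat. a [^]\<^bsub>A\<^esub> n = \<zero>\<^bsub>A\<^esub>)"

definition colon_ideal :: "('a, 'm) ring_scheme \<Rightarrow> 'a set \<Rightarrow> 'a \<Rightarrow> 'a set"
  where "colon_ideal R I f = {g \<in> carrier R. g \<otimes>\<^bsub>R\<^esub> f \<in> I}"


section \<open>Quotients by submodules\<close>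

text \<open>
  The library quotient \<^const>\<open>FactRing\<close> forgets scalar multiplication; here it is put back.
  The same record serves as the quotient of an algebra by an ideal and as the quotient of a
  module by a submodule. The union in the scalar multiplication makes the definition independent
  of a choice of representative; lemma \<open>quot_module_smult\<close> gives the usual formula.
\<close>

definition quot_module :: "('c, 'b, 'm) module_scheme \<Rightarrow> 'b set \<Rightarrow> ('c, 'b set) module"
    (infixl \<open>MQuot\<close> 65)
  where "M MQuot N =
    ring.extend (M Quot N) (module.fields (\<lambda>c B. \<Union>x\<in>B. N +>\<^bsub>M\<^esub> (c \<odot>\<^bsub>M\<^esub> x)))"

lemma truncate_quot_module: "ring.truncate (M MQuot N) = M Quot N"
  by (simp add: quot_module_def ring.defs module.defs)

lemma quot_module_simps:
  "carrier (M MQuot N) = a_rcosets\<^bsub>M\<^esub> N"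
  "monoid.mult (M MQuot N) = rcoset_mult M N"
  "monoid.one (M MQuot N) = N +>\<^bsub>M\<^esub> \<one>\<^bsub>M\<^esub>"
  "ring.zero (M MQuot N) = N"
  "ring.add (M MQuot N) = set_add M"
  by (simp_all add: quot_module_def ring.defs module.defs FactRing_def)

lemma truncate_simps:
  "carrier (ring.truncate A) = carrier A"
  "monoid.mult (ring.truncate A) = monoid.mult A"
  "monoid.one (ring.truncate A) = monoid.one A"
  "ring.zero (ring.truncate A) = ring.zero A"
  "ring.add (ring.truncate A) = ring.add A"
  by (simp_all add: ring.defs)

lemma abelian_group_truncate: "abelian_group A" if "abelian_group (ring.truncate A)"
proof -
  interpret T: abelian_group "ring.truncate A" by (rule that)
  note T = truncate_simps[of A]
  show ?thesis
  proof (rule abelian_groupI)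
    show "\<exists>y\<in>carrier A. y \<oplus>\<^bsub>A\<^esub> x = \<zero>\<^bsub>A\<^esub>" if "x \<in> carrier A" for x
      using T.a_inv_closed[unfolded T, OF that] T.l_neg[unfolded T, OF that] by (rule bexI[rotated])
  qed (rule T.a_closed[unfolded T] T.a_assoc[unfolded T] T.a_comm[unfolded T]
      T.zero_closed[unfolded T] T.l_zero[unfolded T]; assumption)+
qed

lemma ring_truncate: "ring A" if "ring (ring.truncate A)"
proof -
  interpret T: ring "ring.truncate A" by (rule that)
  note T = truncate_simps[of A]
  show ?thesis
    by (intro ringI monoidI abelian_group_truncate[OF T.abelian_group_axioms]
        T.m_closed[unfolded T] T.m_assoc[unfolded T] T.one_closed[unfolded T]
        T.l_one[unfolded T] T.r_one[unfolded T] T.l_distr[unfolded T] T.r_distr[unfolded T])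
qed

lemma (in module) submodule_abelian_subgroup:
  assumes "submodule N R M" shows "abelian_subgroup N M"
proof -
  have "subgroup N (add_monoid M)" using assms by (simp add: submodule_def)
  then show ?thesis
    by (intro abelian_subgroupI3 additive_subgroup.intro M.abelian_group_axioms)
qed

lemma (in module) quot_module_smult:
  assumes N: "submodule N R M" and c: "c \<in> carrier R" and x: "x \<in> carrier M"
  shows "c \<odot>\<^bsub>M MQuot N\<^esub> (N +>\<^bsub>M\<^esub> x) = N +>\<^bsub>M\<^esub> (c \<odot>\<^bsub>M\<^esub> x)"
proof -
  interpret N: abelian_subgroup N M by (rule submodule_abelian_subgroup[OF N])
  have eq: "N +>\<^bsub>M\<^esub> (c \<odot>\<^bsub>M\<^esub> y) = N +>\<^bsub>M\<^esub> (c \<odot>\<^bsub>M\<^esub> x)" if y: "y \<in> N +>\<^bsub>M\<^esub> x" for y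
  proof -
    obtain n where n: "n \<in> N" "y = n \<oplus>\<^bsub>M\<^esub> x" using y by (auto simp: a_r_coset_def')
    have nc: "n \<in> carrier M" using n by (simp add: N.a_Hcarr)
    have "c \<odot>\<^bsub>M\<^esub> y = c \<odot>\<^bsub>M\<^esub> n \<oplus>\<^bsub>M\<^esub> c \<odot>\<^bsub>M\<^esub> x" using n nc c x by (simp add: smult_r_distr)
    moreover have "c \<odot>\<^bsub>M\<^esub> n \<in> N" using N c n by (simp add: submodule.smult_closed)
    ultimately have "c \<odot>\<^bsub>M\<^esub> y \<in> N +>\<^bsub>M\<^esub> (c \<odot>\<^bsub>M\<^esub> x)" by (auto simp: a_r_coset_def')
    then show ?thesis using N.a_repr_independence' c x by (metis smult_closed)
  qed
  have "x \<in> N +>\<^bsub>M\<^esub> x" using x by (rule N.a_rcos_self)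
  then have "(\<Union>y\<in>N +>\<^bsub>M\<^esub> x. N +>\<^bsub>M\<^esub> (c \<odot>\<^bsub>M\<^esub> x)) = N +>\<^bsub>M\<^esub> (c \<odot>\<^bsub>M\<^esub> x)" by blast
  moreover have "(\<Union>y\<in>N +>\<^bsub>M\<^esub> x. N +>\<^bsub>M\<^esub> (c \<odot>\<^bsub>M\<^esub> y)) =
      (\<Union>y\<in>N +>\<^bsub>M\<^esub> x. N +>\<^bsub>M\<^esub> (c \<odot>\<^bsub>M\<^esub> x))"
    by (rule SUP_cong[OF refl eq])
  ultimately show ?thesis by (simp add: quot_module_def ring.defs module.defs)
qed

lemma (in module) quot_module_add:
  assumes N: "submodule N R M" and "x \<in> carrier M" "y \<in> carrier M"
  shows "(N +>\<^bsub>M\<^esub> x) \<oplus>\<^bsub>M MQuot N\<^esub> (N +>\<^bsub>M\<^esub> y) = N +>\<^bsub>M\<^esub> (x \<oplus>\<^bsub>M\<^esub> y)"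
proof -
  interpret N: abelian_subgroup N M by (rule submodule_abelian_subgroup[OF N])
  show ?thesis using assms by (simp add: quot_module_simps N.a_rcos_sum)
qed

lemma quot_module_carrier:
  "B \<in> carrier (M MQuot N) \<longleftrightarrow> (\<exists>x\<in>carrier M. B = N +>\<^bsub>M\<^esub> x)"
  by (auto simp: quot_module_simps A_RCOSETS_def')

lemma (in module) quot_module_is_module:
  assumes N: "submodule N R M" shows "module R (M MQuot N)"
proof (rule moduleI)
  interpret N: abelian_subgroup N M by (rule submodule_abelian_subgroup[OF N])
  show "cring R" by (rule R.is_cring)
  have "abelian_group (M Quot N)"
    by (rule comm_group_abelian_groupI)
      (simp add: FactRing_def N.a_factorgroup_is_comm_group[unfolded A_FactGroup_def'])
  then show "abelian_group (M MQuot N)"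
    by (metis truncate_quot_module abelian_group_truncate)
qed (auto simp: quot_module_carrier quot_module_smult[OF N] quot_module_add[OF N]
        smult_l_distr smult_r_distr smult_assoc1)

lemma (in algebra) ideal_submodule:
  assumes "ideal I M" shows "submodule I R M"
proof -
  interpret I: ideal I M by fact
  have "c \<odot>\<^bsub>M\<^esub> x \<in> I" if c: "c \<in> carrier R" and x: "x \<in> I" for c x
  proof -
    have xc: "x \<in> carrier M" using x by (rule I.a_Hcarr)
    then have "c \<odot>\<^bsub>M\<^esub> x = (c \<odot>\<^bsub>M\<^esub> \<one>\<^bsub>M\<^esub>) \<otimes>\<^bsub>M\<^esub> x" using c by (simp add: smult_assoc2)
    then show ?thesis using c x I.I_l_closed by simp
  qed
  then show ?thesis
    using I.a_subgroup by (simp add: submodule_def submodule_axioms_def)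
qed

lemma (in algebra) quot_is_algebra:
  assumes I: "ideal I M" shows "algebra R (M MQuot I)"
proof -
  interpret I: ideal I M by fact
  note N = ideal_submodule[OF I]
  interpret Q: module R "M MQuot I" by (rule quot_module_is_module[OF N])
  have mult: "(I +>\<^bsub>M\<^esub> x) \<otimes>\<^bsub>M MQuot I\<^esub> (I +>\<^bsub>M\<^esub> y) = I +>\<^bsub>M\<^esub> (x \<otimes>\<^bsub>M\<^esub> y)"
    if "x \<in> carrier M" "y \<in> carrier M" for x y
    using that by (simp add: quot_module_simps I.rcoset_mult_add)
  have "ring (M MQuot I)"
    using I.quotient_is_ring by (metis truncate_quot_module ring_truncate)
  then have "cring (M MQuot I)"
    by (intro cring.intro comm_monoid.intro comm_monoid_axioms.intro)
      (auto simp: quot_module_carrier mult ring_def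
        comm_monoid.m_comm[OF cring.axioms(2)[OF M_cring]])
  moreover have "(c \<odot>\<^bsub>M MQuot I\<^esub> B) \<otimes>\<^bsub>M MQuot I\<^esub> C = c \<odot>\<^bsub>M MQuot I\<^esub> (B \<otimes>\<^bsub>M MQuot I\<^esub> C)"
    if c: "c \<in> carrier R" and XY: "B \<in> carrier (M MQuot I)" "C \<in> carrier (M MQuot I)" for c B C
    using XY c by (auto simp: quot_module_carrier mult quot_module_smult[OF N] smult_assoc2)
  ultimately show ?thesis
    by (intro algebra.intro algebra_axioms.intro Q.module_axioms)
qed


section \<open>Free modules and generated submodules\<close>

text \<open>Finitely supported functions \<open>B \<rightarrow> A\<close>, extended by zero outside \<open>B\<close>.\<close>

definition free_module :: "('a, 'm) ring_scheme \<Rightarrow> 'x set \<Rightarrow> ('a, 'x \<Rightarrow> 'a) module"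
  where "free_module A B =
    \<lparr>carrier = {g. (\<forall>x. g x \<in> carrier A) \<and> finite {x. g x \<noteq> \<zero>\<^bsub>A\<^esub>} \<and> {x. g x \<noteq> \<zero>\<^bsub>A\<^esub>} \<subseteq> B},
     monoid.mult = undefined, one = undefined,
     ring.zero = (\<lambda>_. \<zero>\<^bsub>A\<^esub>), ring.add = (\<lambda>g h x. g x \<oplus>\<^bsub>A\<^esub> h x),
     module.smult = (\<lambda>a g x. a \<otimes>\<^bsub>A\<^esub> g x)\<rparr>"

definition free_gen :: "('a, 'm) ring_scheme \<Rightarrow> 'x \<Rightarrow> 'x \<Rightarrow> 'a"
  where "free_gen A x = (\<lambda>y. if y = x then \<one>\<^bsub>A\<^esub> else \<zero>\<^bsub>A\<^esub>)"

definition submodule_gen ::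
    "('a, 'm) ring_scheme \<Rightarrow> ('a, 'b, 'n) module_scheme \<Rightarrow> 'b set \<Rightarrow> 'b set"
  where "submodule_gen A M S = \<Inter>{N. submodule N A M \<and> S \<subseteq> N}"

lemma free_module_simps:
  "ring.zero (free_module A B) = (\<lambda>_. \<zero>\<^bsub>A\<^esub>)"
  "ring.add (free_module A B) = (\<lambda>g h x. g x \<oplus>\<^bsub>A\<^esub> h x)"
  "module.smult (free_module A B) = (\<lambda>a g x. a \<otimes>\<^bsub>A\<^esub> g x)"
  by (simp_all add: free_module_def)

lemma free_module_carrier:
  "g \<in> carrier (free_module A B) \<longleftrightarrow>
    (\<forall>x. g x \<in> carrier A) \<and> finite {x. g x \<noteq> \<zero>\<^bsub>A\<^esub>} \<and> {x. g x \<noteq> \<zero>\<^bsub>A\<^esub>} \<subseteq> B"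
  by (simp add: free_module_def)

lemma (in cring) free_module_is_module: "module R (free_module R B)"
proof (rule moduleI)
  show "cring R" by (rule is_cring)
  let ?F = "free_module R B"
  have add: "(\<lambda>x. g x \<oplus> h x) \<in> carrier ?F" if "g \<in> carrier ?F" "h \<in> carrier ?F" for g h
  proof -
    have "{x. g x \<oplus> h x \<noteq> \<zero>} \<subseteq> {x. g x \<noteq> \<zero>} \<union> {x. h x \<noteq> \<zero>}" by auto
    then show ?thesis using that unfolding free_module_carrier
      by (meson add.m_closed finite_UnI finite_subset le_sup_iff subset_trans Un_least)
  qed
  have smult: "(\<lambda>x. a \<otimes> g x) \<in> carrier ?F" if "a \<in> carrier R" "g \<in> carrier ?F" for a g
  proof -
    have "{x. a \<otimes> g x \<noteq> \<zero>} \<subseteq> {x. g x \<noteq> \<zero>}" using that by auto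
    then show ?thesis using that unfolding free_module_carrier
      by (meson m_closed finite_subset subset_trans)
  qed
  show "abelian_group ?F"
  proof (rule abelian_groupI)
    show "\<exists>y\<in>carrier ?F. y \<oplus>\<^bsub>?F\<^esub> g = \<zero>\<^bsub>?F\<^esub>" if g: "g \<in> carrier ?F" for g
    proof
      show "(\<lambda>x. (\<ominus> \<one>) \<otimes> g x) \<in> carrier ?F" using g by (intro smult) auto
      show "(\<lambda>x. (\<ominus> \<one>) \<otimes> g x) \<oplus>\<^bsub>?F\<^esub> g = \<zero>\<^bsub>?F\<^esub>"
        using g by (auto simp: free_module_simps free_module_carrier l_minus l_neg)
    qed
  qed (auto simp: free_module_simps add, auto simp: free_module_carrier a_ac)
  show "a \<odot>\<^bsub>?F\<^esub> g \<in> carrier ?F" if "a \<in> carrier R" "g \<in> carrier ?F" for a g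
    using smult that by (simp add: free_module_simps)
qed (auto simp: free_module_simps free_module_carrier l_distr r_distr m_assoc)

lemma submodule_zero: "submodule N A M \<Longrightarrow> \<zero>\<^bsub>M\<^esub> \<in> N"
  using subgroup.one_closed[of N "add_monoid M"] by (simp add: submodule_def)

lemma (in module) submodule_gen_is_submodule:
  assumes S: "S \<subseteq> carrier M" shows "submodule (submodule_gen R M S) R M"
proof (rule submoduleI)
  let ?H = "{N. submodule N R M \<and> S \<subseteq> N}"
  have c: "carrier M \<in> ?H" using S carrier_is_submodule by auto
  show "submodule_gen R M S \<subseteq> carrier M" unfolding submodule_gen_def using c by blast
qed (auto simp: submodule_gen_def submoduleE submodule_zero)

lemma submodule_gen_incl: "S \<subseteq> submodule_gen A M S"
  by (auto simp: submodule_gen_def)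

lemma submodule_gen_minimal: "submodule N A M \<Longrightarrow> S \<subseteq> N \<Longrightarrow> submodule_gen A M S \<subseteq> N"
  by (auto simp: submodule_gen_def)

lemma (in cring) free_gen_closed: "x \<in> B \<Longrightarrow> free_gen R x \<in> carrier (free_module R B)"
  by (auto simp: free_module_carrier free_gen_def intro: finite_subset[of _ "{x}"])


section \<open>Kaehler differentials\<close>

text \<open>
  \<open>\<Omega>\<^sub>A\<^sub>/\<^sub>k\<close> is the free \<open>A\<close>-module on symbols \<open>dx\<close>, \<open>x \<in> A\<close>, modulo additivity, the Leibniz rule and
  vanishing on the image of \<open>k\<close>. Lemma \<open>kaehler_universal\<close> gives its universal property.
\<close>

definition kaehler_rels ::
    "('c, 'm) ring_scheme \<Rightarrow> ('c, 'a, 'n) module_scheme \<Rightarrow> ('a \<Rightarrow> 'a) set"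
  where "kaehler_rels k A = (let F = free_module A (carrier A); e = free_gen A in
      {e (x \<oplus>\<^bsub>A\<^esub> y) \<ominus>\<^bsub>F\<^esub> (e x \<oplus>\<^bsub>F\<^esub> e y) | x y. x \<in> carrier A \<and> y \<in> carrier A} \<union>
      {e (x \<otimes>\<^bsub>A\<^esub> y) \<ominus>\<^bsub>F\<^esub> (x \<odot>\<^bsub>F\<^esub> e y \<oplus>\<^bsub>F\<^esub> y \<odot>\<^bsub>F\<^esub> e x) | x y. x \<in> carrier A \<and> y \<in> carrier A} \<union>
      {e (c \<odot>\<^bsub>A\<^esub> \<one>\<^bsub>A\<^esub>) | c. c \<in> carrier k})"

definition kaehler_sub ::
    "('c, 'm) ring_scheme \<Rightarrow> ('c, 'a, 'n) module_scheme \<Rightarrow> ('a \<Rightarrow> 'a) set"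
  where "kaehler_sub k A = submodule_gen A (free_module A (carrier A)) (kaehler_rels k A)"

definition kaehler ::
    "('c, 'm) ring_scheme \<Rightarrow> ('c, 'a, 'n) module_scheme \<Rightarrow> ('a, ('a \<Rightarrow> 'a) set) module"
  where "kaehler k A = free_module A (carrier A) MQuot kaehler_sub k A"

definition kaehler_d ::
    "('c, 'm) ring_scheme \<Rightarrow> ('c, 'a, 'n) module_scheme \<Rightarrow> 'a \<Rightarrow> ('a \<Rightarrow> 'a) set"
  where "kaehler_d k A x = kaehler_sub k A +>\<^bsub>free_module A (carrier A)\<^esub> free_gen A x"

definition derivation ::
    "('c, 'm) ring_scheme \<Rightarrow> ('c, 'a, 'n) module_scheme \<Rightarrow> ('a, 'b, 'p) module_scheme
      \<Rightarrow> ('a \<Rightarrow> 'b) \<Rightarrow> bool"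
  where "derivation k A M D \<longleftrightarrow>
    D \<in> carrier A \<rightarrow> carrier M \<and>
    (\<forall>x\<in>carrier A. \<forall>y\<in>carrier A. D (x \<oplus>\<^bsub>A\<^esub> y) = D x \<oplus>\<^bsub>M\<^esub> D y) \<and>
    (\<forall>x\<in>carrier A. \<forall>y\<in>carrier A. D (x \<otimes>\<^bsub>A\<^esub> y) = x \<odot>\<^bsub>M\<^esub> D y \<oplus>\<^bsub>M\<^esub> y \<odot>\<^bsub>M\<^esub> D x) \<and>
    (\<forall>c\<in>carrier k. D (c \<odot>\<^bsub>A\<^esub> \<one>\<^bsub>A\<^esub>) = \<zero>\<^bsub>M\<^esub>)"

definition linear_maps ::
    "('a, 'm) ring_scheme \<Rightarrow> ('a, 'b, 'n) module_scheme \<Rightarrow> ('a, 'd, 'p) module_scheme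
      \<Rightarrow> ('b \<Rightarrow> 'd) set"
  where "linear_maps A M N = {h \<in> carrier M \<rightarrow> carrier N.
    (\<forall>x\<in>carrier M. \<forall>y\<in>carrier M. h (x \<oplus>\<^bsub>M\<^esub> y) = h x \<oplus>\<^bsub>N\<^esub> h y) \<and>
    (\<forall>a\<in>carrier A. \<forall>x\<in>carrier M. h (a \<odot>\<^bsub>M\<^esub> x) = a \<odot>\<^bsub>N\<^esub> h x)}"


lemma (in module) a_rcos_eqI:
  assumes N: "submodule N R M" and "u \<in> carrier M" "v \<in> carrier M" "u \<ominus>\<^bsub>M\<^esub> v \<in> N"
  shows "N +>\<^bsub>M\<^esub> u = N +>\<^bsub>M\<^esub> v"
proof -
  interpret N: abelian_subgroup N M by (rule submodule_abelian_subgroup[OF N])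
  have "u = (u \<ominus>\<^bsub>M\<^esub> v) \<oplus>\<^bsub>M\<^esub> v"
    using assms by (simp add: M.minus_eq M.a_assoc M.l_neg)
  then have "u \<in> N +>\<^bsub>M\<^esub> v" using assms by (auto simp: a_r_coset_def')
  then show ?thesis using N.a_repr_independence' assms by metis
qed

context
  fixes k :: "('c, 'm) ring_scheme" and A :: "('c, 'a, 'n) module_scheme"
  assumes alg: "algebra k A"
begin

interpretation A: algebra k A by (rule alg)
interpretation F: module A "free_module A (carrier A)" by (rule A.free_module_is_module)

lemma kaehler_rels_closed: "kaehler_rels k A \<subseteq> carrier (free_module A (carrier A))"
  by (auto simp: kaehler_rels_def Let_def A.free_gen_closed)

lemma kaehler_sub_submodule: "submodule (kaehler_sub k A) A (free_module A (carrier A))"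
  unfolding kaehler_sub_def by (rule F.submodule_gen_is_submodule[OF kaehler_rels_closed])

lemma kaehler_module: "module A (kaehler k A)"
  unfolding kaehler_def by (rule F.quot_module_is_module[OF kaehler_sub_submodule])

lemma kaehler_d_derivation: "derivation k A (kaehler k A) (kaehler_d k A)"
proof -
  let ?F = "free_module A (carrier A)" and ?N = "kaehler_sub k A" and ?e = "free_gen A"
  note sub = kaehler_sub_submodule and e = A.free_gen_closed
  interpret N: abelian_subgroup ?N ?F by (rule F.submodule_abelian_subgroup[OF sub])
  have rels: "kaehler_rels k A \<subseteq> ?N" unfolding kaehler_sub_def by (rule submodule_gen_incl)
  have 1: "?N +>\<^bsub>?F\<^esub> ?e (x \<oplus>\<^bsub>A\<^esub> y) = ?N +>\<^bsub>?F\<^esub> (?e x \<oplus>\<^bsub>?F\<^esub> ?e y)"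
    if "x \<in> carrier A" "y \<in> carrier A" for x y
    using rels that by (intro F.a_rcos_eqI[OF sub]) (auto simp: kaehler_rels_def Let_def e)
  have 2: "?N +>\<^bsub>?F\<^esub> ?e (x \<otimes>\<^bsub>A\<^esub> y) = ?N +>\<^bsub>?F\<^esub> (x \<odot>\<^bsub>?F\<^esub> ?e y \<oplus>\<^bsub>?F\<^esub> y \<odot>\<^bsub>?F\<^esub> ?e x)"
    if "x \<in> carrier A" "y \<in> carrier A" for x y
    using rels that by (intro F.a_rcos_eqI[OF sub]) (auto simp: kaehler_rels_def Let_def e)
  have 3: "?N +>\<^bsub>?F\<^esub> ?e (c \<odot>\<^bsub>A\<^esub> \<one>\<^bsub>A\<^esub>) = ?N" if "c \<in> carrier k" for c
    using rels that by (intro N.a_rcos_const) (auto simp: kaehler_rels_def Let_def)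
  show ?thesis
    unfolding derivation_def kaehler_def kaehler_d_def
    by (auto simp: quot_module_carrier 1 2 3 e F.quot_module_smult[OF sub]
        F.quot_module_add[OF sub] quot_module_simps(4) intro!: e)
qed

end

lemma (in module) free_module_lift:
  assumes D: "D \<in> B \<rightarrow> carrier M"
  shows "\<exists>h\<in>linear_maps R (free_module R B) M. \<forall>x\<in>B. h (free_gen R x) = D x"
proof -
  let ?F = "free_module R B"
  define h where "h g = finsum M (\<lambda>x. g x \<odot>\<^bsub>M\<^esub> D x) {x. g x \<noteq> \<zero>}" for g
  have D': "D x \<in> carrier M" if "x \<in> B" for x using D that by auto
  have h: "h g = finsum M (\<lambda>x. g x \<odot>\<^bsub>M\<^esub> D x) S"
    if "g \<in> carrier ?F" "finite S" "{x. g x \<noteq> \<zero>} \<subseteq> S" "S \<subseteq> B" for g S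
    unfolding h_def using that D'
    by (intro M.add.finprod_mono_neutral_cong_left) (auto simp: free_module_carrier)
  have closed: "h g \<in> carrier M" if "g \<in> carrier ?F" for g
    unfolding h_def using that D' by (intro M.finsum_closed) (auto simp: free_module_carrier)
  have sc: "a \<odot>\<^bsub>?F\<^esub> g \<in> carrier ?F" "g \<oplus>\<^bsub>?F\<^esub> g' \<in> carrier ?F"
    if "a \<in> carrier R" "g \<in> carrier ?F" "g' \<in> carrier ?F" for a g g'
  proof -
    interpret F: module R ?F by (rule R.free_module_is_module)
    show "a \<odot>\<^bsub>?F\<^esub> g \<in> carrier ?F" "g \<oplus>\<^bsub>?F\<^esub> g' \<in> carrier ?F" using that by auto
  qed
  have add: "h (g \<oplus>\<^bsub>?F\<^esub> g') = h g \<oplus>\<^bsub>M\<^esub> h g'" if g: "g \<in> carrier ?F" "g' \<in> carrier ?F" for g g'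
  proof -
    let ?S = "{x. g x \<noteq> \<zero>} \<union> {x. g' x \<noteq> \<zero>}"
    have S: "finite ?S" "?S \<subseteq> B" using g by (auto simp: free_module_carrier)
    have "h (g \<oplus>\<^bsub>?F\<^esub> g') = finsum M (\<lambda>x. (g x \<oplus> g' x) \<odot>\<^bsub>M\<^esub> D x) ?S"
    proof -
      have "{x. (g \<oplus>\<^bsub>?F\<^esub> g') x \<noteq> \<zero>} \<subseteq> ?S" by (auto simp: free_module_simps)
      from h[OF sc(2)[OF R.zero_closed g] S(1) this S(2)] show ?thesis
        by (simp add: free_module_simps)
    qed
    also have "\<dots> = finsum M (\<lambda>x. g x \<odot>\<^bsub>M\<^esub> D x \<oplus>\<^bsub>M\<^esub> g' x \<odot>\<^bsub>M\<^esub> D x) ?S"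
      using g S D' by (intro M.finsum_cong') (auto simp: free_module_carrier smult_l_distr subset_iff)
    also have "\<dots> = finsum M (\<lambda>x. g x \<odot>\<^bsub>M\<^esub> D x) ?S \<oplus>\<^bsub>M\<^esub> finsum M (\<lambda>x. g' x \<odot>\<^bsub>M\<^esub> D x) ?S"
      using g S D' by (intro M.finsum_addf) (auto simp: free_module_carrier subset_iff)
    also have "\<dots> = h g \<oplus>\<^bsub>M\<^esub> h g'"
      using h[OF g(1) S(1) _ S(2)] h[OF g(2) S(1) _ S(2)] by simp
    finally show ?thesis .
  qed
  have smult: "h (a \<odot>\<^bsub>?F\<^esub> g) = a \<odot>\<^bsub>M\<^esub> h g" if a: "a \<in> carrier R" and g: "g \<in> carrier ?F" for a g
  proof -
    let ?S = "{x. g x \<noteq> \<zero>}"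
    have S: "finite ?S" "?S \<subseteq> B" using g by (auto simp: free_module_carrier)
    have "h (a \<odot>\<^bsub>?F\<^esub> g) = finsum M (\<lambda>x. (a \<otimes> g x) \<odot>\<^bsub>M\<^esub> D x) ?S"
    proof -
      have "{x. (a \<odot>\<^bsub>?F\<^esub> g) x \<noteq> \<zero>} \<subseteq> ?S" using a by (auto simp: free_module_simps)
      from h[OF sc(1)[OF a g g] S(1) this S(2)] show ?thesis by (simp add: free_module_simps)
    qed
    also have "\<dots> = finsum M (\<lambda>x. a \<odot>\<^bsub>M\<^esub> (g x \<odot>\<^bsub>M\<^esub> D x)) ?S"
      using a g S D' by (intro M.finsum_cong') (auto simp: free_module_carrier smult_assoc1 subset_iff)
    also have "\<dots> = a \<odot>\<^bsub>M\<^esub> finsum M (\<lambda>x. g x \<odot>\<^bsub>M\<^esub> D x) ?S"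
      using a g S D' by (intro finsum_smult_ldistr[symmetric]) (auto simp: free_module_carrier subset_iff)
    finally show ?thesis using h[OF g S(1) _ S(2)] by simp
  qed
  have gen: "h (free_gen R x) = D x" if x: "x \<in> B" for x
  proof -
    have "h (free_gen R x) = finsum M (\<lambda>y. free_gen R x y \<odot>\<^bsub>M\<^esub> D y) {x}"
      using x by (intro h) (simp_all add: R.free_gen_closed, auto simp: free_gen_def)
    then show ?thesis using x D' by (simp add: free_gen_def)
  qed
  show ?thesis
    by (intro bexI[of _ h]) (auto simp: linear_maps_def closed add smult gen)
qed

lemma (in cring) free_module_span:
  assumes N: "submodule N R (free_module R B)" and gen: "\<And>x. x \<in> B \<Longrightarrow> free_gen R x \<in> N"
  shows "carrier (free_module R B) \<subseteq> N"
proof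
  let ?F = "free_module R B"
  interpret F: module R ?F by (rule free_module_is_module)
  fix g assume g: "g \<in> carrier ?F"
  have ind: "finite S \<Longrightarrow> g \<in> carrier ?F \<Longrightarrow> {x. g x \<noteq> \<zero>} \<subseteq> S \<Longrightarrow> g \<in> N" for S g
  proof (induction S arbitrary: g rule: finite_induct)
    case empty
    then have "g = \<zero>\<^bsub>?F\<^esub>" by (auto simp: free_module_simps)
    then show ?case using submodule_zero[OF N] by simp
  next
    case (insert x S)
    show ?case
    proof (cases "g x = \<zero>")
      case True
      then have "{x. g x \<noteq> \<zero>} \<subseteq> S" using insert.prems by auto
      then show ?thesis using insert by blast
    next
      case False
      then have x: "x \<in> B" using insert.prems by (auto simp: free_module_carrier)
      let ?g = "g(x := \<zero>)"
      have gc: "\<And>y. g y \<in> carrier R" using insert.prems by (simp add: free_module_carrier)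
      have "{y. ?g y \<noteq> \<zero>} \<subseteq> {y. g y \<noteq> \<zero>}" by auto
      then have "?g \<in> carrier ?F" using insert.prems
        unfolding free_module_carrier by (auto intro: finite_subset)
      moreover have "{y. ?g y \<noteq> \<zero>} \<subseteq> S" using insert.prems by auto
      ultimately have "?g \<in> N" by (rule insert.IH)
      moreover have "g x \<odot>\<^bsub>?F\<^esub> free_gen R x \<in> N"
        using gen[OF x] gc N by (simp add: submodule.smult_closed)
      moreover have "g = ?g \<oplus>\<^bsub>?F\<^esub> g x \<odot>\<^bsub>?F\<^esub> free_gen R x"
        using gc by (auto simp: free_module_simps free_gen_def)
      ultimately show ?thesis using F.submoduleE(5)[OF N] by metis
    qed
  qed
  show "g \<in> N" using ind[of "{x. g x \<noteq> \<zero>}" g] g unfolding free_module_carrier by blast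
qed

lemma linear_maps_zero:
  assumes "module A M" "module A N" "h \<in> linear_maps A M N" shows "h \<zero>\<^bsub>M\<^esub> = \<zero>\<^bsub>N\<^esub>"
proof -
  interpret M: module A M by fact
  interpret N: module A N by fact
  have "h (\<zero>\<^bsub>A\<^esub> \<odot>\<^bsub>M\<^esub> \<zero>\<^bsub>M\<^esub>) = \<zero>\<^bsub>A\<^esub> \<odot>\<^bsub>N\<^esub> h \<zero>\<^bsub>M\<^esub>"
    using assms(3) unfolding linear_maps_def by blast
  moreover have "h \<zero>\<^bsub>M\<^esub> \<in> carrier N" using assms(3) by (auto simp: linear_maps_def)
  ultimately show ?thesis by simp
qed

lemma linear_maps_equalizer:
  assumes M: "module A M" and N: "module A N"
    and h: "h \<in> linear_maps A M N" and h': "h' \<in> linear_maps A M N"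
  shows "submodule {x \<in> carrier M. h x = h' x} A M"
proof -
  interpret M: module A M by fact
  interpret N: module A N by fact
  have inv: "h (\<ominus>\<^bsub>M\<^esub> x) = h' (\<ominus>\<^bsub>M\<^esub> x)" if x: "x \<in> carrier M" "h x = h' x" for x
  proof -
    have "\<ominus>\<^bsub>M\<^esub> x = (\<ominus>\<^bsub>A\<^esub> \<one>\<^bsub>A\<^esub>) \<odot>\<^bsub>M\<^esub> x" using x by (simp add: M.smult_l_minus)
    then show ?thesis using h h' x by (simp add: linear_maps_def)
  qed
  show ?thesis
    using h h' inv linear_maps_zero[OF M N h] linear_maps_zero[OF M N h']
    by (intro M.submoduleI) (auto simp: linear_maps_def)
qed

lemma linear_maps_quot:
  assumes M: "module A M" and N: "submodule N A M"
  shows "(\<lambda>x. N +>\<^bsub>M\<^esub> x) \<in> linear_maps A M (M MQuot N)"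
proof -
  interpret M: module A M by fact
  show ?thesis
    by (auto simp: linear_maps_def quot_module_carrier M.quot_module_add[OF N]
        M.quot_module_smult[OF N])
qed

lemma linear_maps_factor:
  assumes M: "module A M" and N: "submodule N A M" and P: "module A P"
    and h: "h \<in> linear_maps A M P" and z: "\<And>x. x \<in> N \<Longrightarrow> h x = \<zero>\<^bsub>P\<^esub>"
  shows "\<exists>h'\<in>linear_maps A (M MQuot N) P. \<forall>x\<in>carrier M. h' (N +>\<^bsub>M\<^esub> x) = h x"
proof -
  interpret M: module A M by fact
  interpret P: module A P by fact
  interpret N: abelian_subgroup N M by (rule M.submodule_abelian_subgroup[OF N])
  have lin: "\<And>x. x \<in> carrier M \<Longrightarrow> h x \<in> carrier P"
      "\<And>x y. x \<in> carrier M \<Longrightarrow> y \<in> carrier M \<Longrightarrow> h (x \<oplus>\<^bsub>M\<^esub> y) = h x \<oplus>\<^bsub>P\<^esub> h y"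
      "\<And>a x. a \<in> carrier A \<Longrightarrow> x \<in> carrier M \<Longrightarrow> h (a \<odot>\<^bsub>M\<^esub> x) = a \<odot>\<^bsub>P\<^esub> h x"
    using h by (auto simp: linear_maps_def)
  have eq: "h y = h x" if x: "x \<in> carrier M" and y: "y \<in> N +>\<^bsub>M\<^esub> x" for x y
  proof -
    obtain n where n: "n \<in> N" "y = n \<oplus>\<^bsub>M\<^esub> x" using y by (auto simp: a_r_coset_def')
    then show ?thesis using x z[OF n(1)] N.a_Hcarr[OF n(1)] by (simp add: lin)
  qed
  define h' where "h' S = h (SOME x. x \<in> S)" for S
  have h': "h' (N +>\<^bsub>M\<^esub> x) = h x" if "x \<in> carrier M" for x
    unfolding h'_def by (rule eq[OF that someI[of _ x]]) (rule N.a_rcos_self[OF that])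
  have "h' \<in> linear_maps A (M MQuot N) P"
    by (auto simp: linear_maps_def quot_module_carrier h' lin M.quot_module_add[OF N]
        M.quot_module_smult[OF N])
  then show ?thesis using h' by blast
qed

theorem kaehler_universal:
  assumes alg: "algebra k A" and M: "module A M" and D: "derivation k A M D"
  shows "\<exists>h\<in>linear_maps A (kaehler k A) M. (\<forall>x\<in>carrier A. h (kaehler_d k A x) = D x) \<and>
    (\<forall>h'\<in>linear_maps A (kaehler k A) M. (\<forall>x\<in>carrier A. h' (kaehler_d k A x) = D x) \<longrightarrow>
      (\<forall>w\<in>carrier (kaehler k A). h' w = h w))"
proof -
  let ?F = "free_module A (carrier A)" and ?N = "kaehler_sub k A" and ?e = "free_gen A"
  interpret A: algebra k A by (rule alg)
  interpret M: module A M by (rule M)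
  interpret F: module A ?F by (rule A.free_module_is_module)
  note sub = kaehler_sub_submodule[OF alg] and e = A.free_gen_closed
  note K = kaehler_module[OF alg]
  note d = D[unfolded derivation_def]
  obtain g where g: "g \<in> linear_maps A ?F M" and ge: "\<And>x. x \<in> carrier A \<Longrightarrow> g (?e x) = D x"
    using M.free_module_lift[of D "carrier A"] d by blast
  have lin: "\<And>x. x \<in> carrier ?F \<Longrightarrow> g x \<in> carrier M"
      "\<And>x y. x \<in> carrier ?F \<Longrightarrow> y \<in> carrier ?F \<Longrightarrow> g (x \<oplus>\<^bsub>?F\<^esub> y) = g x \<oplus>\<^bsub>M\<^esub> g y"
      "\<And>a x. a \<in> carrier A \<Longrightarrow> x \<in> carrier ?F \<Longrightarrow> g (a \<odot>\<^bsub>?F\<^esub> x) = a \<odot>\<^bsub>M\<^esub> g x"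
    using g by (auto simp: linear_maps_def)
  have zero: "(\<lambda>_. \<zero>\<^bsub>M\<^esub>) \<in> linear_maps A ?F M" by (auto simp: linear_maps_def)
  have minus: "g (u \<ominus>\<^bsub>?F\<^esub> v) = \<zero>\<^bsub>M\<^esub>"
    if u: "u \<in> carrier ?F" and v: "v \<in> carrier ?F" and uv: "g u = g v" for u v
  proof -
    have "u = (u \<ominus>\<^bsub>?F\<^esub> v) \<oplus>\<^bsub>?F\<^esub> v" using u v by (simp add: F.M.minus_eq F.M.a_assoc F.M.l_neg)
    then have "g u = g (u \<ominus>\<^bsub>?F\<^esub> v) \<oplus>\<^bsub>M\<^esub> g v" using lin u v by (metis F.M.minus_closed)
    moreover have "g v \<in> carrier M" "g (u \<ominus>\<^bsub>?F\<^esub> v) \<in> carrier M" using lin u v by auto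
    ultimately show ?thesis using uv by (metis M.M.add.r_cancel_one')
  qed
  have "kaehler_rels k A \<subseteq> {x \<in> carrier ?F. g x = \<zero>\<^bsub>M\<^esub>}"
    using d by (auto simp: kaehler_rels_def Let_def e ge lin intro!: minus)
  then have "?N \<subseteq> {x \<in> carrier ?F. g x = \<zero>\<^bsub>M\<^esub>}"
    unfolding kaehler_sub_def
    using linear_maps_equalizer[OF F.module_axioms M g zero] by (rule submodule_gen_minimal[rotated])
  then obtain h where h: "h \<in> linear_maps A (kaehler k A) M"
    and hg: "\<And>x. x \<in> carrier ?F \<Longrightarrow> h (?N +>\<^bsub>?F\<^esub> x) = g x"
    using linear_maps_factor[OF F.module_axioms sub M g] unfolding kaehler_def by blast
  have hd: "h (kaehler_d k A x) = D x" if "x \<in> carrier A" for x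
    using that by (simp add: kaehler_d_def hg e ge)
  have uniq: "h' w = h w"
    if h': "h' \<in> linear_maps A (kaehler k A) M" "\<And>x. x \<in> carrier A \<Longrightarrow> h' (kaehler_d k A x) = D x"
      and w: "w \<in> carrier (kaehler k A)" for h' w
  proof -
    let ?q = "\<lambda>x. ?N +>\<^bsub>?F\<^esub> x"
    have q: "?q \<in> linear_maps A ?F (kaehler k A)"
      unfolding kaehler_def by (rule linear_maps_quot[OF F.module_axioms sub])
    have comp: "(\<lambda>x. j (?q x)) \<in> linear_maps A ?F M" if "j \<in> linear_maps A (kaehler k A) M" for j
      using that q unfolding linear_maps_def by (simp add: Pi_iff)
    have "carrier ?F \<subseteq> {x \<in> carrier ?F. h' (?q x) = h (?q x)}"
      using linear_maps_equalizer[OF F.module_axioms M comp[OF h'(1)] comp[OF h]] h'(2) hd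
      by (intro A.free_module_span) (auto simp: e kaehler_d_def)
    then show ?thesis using w by (auto simp: kaehler_def quot_module_carrier)
  qed
  show ?thesis using h hd uniq by blast
qed

end

theory Submission
  imports Defs
begin

text \<open>
  Assume \<open>I : f \<subseteq> (I, f)\<close>, that is, \<open>Ann(a) \<subseteq> aA\<close>. This persists in the localization \<open>T\<close> of \<open>A\<close> at a
  minimal prime, an Artinian local ring, which contains a coefficient field \<open>L\<close> over \<open>k\<close> because the
  characteristic is zero and is therefore finite-dimensional over \<open>L\<close>. Since \<open>Ann(a) \<subseteq> aT\<close>, the ring
  \<open>T/a\<^sup>2T\<close> is a free module of some rank \<open>r > 0\<close> over \<open>L[a]\<close> with \<open>a\<^sup>2 = 0\<close>. Let \<open>X\<close>, \<open>Y\<close> be the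
  matrices over \<open>L[a]\<close> of multiplication by \<open>x\<close>, \<open>y\<close>, and \<open>\<delta>\<close> the derivation \<open>L[a] \<rightarrow> L\<close> with
  \<open>\<delta>a = 1\<close>. The form \<open>\<langle>x, y\<rangle> = tr(X \<cdot> \<delta>Y)\<close> is a Hochschild cocycle by cyclicity of the trace, so
  \<open>y \<mapsto> \<langle>\<cdot>, y\<rangle>\<close> is a \<open>k\<close>-derivation of \<open>A\<close>. It maps \<open>a\<close> to a functional with value \<open>tr(1) = r \<noteq> 0\<close> at
  \<open>1\<close>, contradicting \<open>da = 0\<close>.
\<close>

section \<open>Nilpotent elements\<close>

text \<open>The hypothesis \<open>da = 0\<close> says that every \<open>k\<close>-derivation of
  \<open>A\<close> into an \<open>A\<close>-module kills \<open>a\<close>, so a contradiction needs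
  one derivation, into any module, that does not. The map \<open>\<delta>\<close> alone does not
  give one: \<open>Y \<mapsto> \<delta>Y\<close> is a derivation into matrices over
  \<open>L\<close>, where left and right multiplication by \<open>A\<close> differ. Pairing with
  \<open>X\<close> under the trace removes the difference, which is why the target module consists
  of functions on \<open>T\<close>. Freeness rests on a criterion: over \<open>L[a]\<close> with
  \<open>a\<^sup>2 = 0\<close>, a module is free as soon as everything killed by \<open>a\<close> is
  a multiple of \<open>a\<close>. Reduction modulo \<open>a\<^sup>2\<close> preserves this property,
  since \<open>a x = a\<^sup>2 u\<close> puts \<open>x - a u\<close> in \<open>Ann(a)\<close>. The
  rank is the dimension of \<open>T/aT\<close> over \<open>L\<close>, positive because a nilpotent
  \<open>a\<close> is not a unit. Characteristic zero acts twice: it makes minimal polynomials over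
  \<open>L\<close> separable, and it keeps the rank nonzero as an element of \<open>T\<close>.
  Maximality of the multiplicative set gives directly that every element of \<open>T\<close> is a
  unit or nilpotent; this dichotomy, together with a finitely generated nilradical, carries the
  Artinian local structure.\<close>

context cring begin

lemma nilpotent_mult:
  assumes "x \<in> carrier R" "y \<in> carrier R" "nilpotent_elem R x"
  shows "nilpotent_elem R (x \<otimes> y)"
proof -
  obtain n :: nat where "x [^] n = \<zero>" using assms(3) by (auto simp: nilpotent_elem_def)
  then have "(x \<otimes> y) [^] n = \<zero>" using assms by (simp add: nat_pow_distrib)
  then show ?thesis by (auto simp: nilpotent_elem_def)
qed

lemma one_minus_nilpotent_Units:
  assumes x: "x \<in> carrier R" and n: "nilpotent_elem R x"
  shows "\<one> \<ominus> x \<in> Units R"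
proof -
  have "\<exists>v\<in>carrier R. (\<one> \<ominus> x) \<otimes> v = \<one> \<ominus> x [^] n" for n :: nat
  proof (induction n)
    case 0 then show ?case using x by (intro bexI[of _ \<zero>]) (auto simp: minus_eq r_neg)
  next
    case (Suc n)
    then obtain v where v: "v \<in> carrier R" and eq: "(\<one> \<ominus> x) \<otimes> v = \<one> \<ominus> x [^] n" by blast
    have "(\<one> \<ominus> x) \<otimes> (\<one> \<oplus> x \<otimes> v) = (\<one> \<ominus> x) \<oplus> x \<otimes> ((\<one> \<ominus> x) \<otimes> v)" using x v by algebra
    also have "\<dots> = \<one> \<ominus> x [^] n \<otimes> x"
    proof -
      have "x [^] n \<in> carrier R" using x by simp
      then show ?thesis unfolding eq using x by algebra
    qed
    finally show ?case using x v by (intro bexI[of _ "\<one> \<oplus> x \<otimes> v"]) auto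
  qed
  moreover obtain n :: nat where "x [^] n = \<zero>" using n by (auto simp: nilpotent_elem_def)
  ultimately obtain v where "v \<in> carrier R" "(\<one> \<ominus> x) \<otimes> v = \<one>"
    by (metis minus_eq minus_zero r_zero one_closed)
  then show ?thesis using x by (auto simp: Units_def m_comm intro!: bexI[of _ v])
qed

end

text \<open>Such a ring is local with the nilradical as its maximal ideal. Finite generation of the
  nilradical enters separately, as a hypothesis of \<open>frame_exists\<close>.\<close>

locale unit_or_nilpotent = cring R for R (structure) +
  assumes one_not_zero: "\<one> \<noteq> \<zero>"
    and unit_or_nilpotent: "x \<in> carrier R \<Longrightarrow> x \<in> Units R \<or> nilpotent_elem R x"
begin

lemma unit_not_nilpotent:
  assumes "x \<in> Units R" shows "\<not> nilpotent_elem R x"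
proof
  assume "nilpotent_elem R x"
  then have "nilpotent_elem R (x \<otimes> inv x)" using assms by (intro nilpotent_mult) auto
  then have "nilpotent_elem R \<one>" using assms by simp
  then show False using one_not_zero by (auto simp: nilpotent_elem_def)
qed

lemma nilpotent_zero: "nilpotent_elem R \<zero>"
  by (auto simp: nilpotent_elem_def intro: exI[of _ "1::nat"])

text \<open>Were the sum a unit with inverse \<open>v\<close>, then \<open>y v = 1 - x v\<close>
  would be both nilpotent and a unit.\<close>

lemma nilpotent_add:
  assumes "x \<in> carrier R" "y \<in> carrier R" "nilpotent_elem R x" "nilpotent_elem R y"
  shows "nilpotent_elem R (x \<oplus> y)"
proof (rule ccontr)
  assume "\<not> nilpotent_elem R (x \<oplus> y)"
  then have u: "x \<oplus> y \<in> Units R" using unit_or_nilpotent assms by blast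
  let ?v = "inv (x \<oplus> y)"
  have v: "?v \<in> carrier R" using u by simp
  have "(x \<oplus> y) \<otimes> ?v = \<one>" using u by simp
  then have "x \<otimes> ?v \<oplus> y \<otimes> ?v = \<one>" using assms v by (simp add: l_distr)
  then have "y \<otimes> ?v = \<one> \<ominus> x \<otimes> ?v" using assms v
    by (metis add.inv_solve_right' a_comm m_closed minus_eq one_closed)
  moreover have "\<one> \<ominus> x \<otimes> ?v \<in> Units R"
    using assms v by (intro one_minus_nilpotent_Units nilpotent_mult) auto
  ultimately show False using unit_not_nilpotent nilpotent_mult[of y ?v] assms v by auto
qed

lemma nilpotent_uminus:
  assumes "x \<in> carrier R" "nilpotent_elem R x" shows "nilpotent_elem R (\<ominus> x)"
  using nilpotent_mult[of x "\<ominus> \<one>"] assms by (simp add: r_minus)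

lemma nilpotent_ideal: "ideal {x \<in> carrier R. nilpotent_elem R x} R"
proof (rule idealI)
  show "subgroup {x \<in> carrier R. nilpotent_elem R x} (add_monoid R)"
    using nilpotent_add nilpotent_zero nilpotent_uminus
    by (intro add.subgroupI) (auto simp flip: a_inv_def)
  show "y \<otimes> x \<in> {x \<in> carrier R. nilpotent_elem R x}" "x \<otimes> y \<in> {x \<in> carrier R. nilpotent_elem R x}"
    if "x \<in> {x \<in> carrier R. nilpotent_elem R x}" "y \<in> carrier R" for x y
    using that nilpotent_mult[of x y] m_comm[of x y] by auto
qed (rule ring_axioms)

lemma unit_add_nilpotent:
  assumes "u \<in> Units R" "x \<in> carrier R" "nilpotent_elem R x"
  shows "u \<oplus> x \<in> Units R"
proof (rule ccontr)
  assume "u \<oplus> x \<notin> Units R"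
  then have "nilpotent_elem R (u \<oplus> x)" using unit_or_nilpotent assms by blast
  then have "nilpotent_elem R ((u \<oplus> x) \<oplus> \<ominus> x)"
    using assms nilpotent_add[of "u \<oplus> x" "\<ominus> x"] nilpotent_uminus[of x] by auto
  moreover have "(u \<oplus> x) \<oplus> \<ominus> x = u" using assms Units_closed[of u] by (simp add: a_assoc r_neg)
  ultimately have "nilpotent_elem R u" by simp
  then show False using unit_not_nilpotent assms(1) by blast
qed

end

section \<open>Localization at a maximal multiplicative set\<close>

text \<open>Evaluates a ring operation on fractions, defined below as a union over all
  representatives, once every pair of representatives gives the same fraction.\<close>

lemma UN_const_eq:
  assumes "p \<in> A" "q \<in> B" "\<And>p q. p \<in> A \<Longrightarrow> q \<in> B \<Longrightarrow> F p q = C"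
  shows "(\<Union>p\<in>A. \<Union>q\<in>B. F p q) = C"
  using assms by blast

locale localization = cring R for R (structure) +
  fixes S assumes S: "submonoid S R"
begin

lemma S_closed [simp]: "s \<in> S \<Longrightarrow> s \<in> carrier R"
  and S_mult [simp]: "s \<in> S \<Longrightarrow> t \<in> S \<Longrightarrow> s \<otimes> t \<in> S"
  and S_one [simp]: "\<one> \<in> S"
  using submonoid.subset[OF S] submonoid.m_closed[OF S] submonoid.one_closed[OF S] by auto

text \<open>The equivalence class of the pair \<open>(x, s)\<close>. The extra factor
  \<open>u\<close> makes the relation transitive when \<open>S\<close> contains zero
  divisors.\<close>

definition frac :: "'a \<Rightarrow> 'a \<Rightarrow> ('a \<times> 'a) set"
  where "frac x s = {(y, t). y \<in> carrier R \<and> t \<in> S \<and> (\<exists>u\<in>S. u \<otimes> (x \<otimes> t) = u \<otimes> (y \<otimes> s))}"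

definition loc :: "('a \<times> 'a) set ring"
  where "loc = \<lparr>carrier = {frac x s | x s. x \<in> carrier R \<and> s \<in> S},
    monoid.mult = (\<lambda>U V. \<Union>p\<in>U. \<Union>q\<in>V. frac (fst p \<otimes> fst q) (snd p \<otimes> snd q)),
    one = frac \<one> \<one>,
    ring.zero = frac \<zero> \<one>,
    ring.add = (\<lambda>U V. \<Union>p\<in>U. \<Union>q\<in>V. frac (fst p \<otimes> snd q \<oplus> fst q \<otimes> snd p) (snd p \<otimes> snd q))\<rparr>"

lemma frac_self: "x \<in> carrier R \<Longrightarrow> s \<in> S \<Longrightarrow> (x, s) \<in> frac x s"
  by (auto simp: frac_def intro: bexI[of _ \<one>])

lemma frac_eqI_aux:
  assumes "x \<in> carrier R" "y \<in> carrier R" "s \<in> S" "t \<in> S" "u \<in> S"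
    and u: "u \<otimes> (x \<otimes> t) = u \<otimes> (y \<otimes> s)"
  shows "frac x s \<subseteq> frac y t"
proof
  fix p assume "p \<in> frac x s"
  then obtain z r v where p: "p = (z, r)" "z \<in> carrier R" "r \<in> S" "v \<in> S"
    and v: "v \<otimes> (x \<otimes> r) = v \<otimes> (z \<otimes> s)" by (auto simp: frac_def)
  \<comment> \<open>The factor \<open>s\<close>, the denominator of the middle fraction, allows the
    two given equations to be chained.\<close>
  have "(u \<otimes> v \<otimes> s) \<otimes> (y \<otimes> r) = (u \<otimes> (y \<otimes> s)) \<otimes> (v \<otimes> r)"
    using assms p by (simp add: m_ac)
  also have "\<dots> = (v \<otimes> (x \<otimes> r)) \<otimes> (u \<otimes> t)"
    unfolding u[symmetric] using assms(1-5) p by (simp add: m_ac)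
  also have "\<dots> = (u \<otimes> v \<otimes> s) \<otimes> (z \<otimes> t)"
    unfolding v using assms(1-5) p by (simp add: m_ac)
  finally show "p \<in> frac y t" using assms p
    by (auto simp: frac_def intro!: bexI[of _ "u \<otimes> v \<otimes> s"])
qed

lemma frac_eq_iff:
  assumes "x \<in> carrier R" "y \<in> carrier R" "s \<in> S" "t \<in> S"
  shows "frac x s = frac y t \<longleftrightarrow> (\<exists>u\<in>S. u \<otimes> (x \<otimes> t) = u \<otimes> (y \<otimes> s))"
proof
  assume "frac x s = frac y t"
  then have "(y, t) \<in> frac x s" using frac_self assms by simp
  then show "\<exists>u\<in>S. u \<otimes> (x \<otimes> t) = u \<otimes> (y \<otimes> s)" by (auto simp: frac_def)
next
  assume "\<exists>u\<in>S. u \<otimes> (x \<otimes> t) = u \<otimes> (y \<otimes> s)"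
  then show "frac x s = frac y t"
    using frac_eqI_aux[OF assms] frac_eqI_aux[of y x t s] assms
    by (metis subset_antisym)
qed

lemma frac_cong:
  assumes "x \<in> carrier R" "y \<in> carrier R" "s \<in> S" "t \<in> S" "x \<otimes> t = y \<otimes> s"
  shows "frac x s = frac y t"
  using assms by (auto simp: frac_eq_iff intro: bexI[of _ \<one>])

lemma frac_mem:
  assumes "(y, t) \<in> frac x s"
  shows "y \<in> carrier R" "t \<in> S" "\<exists>u\<in>S. u \<otimes> (x \<otimes> t) = u \<otimes> (y \<otimes> s)"
  using assms by (auto simp: frac_def)

lemma loc_mult:
  assumes "x \<in> carrier R" "s \<in> S" "y \<in> carrier R" "t \<in> S"
  shows "frac x s \<otimes>\<^bsub>loc\<^esub> frac y t = frac (x \<otimes> y) (s \<otimes> t)"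
proof -
  have "frac (x' \<otimes> y') (s' \<otimes> t') = frac (x \<otimes> y) (s \<otimes> t)"
    if p: "(x', s') \<in> frac x s" and q: "(y', t') \<in> frac y t" for x' s' y' t'
  proof -
    note p = frac_mem[OF p] and q = frac_mem[OF q]
    obtain u v where uv: "u \<in> S" "v \<in> S" and u: "u \<otimes> (x \<otimes> s') = u \<otimes> (x' \<otimes> s)"
      and v: "v \<otimes> (y \<otimes> t') = v \<otimes> (y' \<otimes> t)" using p q by blast
    have "u \<otimes> v \<otimes> (x' \<otimes> y' \<otimes> (s \<otimes> t)) = (u \<otimes> (x' \<otimes> s)) \<otimes> (v \<otimes> (y' \<otimes> t))"
      using p(1,2) q(1,2) uv assms by (simp add: m_ac)
    also have "\<dots> = u \<otimes> v \<otimes> (x \<otimes> y \<otimes> (s' \<otimes> t'))"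
      unfolding u[symmetric] v[symmetric] using p(1,2) q(1,2) uv assms by (simp add: m_ac)
    finally show ?thesis using p(1,2) q(1,2) uv assms
      by (auto simp: frac_eq_iff intro!: bexI[of _ "u \<otimes> v"])
  qed
  then show ?thesis unfolding loc_def monoid.simps ring.simps
    by (intro UN_const_eq[OF frac_self[OF assms(1,2)] frac_self[OF assms(3,4)]]) auto
qed

lemma loc_add:
  assumes "x \<in> carrier R" "s \<in> S" "y \<in> carrier R" "t \<in> S"
  shows "frac x s \<oplus>\<^bsub>loc\<^esub> frac y t = frac (x \<otimes> t \<oplus> y \<otimes> s) (s \<otimes> t)"
proof -
  have "frac (x' \<otimes> t' \<oplus> y' \<otimes> s') (s' \<otimes> t') = frac (x \<otimes> t \<oplus> y \<otimes> s) (s \<otimes> t)"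
    if p: "(x', s') \<in> frac x s" and q: "(y', t') \<in> frac y t" for x' s' y' t'
  proof -
    note p = frac_mem[OF p] and q = frac_mem[OF q]
    obtain u v where uv: "u \<in> S" "v \<in> S" and u: "u \<otimes> (x \<otimes> s') = u \<otimes> (x' \<otimes> s)"
      and v: "v \<otimes> (y \<otimes> t') = v \<otimes> (y' \<otimes> t)" using p q by blast
    have "u \<otimes> v \<otimes> ((x' \<otimes> t' \<oplus> y' \<otimes> s') \<otimes> (s \<otimes> t))
        = (u \<otimes> (x' \<otimes> s)) \<otimes> (v \<otimes> t' \<otimes> t) \<oplus> (v \<otimes> (y' \<otimes> t)) \<otimes> (u \<otimes> s' \<otimes> s)"
      using p(1,2) q(1,2) uv assms by (simp add: m_ac l_distr r_distr)
    also have "\<dots> = u \<otimes> v \<otimes> ((x \<otimes> t \<oplus> y \<otimes> s) \<otimes> (s' \<otimes> t'))"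
      unfolding u[symmetric] v[symmetric] using p(1,2) q(1,2) uv assms
      by (simp add: m_ac l_distr r_distr)
    finally show ?thesis using p(1,2) q(1,2) uv assms
      by (auto simp: frac_eq_iff intro!: bexI[of _ "u \<otimes> v"])
  qed
  then show ?thesis unfolding loc_def monoid.simps ring.simps
    by (intro UN_const_eq[OF frac_self[OF assms(1,2)] frac_self[OF assms(3,4)]]) auto
qed

lemma loc_carrier: "U \<in> carrier loc \<longleftrightarrow> (\<exists>x\<in>carrier R. \<exists>s\<in>S. U = frac x s)"
  and loc_zero: "\<zero>\<^bsub>loc\<^esub> = frac \<zero> \<one>" and loc_one: "\<one>\<^bsub>loc\<^esub> = frac \<one> \<one>"
  by (auto simp: loc_def)

lemma frac_closed: "x \<in> carrier R \<Longrightarrow> s \<in> S \<Longrightarrow> frac x s \<in> carrier loc"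
  by (auto simp: loc_carrier)

lemma loc_cring: "cring loc"
proof (intro cringI abelian_groupI comm_monoidI)
  show "\<exists>V\<in>carrier loc. V \<oplus>\<^bsub>loc\<^esub> U = \<zero>\<^bsub>loc\<^esub>" if U: "U \<in> carrier loc" for U
  proof -
    obtain x s where x: "x \<in> carrier R" "s \<in> S" "U = frac x s" using U by (auto simp: loc_carrier)
    have "frac (\<ominus> x) s \<oplus>\<^bsub>loc\<^esub> U = frac (\<ominus> x \<otimes> s \<oplus> x \<otimes> s) (s \<otimes> s)"
      using x by (simp add: loc_add)
    also have "\<dots> = \<zero>\<^bsub>loc\<^esub>"
      unfolding loc_zero using x by (intro frac_cong) (simp_all add: l_minus l_neg)
    finally show ?thesis using x frac_closed by blast
  qed
  show "U \<oplus>\<^bsub>loc\<^esub> V \<in> carrier loc" "U \<otimes>\<^bsub>loc\<^esub> V \<in> carrier loc"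
    if "U \<in> carrier loc" "V \<in> carrier loc" for U V
    using that by (auto simp: loc_carrier[of U] loc_carrier[of V] loc_add loc_mult intro!: frac_closed)
  show "U \<oplus>\<^bsub>loc\<^esub> V = V \<oplus>\<^bsub>loc\<^esub> U" "U \<otimes>\<^bsub>loc\<^esub> V = V \<otimes>\<^bsub>loc\<^esub> U"
    if "U \<in> carrier loc" "V \<in> carrier loc" for U V
    using that by (auto simp: loc_carrier loc_add loc_mult m_comm a_comm)
  show "U \<oplus>\<^bsub>loc\<^esub> V \<oplus>\<^bsub>loc\<^esub> W = U \<oplus>\<^bsub>loc\<^esub> (V \<oplus>\<^bsub>loc\<^esub> W)"
      "U \<otimes>\<^bsub>loc\<^esub> V \<otimes>\<^bsub>loc\<^esub> W = U \<otimes>\<^bsub>loc\<^esub> (V \<otimes>\<^bsub>loc\<^esub> W)"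
      "(U \<oplus>\<^bsub>loc\<^esub> V) \<otimes>\<^bsub>loc\<^esub> W = U \<otimes>\<^bsub>loc\<^esub> W \<oplus>\<^bsub>loc\<^esub> V \<otimes>\<^bsub>loc\<^esub> W"
    if UVW: "U \<in> carrier loc" "V \<in> carrier loc" "W \<in> carrier loc" for U V W
  proof -
    obtain x s y t z r where x: "x \<in> carrier R" "s \<in> S" "y \<in> carrier R" "t \<in> S"
        "z \<in> carrier R" "r \<in> S" and eq: "U = frac x s" "V = frac y t" "W = frac z r"
      using UVW unfolding loc_carrier by blast
    show "U \<oplus>\<^bsub>loc\<^esub> V \<oplus>\<^bsub>loc\<^esub> W = U \<oplus>\<^bsub>loc\<^esub> (V \<oplus>\<^bsub>loc\<^esub> W)"
        "U \<otimes>\<^bsub>loc\<^esub> V \<otimes>\<^bsub>loc\<^esub> W = U \<otimes>\<^bsub>loc\<^esub> (V \<otimes>\<^bsub>loc\<^esub> W)"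
        "(U \<oplus>\<^bsub>loc\<^esub> V) \<otimes>\<^bsub>loc\<^esub> W = U \<otimes>\<^bsub>loc\<^esub> W \<oplus>\<^bsub>loc\<^esub> V \<otimes>\<^bsub>loc\<^esub> W"
      unfolding eq using x by (simp_all add: loc_add loc_mult)
        (rule frac_cong; simp add: m_ac a_ac l_distr r_distr)+
  qed
  show "\<zero>\<^bsub>loc\<^esub> \<oplus>\<^bsub>loc\<^esub> U = U" "\<one>\<^bsub>loc\<^esub> \<otimes>\<^bsub>loc\<^esub> U = U" if "U \<in> carrier loc" for U
    using that by (auto simp: loc_carrier loc_zero loc_one loc_add loc_mult)
qed (auto simp: loc_zero loc_one frac_closed)

lemma frac_hom: "(\<lambda>x. frac x \<one>) \<in> ring_hom R loc"
  by (auto simp: ring_hom_def loc_mult loc_add loc_one frac_closed)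

lemma frac_eq_zero_iff:
  assumes "x \<in> carrier R" "s \<in> S" shows "frac x s = \<zero>\<^bsub>loc\<^esub> \<longleftrightarrow> (\<exists>u\<in>S. u \<otimes> x = \<zero>)"
  using assms by (simp add: loc_zero frac_eq_iff)

lemma frac_pow:
  assumes "x \<in> carrier R" shows "frac x \<one> [^]\<^bsub>loc\<^esub> (n::nat) = frac (x [^] n) \<one>"
proof -
  interpret L: cring loc by (rule loc_cring)
  show ?thesis using assms by (induction n) (simp_all add: loc_one loc_mult)
qed

end

text \<open>The complement of a maximal such \<open>S\<close> is a minimal prime ideal. The last
  clause is the form in which maximality is used later: adjoining the powers of some
  \<open>x \<notin> S\<close> must produce zero.\<close>

lemma (in cring) maximal_submonoid_avoiding_zero:
  assumes "\<one> \<noteq> \<zero>"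
  obtains S where "submonoid S R" "\<zero> \<notin> S"
    "\<And>x. x \<in> carrier R \<Longrightarrow> x \<notin> S \<Longrightarrow> \<exists>s\<in>S. \<exists>n::nat. s \<otimes> x [^] n = \<zero>"
proof -
  let ?F = "{S. submonoid S R \<and> \<zero> \<notin> S}"
  have "\<exists>M\<in>?F. \<forall>N\<in>?F. M \<subseteq> N \<longrightarrow> N = M"
  proof (rule subset_Zorn_nonempty)
    have "submonoid {\<one>} R" by unfold_locales auto
    then have "{\<one>} \<in> ?F" using assms by simp
    then show "?F \<noteq> {}" by (rule ex_in_conv[THEN iffD1, OF exI])
  next
    fix C assume "C \<noteq> {}" and C: "subset.chain ?F C"
    then have C1: "\<And>S. S \<in> C \<Longrightarrow> submonoid S R \<and> \<zero> \<notin> S"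
      and C2: "\<And>S S'. S \<in> C \<Longrightarrow> S' \<in> C \<Longrightarrow> S \<subseteq> S' \<or> S' \<subseteq> S"
      unfolding subset_chain_def by blast+
    have "submonoid (\<Union>C) R"
    proof
      show "\<Union>C \<subseteq> carrier R" using C1 by (intro Union_least submonoid.subset) simp
      show "\<one> \<in> \<Union>C"
      proof -
        obtain S where "S \<in> C" using \<open>C \<noteq> {}\<close> by blast
        then show ?thesis using submonoid.one_closed[of S R] C1[of S] by blast
      qed
      show "x \<otimes> y \<in> \<Union>C" if xy: "x \<in> \<Union>C" "y \<in> \<Union>C" for x y
      proof -
        obtain S S' where S: "S \<in> C" "S' \<in> C" "x \<in> S" "y \<in> S'" using xy by blast
        then obtain S'' where S'': "S'' \<in> C" "x \<in> S''" "y \<in> S''" using C2[of S S'] by blast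
        then have "x \<otimes> y \<in> S''" using submonoid.m_closed[of S'' R x y] C1 by blast
        then show ?thesis using S'' by blast
      qed
    qed
    then show "\<Union>C \<in> ?F" using C1 by blast
  qed
  then obtain S where S: "S \<in> ?F" and max: "\<forall>N\<in>?F. S \<subseteq> N \<longrightarrow> N = S" by (rule bexE)
  have sub: "submonoid S R" and zero: "\<zero> \<notin> S" using S by auto
  note SR = submonoid.mem_carrier[OF sub] and S1 = submonoid.one_closed[OF sub]
  have "\<exists>s\<in>S. \<exists>n::nat. s \<otimes> x [^] n = \<zero>" if x: "x \<in> carrier R" "x \<notin> S" for x
  proof (rule ccontr)
    assume no: "\<not> ?thesis"
    \<comment> \<open>The submonoid generated by \<open>S\<close> and \<open>x\<close>. It avoids
      zero by \<open>no\<close>, so maximality makes it equal to \<open>S\<close>, although it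
      contains \<open>x\<close>.\<close>
    let ?S = "{s \<otimes> x [^] n | s n. s \<in> S \<and> n \<in> (UNIV :: nat set)}"
    have sub': "submonoid ?S R"
    proof
      show "?S \<subseteq> carrier R" using SR x by auto
      have "\<one> = \<one> \<otimes> x [^] (0::nat)" using x by simp
      then show "\<one> \<in> ?S" using S1 by blast
      fix y z assume "y \<in> ?S" "z \<in> ?S"
      then obtain s t and m n :: nat where st: "s \<in> S" "t \<in> S" "y = s \<otimes> x [^] m" "z = t \<otimes> x [^] n"
        by blast
      have "y \<otimes> z = (s \<otimes> t) \<otimes> x [^] (m + n)"
        using SR[OF st(1)] SR[OF st(2)] x by (simp add: st(3,4) nat_pow_mult[symmetric] m_ac)
      moreover have "s \<otimes> t \<in> S" using st submonoid.m_closed[OF sub] by simp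
      ultimately show "y \<otimes> z \<in> ?S" by blast
    qed
    have zero': "\<zero> \<notin> ?S"
    proof
      assume "\<zero> \<in> ?S"
      then obtain s and n :: nat where "s \<in> S" "\<zero> = s \<otimes> x [^] n" by blast
      then show False using no by metis
    qed
    have "S \<subseteq> ?S"
    proof
      fix s assume s: "s \<in> S"
      then have "s = s \<otimes> x [^] (0::nat)" using SR by simp
      then show "s \<in> ?S" using s by blast
    qed
    moreover have "?S \<in> ?F" using sub' zero' by (intro CollectI conjI)
    ultimately have "?S = S" using mp[OF bspec[OF max]] by simp
    moreover have "x = \<one> \<otimes> x [^] (1::nat)" using x by simp
    then have "x \<in> ?S" using S1 by blast
    ultimately show False using x by blast
  qed
  then show ?thesis using that[OF sub zero] by blast
qed

section \<open>Passage of the hypotheses to the localization\<close>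

context localization begin

lemma frac_split:
  assumes "x \<in> carrier R" "s \<in> S"
  shows "frac x s = frac x \<one> \<otimes>\<^bsub>loc\<^esub> frac \<one> s" "frac x \<one> = frac x s \<otimes>\<^bsub>loc\<^esub> frac s \<one>"
  using assms by (simp_all add: loc_mult) (rule frac_cong; simp add: m_ac)

lemma nilpotent_frac_iff:
  assumes "x \<in> carrier R" "s \<in> S"
  shows "nilpotent_elem loc (frac x s) \<longleftrightarrow> nilpotent_elem loc (frac x \<one>)"
proof -
  interpret T: cring loc by (rule loc_cring)
  show ?thesis using T.nilpotent_mult assms frac_split[OF assms] frac_closed S_closed S_one one_closed
    by metis
qed

text \<open>For \<open>x \<in> S\<close> the fraction \<open>x/s\<close> has the inverse
  \<open>s/x\<close>. For \<open>x \<notin> S\<close> the relation \<open>t x^n = 0\<close> with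
  \<open>t \<in> S\<close> makes \<open>x^n\<close> vanish in the localization.\<close>

lemma loc_unit_or_nilpotent:
  assumes "\<zero> \<notin> S"
    and max: "\<And>x. x \<in> carrier R \<Longrightarrow> x \<notin> S \<Longrightarrow> \<exists>s\<in>S. \<exists>n::nat. s \<otimes> x [^] n = \<zero>"
  shows "unit_or_nilpotent loc"
proof (intro unit_or_nilpotent.intro loc_cring unit_or_nilpotent_axioms.intro)
  show "\<one>\<^bsub>loc\<^esub> \<noteq> \<zero>\<^bsub>loc\<^esub>"
    unfolding loc_one using assms(1) by (auto simp: frac_eq_zero_iff)
  fix U assume "U \<in> carrier loc"
  then obtain x s where x: "x \<in> carrier R" and s: "s \<in> S" and U: "U = frac x s"
    by (auto simp: loc_carrier)
  show "U \<in> Units loc \<or> nilpotent_elem loc U"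
  proof (cases "x \<in> S")
    case True
    have "frac (s \<otimes> x) (x \<otimes> s) = frac \<one> \<one>" "frac (x \<otimes> s) (s \<otimes> x) = frac \<one> \<one>"
      by (rule frac_cong; use True x s m_comm[of x s] in simp)+
    then have "frac s x \<otimes>\<^bsub>loc\<^esub> U = \<one>\<^bsub>loc\<^esub>" "U \<otimes>\<^bsub>loc\<^esub> frac s x = \<one>\<^bsub>loc\<^esub>"
      unfolding U loc_one loc_mult[OF S_closed[OF s] True x s] loc_mult[OF x s S_closed[OF s] True] .
    moreover have "frac s x \<in> carrier loc" "U \<in> carrier loc" using True s U by (auto intro: frac_closed)
    ultimately have "U \<in> Units loc" unfolding Units_def by blast
    then show ?thesis ..
  next
    case False
    then obtain t and n :: nat where "t \<in> S" "t \<otimes> x [^] n = \<zero>" using max x by blast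
    then have "frac x \<one> [^]\<^bsub>loc\<^esub> n = \<zero>\<^bsub>loc\<^esub>"
      using x by (auto simp: frac_pow frac_eq_zero_iff)
    then have "nilpotent_elem loc (frac x \<one>)" unfolding nilpotent_elem_def ..
    then show ?thesis using nilpotent_frac_iff[OF x s] U by blast
  qed
qed

text \<open>If \<open>a x / s\<close> vanishes, some \<open>u \<in> S\<close> gives
  \<open>a (u x) = 0\<close>; then \<open>u x = a y\<close> for some \<open>y\<close>, and
  \<open>x/s = a (y/(u s))\<close>.\<close>

lemma loc_annihilator:
  assumes a: "a \<in> carrier R"
    and ann: "\<And>x. x \<in> carrier R \<Longrightarrow> a \<otimes> x = \<zero> \<Longrightarrow> \<exists>u\<in>carrier R. x = a \<otimes> u"
    and U: "U \<in> carrier loc" "frac a \<one> \<otimes>\<^bsub>loc\<^esub> U = \<zero>\<^bsub>loc\<^esub>"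
  shows "\<exists>V\<in>carrier loc. U = frac a \<one> \<otimes>\<^bsub>loc\<^esub> V"
proof -
  obtain x s where x: "x \<in> carrier R" and s: "s \<in> S" and U': "U = frac x s"
    using U by (auto simp: loc_carrier)
  then obtain u where u: "u \<in> S" "u \<otimes> (a \<otimes> x) = \<zero>"
    using U(2) a by (auto simp: loc_mult frac_eq_zero_iff)
  then have "a \<otimes> (u \<otimes> x) = \<zero>" using a x by (simp add: m_lcomm)
  then obtain y where y: "y \<in> carrier R" "u \<otimes> x = a \<otimes> y" using ann[of "u \<otimes> x"] u x by auto
  have "frac x s = frac (a \<otimes> y) (u \<otimes> s)"
    unfolding y(2)[symmetric] using x s u by (intro frac_cong) (auto simp: m_ac)
  also have "\<dots> = frac a \<one> \<otimes>\<^bsub>loc\<^esub> frac y (u \<otimes> s)" using a y s u by (simp add: loc_mult)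
  finally show ?thesis using U' y s u by (auto intro!: bexI[of _ "frac y (u \<otimes> s)"] frac_closed)
qed

text \<open>Here the Noetherian hypothesis enters. The preimage of the nilradical in
  \<open>R\<close> is finitely generated, and the images of its generators suffice because
  \<open>x/s\<close> is a multiple of \<open>x/1\<close>.\<close>

lemma loc_nilradical_finitely_generated:
  assumes noeth: "noetherian_ring R" and T: "unit_or_nilpotent loc"
  shows "\<exists>G. finite G \<and> G \<subseteq> carrier loc \<and> (\<forall>U\<in>G. nilpotent_elem loc U) \<and>
    (\<forall>U\<in>carrier loc. nilpotent_elem loc U \<longrightarrow> U \<in> Idl\<^bsub>loc\<^esub> G)"
proof -
  interpret T: unit_or_nilpotent loc by fact
  interpret h: ring_hom_ring R loc "\<lambda>x. frac x \<one>"
    by (rule ring_hom_ringI2[OF ring_axioms T.ring_axioms frac_hom])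
  let ?P = "{x \<in> carrier R. frac x \<one> \<in> {U \<in> carrier loc. nilpotent_elem loc U}}"
  have "ideal ?P R" by (rule h.ideal_vimage[OF T.nilpotent_ideal])
  then obtain G where G: "G \<subseteq> carrier R" "finite G" "?P = Idl G"
    using noetherian_ring.finetely_gen[OF noeth] by blast
  let ?G = "(\<lambda>x. frac x \<one>) ` G"
  have GT: "?G \<subseteq> carrier loc" using G frac_closed S_one by blast
  have "G \<subseteq> ?P" using genideal_self[OF G(1)] G(3) by simp
  then have "\<forall>U\<in>?G. nilpotent_elem loc U" by blast
  moreover have "U \<in> Idl\<^bsub>loc\<^esub> ?G" if U: "U \<in> carrier loc" "nilpotent_elem loc U" for U
  proof -
    obtain x s where x: "x \<in> carrier R" and s: "s \<in> S" and U': "U = frac x s"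
      using U by (auto simp: loc_carrier)
    have "x \<in> Idl G" using nilpotent_frac_iff[OF x s] U U' x frac_closed G(3) by auto
    moreover have "Idl G \<subseteq> {x \<in> carrier R. frac x \<one> \<in> Idl\<^bsub>loc\<^esub> ?G}"
      using T.genideal_self[OF GT] G(1)
      by (intro genideal_minimal h.ideal_vimage T.genideal_ideal GT) auto
    ultimately have "frac x \<one> \<in> Idl\<^bsub>loc\<^esub> ?G" by blast
    then have "frac x \<one> \<otimes>\<^bsub>loc\<^esub> frac \<one> s \<in> Idl\<^bsub>loc\<^esub> ?G"
      using ideal.I_r_closed[OF T.genideal_ideal[OF GT]] frac_closed s by simp
    then show ?thesis using frac_split(1)[OF x s] U' by simp
  qed
  ultimately show ?thesis using G(2) GT by (intro exI[of _ ?G]) simp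
qed

end

section \<open>Polynomials and coefficient fields\<close>

context cring begin

text \<open>Coefficients are listed by increasing degree, so a monic polynomial of degree
  \<open>length p\<close> is \<open>p @ [\<one>]\<close>.\<close>

primrec horner :: "'a list \<Rightarrow> 'a \<Rightarrow> 'a" where
  "horner [] x = \<zero>"
| "horner (c # p) x = c \<oplus> x \<otimes> horner p x"

primrec horner_deriv :: "'a list \<Rightarrow> 'a \<Rightarrow> 'a" where
  "horner_deriv [] x = \<zero>"
| "horner_deriv (c # p) x = horner p x \<oplus> x \<otimes> horner_deriv p x"

lemma horner_closed [simp]: "set p \<subseteq> carrier R \<Longrightarrow> x \<in> carrier R \<Longrightarrow> horner p x \<in> carrier R"
  by (induction p) auto

lemma horner_deriv_closed [simp]:
  "set p \<subseteq> carrier R \<Longrightarrow> x \<in> carrier R \<Longrightarrow> horner_deriv p x \<in> carrier R"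
  by (induction p) auto

text \<open>The remainder is just some ring element, which avoids division by factorials. The Newton
  step uses the second-order form; \<open>horner_diff\<close> weakens it to first order.\<close>

lemma horner_taylor:
  assumes "set p \<subseteq> carrier R" "x \<in> carrier R" "h \<in> carrier R"
  shows "\<exists>r\<in>carrier R. horner p (x \<oplus> h) = horner p x \<oplus> h \<otimes> horner_deriv p x \<oplus> h \<otimes> h \<otimes> r"
  using assms(1)
proof (induction p)
  case Nil
  then show ?case using assms by (intro bexI[of _ \<zero>]) auto
next
  case (Cons c p)
  let ?P = "horner p x" and ?D = "horner_deriv p x"
  obtain r where r: "r \<in> carrier R" and eq: "horner p (x \<oplus> h) = ?P \<oplus> h \<otimes> ?D \<oplus> h \<otimes> h \<otimes> r"
    using Cons by auto
  have cl: "?P \<in> carrier R" "?D \<in> carrier R" "c \<in> carrier R" using Cons assms by auto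
  have "c \<oplus> (x \<oplus> h) \<otimes> (?P \<oplus> h \<otimes> ?D \<oplus> h \<otimes> h \<otimes> r) =
      c \<oplus> x \<otimes> ?P \<oplus> h \<otimes> (?P \<oplus> x \<otimes> ?D) \<oplus> h \<otimes> h \<otimes> (?D \<oplus> (x \<oplus> h) \<otimes> r)"
    using cl r assms(2,3) by algebra
  then show ?case using eq r cl assms(2,3) by (intro bexI[of _ "?D \<oplus> (x \<oplus> h) \<otimes> r"]) auto
qed

lemma horner_diff:
  assumes "set p \<subseteq> carrier R" "x \<in> carrier R" "h \<in> carrier R"
  shows "\<exists>r\<in>carrier R. horner p (x \<oplus> h) = horner p x \<oplus> h \<otimes> r"
proof -
  obtain r where "r \<in> carrier R"
    "horner p (x \<oplus> h) = horner p x \<oplus> h \<otimes> horner_deriv p x \<oplus> h \<otimes> h \<otimes> r"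
    using horner_taylor[OF assms] by blast
  then show ?thesis using assms
    by (intro bexI[of _ "horner_deriv p x \<oplus> h \<otimes> r"]) (auto simp: r_distr m_assoc a_assoc)
qed

lemma horner_deriv_diff:
  assumes "set p \<subseteq> carrier R" "x \<in> carrier R" "h \<in> carrier R"
  shows "\<exists>r\<in>carrier R. horner_deriv p (x \<oplus> h) = horner_deriv p x \<oplus> h \<otimes> r"
  using assms(1)
proof (induction p)
  case Nil
  then show ?case using assms by (intro bexI[of _ \<zero>]) auto
next
  case (Cons c p)
  let ?P = "horner p x" and ?D = "horner_deriv p x"
  obtain r where r: "r \<in> carrier R" and eq: "horner_deriv p (x \<oplus> h) = ?D \<oplus> h \<otimes> r"
    using Cons by auto
  obtain r' where r': "r' \<in> carrier R" and eq': "horner p (x \<oplus> h) = ?P \<oplus> h \<otimes> r'"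
    using horner_diff[of p x h] Cons assms by auto
  have cl: "?P \<in> carrier R" "?D \<in> carrier R" "c \<in> carrier R" using Cons assms by auto
  have "(?P \<oplus> h \<otimes> r') \<oplus> (x \<oplus> h) \<otimes> (?D \<oplus> h \<otimes> r) =
      ?P \<oplus> x \<otimes> ?D \<oplus> h \<otimes> (r' \<oplus> ?D \<oplus> (x \<oplus> h) \<otimes> r)"
    using cl r r' assms(2,3) by algebra
  then show ?case using eq eq' r r' cl assms(2,3)
    by (intro bexI[of _ "r' \<oplus> ?D \<oplus> (x \<oplus> h) \<otimes> r"]) auto
qed

lemma horner_map2_add:
  assumes "length p = length q" "set p \<subseteq> carrier R" "set q \<subseteq> carrier R" "x \<in> carrier R"
  shows "horner (map2 (\<oplus>) p q) x = horner p x \<oplus> horner q x"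
  using assms(1-3)
proof (induction rule: list_induct2)
  case Nil then show ?case by simp
next
  case (Cons c p d q)
  have "c \<oplus> d \<oplus> x \<otimes> (horner p x \<oplus> horner q x) = (c \<oplus> x \<otimes> horner p x) \<oplus> (d \<oplus> x \<otimes> horner q x)"
    if "horner p x \<in> carrier R" "horner q x \<in> carrier R" "c \<in> carrier R" "d \<in> carrier R"
    using that assms(4) by algebra
  then show ?case using Cons assms(4) by simp
qed

lemma horner_scale:
  assumes "set p \<subseteq> carrier R" "x \<in> carrier R" "c \<in> carrier R"
  shows "horner (map ((\<otimes>) c) p) x = c \<otimes> horner p x"
  using assms by (induction p) (auto simp: r_distr m_lcomm)

lemma horner_snoc:
  assumes "set p \<subseteq> carrier R" "x \<in> carrier R" "c \<in> carrier R"
  shows "horner (p @ [c]) x = horner p x \<oplus> c \<otimes> x [^] length p"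
  using assms(1)
proof (induction p)
  case Nil
  then show ?case using assms by simp
next
  case (Cons d p)
  have "x [^] length p \<in> carrier R" "horner p x \<in> carrier R" "d \<in> carrier R"
    using Cons assms by auto
  then have "d \<oplus> x \<otimes> (horner p x \<oplus> c \<otimes> x [^] length p) =
      d \<oplus> x \<otimes> horner p x \<oplus> c \<otimes> (x [^] length p \<otimes> x)"
    using assms(2,3) by algebra
  then show ?case using Cons by simp
qed

lemma set_map2_add:
  assumes "subring L R" "set p \<subseteq> L" "set q \<subseteq> L"
  shows "set (map2 (\<oplus>) p q) \<subseteq> L"
proof
  fix z assume "z \<in> set (map2 (\<oplus>) p q)"
  then obtain a b where "(a, b) \<in> set (zip p q)" "z = a \<oplus> b" by auto
  then show "z \<in> L"
    using assms(2,3) subringE(7)[OF assms(1)] set_zip_leftD[of a b p q] set_zip_rightD[of a b p q]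
    by blast
qed

text \<open>Serves to compare the derivative with a polynomial of least degree in
  \<open>coefficient_field\<close>: the list \<open>q\<close> has one entry fewer than
  \<open>p @ [c]\<close>, and its leading coefficient, \<open>n c\<close> with
  \<open>n = length p\<close>, is nonzero for \<open>c = \<one>\<close> in characteristic
  zero.\<close>

lemma horner_deriv_snoc:
  assumes L: "subring L R" and "set p \<subseteq> L" "c \<in> L" "x \<in> carrier R"
  shows "\<exists>q. length q = length p \<and> set q \<subseteq> L \<and> horner_deriv (p @ [c]) x = horner q x \<and>
    (p \<noteq> [] \<longrightarrow> last q = add_pow R (length p) c)"
  using assms(2)
proof (induction p)
  case Nil
  then show ?case using assms by simp
next
  case (Cons d p)
  note LR = subringE(1)[OF L]
  have c: "c \<in> carrier R" using assms LR by blast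
  obtain q where q: "length q = length p" "set q \<subseteq> L" "horner_deriv (p @ [c]) x = horner q x"
    "p \<noteq> [] \<longrightarrow> last q = add_pow R (length p) c" using Cons by auto
  \<comment> \<open>The derivative of \<open>d + x P\<close> is \<open>P + x P'\<close>; prepending
    \<open>\<zero>\<close> to \<open>q\<close> is multiplication by \<open>x\<close>.\<close>
  let ?q = "map2 (\<oplus>) (p @ [c]) (\<zero> # q)"
  have "horner ?q x = horner (p @ [c]) x \<oplus> horner (\<zero> # q) x"
    using q Cons.prems LR c assms by (intro horner_map2_add) auto
  also have "\<dots> = horner_deriv ((d # p) @ [c]) x" using q(2) LR assms by (simp add: q(3) order_trans)
  finally have 1: "horner_deriv ((d # p) @ [c]) x = horner ?q x" by simp
  have 2: "set ?q \<subseteq> L" using q Cons.prems assms subringE(2)[OF L]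
    by (intro set_map2_add) auto
  have "last ?q = last (p @ [c]) \<oplus> last (\<zero> # q)"
    using q(1) by (subst last_map) (auto simp: last_zip simp del: last.simps)
  also have "\<dots> = add_pow R (length (d # p)) c"
    using q c by (cases "p = []") (auto simp: a_comm)
  finally show ?case using 1 2 q(1) by (intro exI[of _ ?q]) simp
qed

end

context cring begin

text \<open>Newton iteration: each step multiplies the error by \<open>p(x)\<close>, which is nilpotent.\<close>

lemma horner_root_lift:
  assumes p: "set p \<subseteq> carrier R" and x: "x \<in> carrier R"
    and nil: "nilpotent_elem R (horner p x)"
    and unit: "\<And>z. z \<in> carrier R \<Longrightarrow> horner_deriv p x \<oplus> horner p x \<otimes> z \<in> Units R"
  shows "\<exists>z\<in>carrier R. horner p (x \<oplus> horner p x \<otimes> z) = \<zero>"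
proof -
  let ?e = "horner p x"
  have e: "?e \<in> carrier R" using p x by simp
  have step: "\<exists>z\<in>carrier R. \<exists>w\<in>carrier R. horner p (x \<oplus> ?e \<otimes> z) = ?e [^] (n::nat) \<otimes> ?e \<otimes> w" for n
  proof (induction n)
    case 0
    show ?case using e x by (intro bexI[of _ \<zero>] bexI[of _ \<one>]) auto
  next
    case (Suc n)
    then obtain z w where z: "z \<in> carrier R" and w: "w \<in> carrier R"
      and eq: "horner p (x \<oplus> ?e \<otimes> z) = ?e [^] n \<otimes> ?e \<otimes> w" by blast
    let ?y = "x \<oplus> ?e \<otimes> z" and ?E = "?e [^] n"
    let ?d = "horner_deriv p ?y"
    have y: "?y \<in> carrier R" and E: "?E \<in> carrier R" using x e z by auto
    \<comment> \<open>The derivative at the moved point \<open>?y\<close> differs from the one at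
      \<open>x\<close> by a multiple of \<open>?e\<close>, which is the form that the hypothesis
      \<open>unit\<close> covers.\<close>
    obtain r where r: "r \<in> carrier R" "?d = horner_deriv p x \<oplus> (?e \<otimes> z) \<otimes> r"
      using horner_deriv_diff[OF p x, of "?e \<otimes> z"] e z by auto
    have d: "?d \<in> Units R" using r unit[of "z \<otimes> r"] e z by (simp add: m_assoc)
    let ?v = "inv ?d"
    have v: "?v \<in> carrier R" using d by simp
    let ?h = "\<ominus> (?E \<otimes> ?e \<otimes> w \<otimes> ?v)"
    have h: "?h \<in> carrier R" using E e w v by simp
    obtain s where s: "s \<in> carrier R" and
      "horner p (?y \<oplus> ?h) = horner p ?y \<oplus> ?h \<otimes> ?d \<oplus> ?h \<otimes> ?h \<otimes> s"
      using horner_taylor[OF p y h] by blast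
    moreover have "?h \<otimes> ?d = \<ominus> (?E \<otimes> ?e \<otimes> w)"
      using E e w v d Units_closed[OF d] by (simp add: l_minus m_assoc)
    ultimately have "horner p (?y \<oplus> ?h) = ?h \<otimes> ?h \<otimes> s"
      using E e w h s by (simp add: eq r_neg)
    \<comment> \<open>The new error is a multiple of the square of the old one. One extra factor
      \<open>?e\<close> is recorded and the rest goes into the cofactor, since linear progress
      suffices.\<close>
    also have "\<dots> = (?E \<otimes> ?e) \<otimes> ?e \<otimes> (?E \<otimes> w \<otimes> ?v \<otimes> w \<otimes> ?v \<otimes> s)"
      using E e w v s by (simp add: l_minus r_minus m_ac)
    also have "?y \<oplus> ?h = x \<oplus> ?e \<otimes> (z \<oplus> \<ominus> (?E \<otimes> w \<otimes> ?v))"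
      using x E e w v z by (simp add: r_distr r_minus m_ac a_assoc)
    finally show ?case using E e w v s z
      by (intro bexI[of _ "z \<oplus> \<ominus> (?E \<otimes> w \<otimes> ?v)"] bexI[of _ "?E \<otimes> w \<otimes> ?v \<otimes> w \<otimes> ?v \<otimes> s"]) auto
  qed
  obtain n :: nat where n: "?e [^] n = \<zero>" using nil by (auto simp: nilpotent_elem_def)
  obtain z w where "z \<in> carrier R" "w \<in> carrier R"
      "horner p (x \<oplus> ?e \<otimes> z) = ?e [^] n \<otimes> ?e \<otimes> w"
    using step[of n] by blast
  then show ?thesis using e n by auto
qed

section \<open>Simple extensions L[x] of a subring L\<close>

lemma horner_zeros: "set p \<subseteq> {\<zero>} \<Longrightarrow> x \<in> carrier R \<Longrightarrow> horner p x = \<zero>"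
  by (induction p) auto

lemma horner_add_closed:
  assumes L: "subring L R" and x: "x \<in> carrier R" and "set p \<subseteq> L" "set q \<subseteq> L"
  shows "\<exists>r. set r \<subseteq> L \<and> horner r x = horner p x \<oplus> horner q x"
proof -
  note LR = subringE(1)[OF L] and L0 = subringE(2)[OF L]
  \<comment> \<open>\<open>map2\<close> stops at the shorter list, so both lists are padded with
    zeros to a common length.\<close>
  let ?pad = "\<lambda>n p. p @ replicate n \<zero>"
  have pad: "horner (?pad n p) x = horner p x" if "set p \<subseteq> L" for n p
    using that
  proof (induction p)
    case Nil
    have "set (replicate n \<zero>) \<subseteq> {\<zero>}" by auto
    then show ?case using x horner_zeros by simp
  qed simp
  let ?p = "?pad (length q) p" and ?q = "?pad (length p) q"
  have sub: "set ?p \<subseteq> L" "set ?q \<subseteq> L" using assms L0 by auto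
  then have "horner (map2 (\<oplus>) ?p ?q) x = horner p x \<oplus> horner q x"
    using LR x assms by (subst horner_map2_add) (auto simp: pad)
  then show ?thesis using set_map2_add[OF L sub] by blast
qed

lemma horner_mult_closed:
  assumes L: "subring L R" and x: "x \<in> carrier R" and "set p \<subseteq> L" and q: "set q \<subseteq> L"
  shows "\<exists>r. set r \<subseteq> L \<and> horner r x = horner p x \<otimes> horner q x"
  using assms(3)
proof (induction p)
  case Nil
  show ?case using x q subringE(1)[OF L] by (intro exI[of _ "[]"]) (simp add: order_trans)
next
  case (Cons c p)
  note LR = subringE(1)[OF L]
  obtain r where r: "set r \<subseteq> L" "horner r x = horner p x \<otimes> horner q x" using Cons by auto
  have R: "set p \<subseteq> carrier R" "set q \<subseteq> carrier R" "c \<in> carrier R" using Cons.prems q LR by auto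
  have "set (map ((\<otimes>) c) q) \<subseteq> L" "set (\<zero> # r) \<subseteq> L"
    using Cons.prems q r subringE(2,6)[OF L] by auto
  then obtain s where s: "set s \<subseteq> L" "horner s x = horner (map ((\<otimes>) c) q) x \<oplus> horner (\<zero> # r) x"
    using horner_add_closed[OF L x] by blast
  have "horner s x = horner (c # p) x \<otimes> horner q x"
    using s(2) r(2) R x by (simp add: horner_scale l_distr m_assoc)
  then show ?case using s by blast
qed

definition adjoin :: "'a set \<Rightarrow> 'a \<Rightarrow> 'a set"
  where "adjoin L x = {horner p x | p. set p \<subseteq> L}"

lemma adjoin_incl: "L \<subseteq> carrier R \<Longrightarrow> x \<in> carrier R \<Longrightarrow> L \<subseteq> adjoin L x"
proof
  fix c assume "L \<subseteq> carrier R" "x \<in> carrier R" "c \<in> L"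
  then have "c = horner [c] x" "set [c] \<subseteq> L" by auto
  then show "c \<in> adjoin L x" unfolding adjoin_def by blast
qed

lemma adjoin_mem: "subring L R \<Longrightarrow> x \<in> carrier R \<Longrightarrow> x \<in> adjoin L x"
proof -
  assume L: "subring L R" and x: "x \<in> carrier R"
  then have "x = horner [\<zero>, \<one>] x" "set [\<zero>, \<one>] \<subseteq> L" using subringE(2,3)[OF L] by auto
  then show ?thesis unfolding adjoin_def by blast
qed

lemma adjoin_subring:
  assumes L: "subring L R" and x: "x \<in> carrier R" shows "subring (adjoin L x) R"
proof (rule subringI)
  note LR = subringE(1)[OF L]
  show "adjoin L x \<subseteq> carrier R" using x LR horner_closed by (force simp: adjoin_def)
  show "\<one> \<in> adjoin L x" using adjoin_incl[OF LR x] subringE(3)[OF L] by blast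
  show "y \<otimes> z \<in> adjoin L x" "y \<oplus> z \<in> adjoin L x"
    if yz: "y \<in> adjoin L x" "z \<in> adjoin L x" for y z
  proof -
    obtain p q where "set p \<subseteq> L" "set q \<subseteq> L" "y = horner p x" "z = horner q x"
      using yz by (auto simp: adjoin_def)
    then show "y \<otimes> z \<in> adjoin L x" "y \<oplus> z \<in> adjoin L x"
      using horner_mult_closed[OF L x, of p q] horner_add_closed[OF L x, of p q]
      unfolding adjoin_def by (metis (mono_tags, lifting) CollectI)+
  qed
  show "\<ominus> y \<in> adjoin L x" if y: "y \<in> adjoin L x" for y
  proof -
    obtain p where p: "set p \<subseteq> L" "y = horner p x" using y by (auto simp: adjoin_def)
    then have "\<ominus> y = horner (map ((\<otimes>) (\<ominus> \<one>)) p) x"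
      using LR x by (simp add: horner_scale l_minus order_trans)
    moreover have "set (map ((\<otimes>) (\<ominus> \<one>)) p) \<subseteq> L" using p subringE(3,5,6)[OF L] by auto
    ultimately show ?thesis unfolding adjoin_def by blast
  qed
qed

text \<open>Division with remainder by the monic \<open>p @ [\<one>]\<close>, carried out on values:
  multiplying a reduced \<open>q' @ [c]\<close> by \<open>x\<close> creates a single term
  \<open>c x^n\<close> of degree \<open>n = length p\<close>, and \<open>x^n\<close> equals
  \<open>- horner p x\<close>.\<close>

lemma horner_reduce_monic:
  assumes L: "subring L R" and x: "x \<in> carrier R" and "set r \<subseteq> L"
    and p: "set p \<subseteq> L" "horner (p @ [\<one>]) x = \<zero>" and "p \<noteq> []"
  shows "\<exists>q. set q \<subseteq> L \<and> length q = length p \<and> horner r x = horner q x"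
  using assms(3)
proof (induction r)
  case Nil
  have "horner (replicate (length p) \<zero>) x = \<zero>" using x by (intro horner_zeros) auto
  then show ?case using subringE(2)[OF L]
    by (intro exI[of _ "replicate (length p) \<zero>"]) auto
next
  case (Cons k2 r)
  note LR = subringE(1)[OF L]
  obtain q where q: "set q \<subseteq> L" "length q = length p" "horner r x = horner q x"
    using Cons by auto
  obtain q' c where qc: "q = q' @ [c]" using q(2) \<open>p \<noteq> []\<close> by (metis length_0_conv rev_exhaust)
  have c: "c \<in> L" "set q' \<subseteq> L" "length (k2 # q') = length p" using q qc by auto
  have R: "set q \<subseteq> carrier R" "set q' \<subseteq> carrier R" "set p \<subseteq> carrier R" "c \<in> carrier R" "k2 \<in> carrier R"
    using q c p Cons.prems LR by auto
  let ?q = "map2 (\<oplus>) (k2 # q') (map ((\<otimes>) (\<ominus> c)) p)"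
  have "set (map ((\<otimes>) (\<ominus> c)) p) \<subseteq> L" using c p subringE(5,6)[OF L] by auto
  then have 1: "set ?q \<subseteq> L" using Cons.prems c by (intro set_map2_add[OF L]) auto
  have xn: "x [^] length p \<in> carrier R" using x by simp
  have P: "horner p x = \<ominus> (x [^] length p)"
    using p(2) R(3) x by (simp add: horner_snoc minus_equality[symmetric] a_comm)
  have "horner ?q x = horner (k2 # q') x \<oplus> horner (map ((\<otimes>) (\<ominus> c)) p) x"
    using c(3) R x by (intro horner_map2_add) auto
  also have "\<dots> = k2 \<oplus> x \<otimes> horner q' x \<oplus> c \<otimes> x [^] length p"
    using R x xn by (simp add: horner_scale P l_minus r_minus)
  also have "\<dots> = k2 \<oplus> x \<otimes> (horner q' x \<oplus> c \<otimes> x [^] length q')"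
  proof -
    have "x [^] length p = x [^] length q' \<otimes> x" using c(3) by (simp flip: c(3))
    moreover have X: "x [^] length q' \<in> carrier R" "horner q' x \<in> carrier R" using x R by auto
    ultimately show ?thesis using x R(4,5) by (simp add: r_distr m_ac a_ac)
  qed
  also have "\<dots> = horner (k2 # r) x" using q(3) qc R x by (simp add: horner_snoc)
  finally have "horner (k2 # r) x = horner ?q x" by (rule sym)
  then show ?case using 1 c(3) by (intro exI[of _ ?q]) auto
qed

end

section \<open>Coefficient fields by maximality\<close>

context unit_or_nilpotent begin

text \<open>These are the subrings that embed into the residue field modulo nilpotents. Their
  nonzero elements are units of \<open>R\<close>, but the inverses may lie outside
  \<open>L\<close>.\<close>

definition reduced_subring :: "'a set \<Rightarrow> bool"
  where "reduced_subring L \<longleftrightarrow> subring L R \<and> (\<forall>x\<in>L. nilpotent_elem R x \<longrightarrow> x = \<zero>)"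

lemma reduced_subring_Units:
  assumes "reduced_subring L" "x \<in> L" "x \<noteq> \<zero>" shows "x \<in> Units R"
proof -
  have "x \<in> carrier R" using assms subringE(1)[of L] unfolding reduced_subring_def by blast
  then show ?thesis using assms unit_or_nilpotent unfolding reduced_subring_def by blast
qed

lemma reduced_subring_maximal:
  assumes "reduced_subring K"
  obtains L where "reduced_subring L" "K \<subseteq> L"
    "\<And>L'. reduced_subring L' \<Longrightarrow> L \<subseteq> L' \<Longrightarrow> L' = L"
proof -
  let ?F = "{L. reduced_subring L \<and> K \<subseteq> L}"
  have "\<exists>M\<in>?F. \<forall>N\<in>?F. M \<subseteq> N \<longrightarrow> N = M"
  proof (rule subset_Zorn_nonempty)
    show "?F \<noteq> {}" using assms by blast
  next
    fix C assume "C \<noteq> {}" and C: "subset.chain ?F C"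
    then have C1: "\<And>L. L \<in> C \<Longrightarrow> reduced_subring L \<and> K \<subseteq> L"
      and C2: "\<And>L M. L \<in> C \<Longrightarrow> M \<in> C \<Longrightarrow> L \<subseteq> M \<or> M \<subseteq> L"
      unfolding subset_chain_def by blast+
    have sub: "\<And>L. L \<in> C \<Longrightarrow> subring L R" using C1 reduced_subring_def by blast
    have two: "\<exists>L\<in>C. x \<in> L \<and> y \<in> L" if xy: "x \<in> \<Union>C" "y \<in> \<Union>C" for x y
    proof -
      obtain L M where "L \<in> C" "M \<in> C" "x \<in> L" "y \<in> M" using xy by blast
      then show ?thesis using C2[of L M] by blast
    qed
    have "subring (\<Union>C) R"
    proof (rule subringI)
      show "\<Union>C \<subseteq> carrier R" using sub subringE(1) by blast
      show "\<one> \<in> \<Union>C" using subringE(3)[OF sub] \<open>C \<noteq> {}\<close> by blast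
      show "\<ominus> x \<in> \<Union>C" if x: "x \<in> \<Union>C" for x
      proof -
        obtain L where L: "L \<in> C" "x \<in> L" using x by blast
        show ?thesis using L subringE(5)[OF sub[OF L(1)] L(2)] by blast
      qed
      show "x \<otimes> y \<in> \<Union>C" "x \<oplus> y \<in> \<Union>C" if xy: "x \<in> \<Union>C" "y \<in> \<Union>C" for x y
      proof -
        obtain L where L: "L \<in> C" "x \<in> L" "y \<in> L" using two[OF xy] by blast
        show "x \<otimes> y \<in> \<Union>C" "x \<oplus> y \<in> \<Union>C"
          using L subringE(6,7)[OF sub[OF L(1)] L(2,3)] by blast+
      qed
    qed
    then show "\<Union>C \<in> ?F" using C1 \<open>C \<noteq> {}\<close> unfolding reduced_subring_def by blast
  qed
  then obtain L where L: "L \<in> ?F" "\<forall>N\<in>?F. L \<subseteq> N \<longrightarrow> N = L"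
    by (rule bexE)
  show ?thesis
  proof (rule that)
    show "reduced_subring L" "K \<subseteq> L" using L(1) by auto
    show "L' = L" if "reduced_subring L'" "L \<subseteq> L'" for L'
      using that L(1) by (intro L(2)[rule_format]) auto
  qed
qed

text \<open>The fractions \<open>q/s\<close> formed inside \<open>R\<close> are again a reduced
  subring, since multiplying a nilpotent \<open>q/s\<close> by \<open>s\<close> shows that
  \<open>q\<close> is nilpotent. Maximality makes this subring equal to \<open>L\<close>, so
  \<open>L\<close> is a field.\<close>

lemma maximal_reduced_subring_inv:
  assumes L: "reduced_subring L" and max: "\<And>L'. reduced_subring L' \<Longrightarrow> L \<subseteq> L' \<Longrightarrow> L' = L"
    and x: "x \<in> L" "x \<noteq> \<zero>"
  shows "inv x \<in> L"
proof -
  have sL: "subring L R" using L reduced_subring_def by blast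
  note LR = subsetD[OF subringE(1)[OF sL]]
  note U = reduced_subring_Units[OF L]
  have prod: "s \<otimes> t \<in> L \<and> s \<otimes> t \<noteq> \<zero>" if "s \<in> L" "s \<noteq> \<zero>" "t \<in> L" "t \<noteq> \<zero>" for s t
    using that U subringE(6)[OF sL] one_not_zero
    by (metis Units_closed Units_l_cancel Units_m_closed r_null zero_closed Units_r_inv_ex l_null)
  let ?L = "{q \<otimes> inv s | q s. q \<in> L \<and> s \<in> L \<and> s \<noteq> \<zero>}"
  have "subring ?L R"
  proof (rule subringI)
    show "?L \<subseteq> carrier R" using LR U by auto
    show "\<one> \<in> ?L"
      using subringE(3)[OF sL] one_not_zero by (intro CollectI exI[of _ \<one>]) auto
    show "\<ominus> y \<in> ?L" if y: "y \<in> ?L" for y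
    proof -
      obtain q s where q: "y = q \<otimes> inv s" "q \<in> L" "s \<in> L" "s \<noteq> \<zero>" using y by blast
      then have "\<ominus> y = (\<ominus> q) \<otimes> inv s" using LR U by (simp add: l_minus)
      then show ?thesis using q subringE(5)[OF sL] by blast
    qed
    fix y z assume "y \<in> ?L" "z \<in> ?L"
    then obtain q s r t where q: "y = q \<otimes> inv s" "q \<in> L" "s \<in> L" "s \<noteq> \<zero>"
      and r: "z = r \<otimes> inv t" "r \<in> L" "t \<in> L" "t \<noteq> \<zero>" by blast
    have Us: "s \<in> Units R" "t \<in> Units R" using q r U by auto
    have cl: "q \<in> carrier R" "r \<in> carrier R" using q r LR by auto
    have inv: "inv (s \<otimes> t) = inv s \<otimes> inv t"
    proof (rule comm_inv_char[of "s \<otimes> t" "inv s \<otimes> inv t"])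
      have "s \<otimes> t \<otimes> (inv s \<otimes> inv t) = (s \<otimes> inv s) \<otimes> (t \<otimes> inv t)"
        using Us by (simp add: m_ac Units_closed del: Units_r_inv)
      then show "s \<otimes> t \<otimes> (inv s \<otimes> inv t) = \<one>" using Us by simp
    qed (use Us in \<open>auto simp: Units_closed\<close>)
    have "y \<otimes> z = (q \<otimes> r) \<otimes> inv (s \<otimes> t)"
      using q(1) r(1) Us cl by (simp add: inv m_ac)
    then show "y \<otimes> z \<in> ?L" using q r prod[of s t] subringE(6)[OF sL, of q r] by blast
    have "q \<otimes> inv s = (q \<otimes> t) \<otimes> (inv s \<otimes> inv t)"
    proof -
      have "(q \<otimes> t) \<otimes> (inv s \<otimes> inv t) = q \<otimes> inv s \<otimes> (t \<otimes> inv t)"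
        using Us cl by (simp add: m_ac Units_closed del: Units_r_inv)
      then show ?thesis using Us cl by simp
    qed
    moreover have "r \<otimes> inv t = (r \<otimes> s) \<otimes> (inv s \<otimes> inv t)"
    proof -
      have "(r \<otimes> s) \<otimes> (inv s \<otimes> inv t) = r \<otimes> inv t \<otimes> (s \<otimes> inv s)"
        using Us cl by (simp add: m_ac Units_closed del: Units_r_inv)
      then show ?thesis using Us cl by simp
    qed
    ultimately have "y \<oplus> z = (q \<otimes> t \<oplus> r \<otimes> s) \<otimes> inv (s \<otimes> t)"
      using q(1) r(1) Us cl by (simp add: inv l_distr Units_closed)
    moreover have "q \<otimes> t \<oplus> r \<otimes> s \<in> L" using q r by (intro subringE(6,7)[OF sL])
    ultimately show "y \<oplus> z \<in> ?L" using q r prod[of s t] by blast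
  qed
  moreover have "y = \<zero>" if y: "y \<in> ?L" and n: "nilpotent_elem R y" for y
  proof -
    obtain q s where q: "y = q \<otimes> inv s" "q \<in> L" "s \<in> L" "s \<noteq> \<zero>" using y by blast
    have s: "s \<in> Units R" "q \<in> carrier R" using q U LR by auto
    then have "y \<otimes> s = q" using q by (simp add: m_assoc Units_closed)
    then have "nilpotent_elem R q" using n nilpotent_mult[of y s] q s by auto
    then show ?thesis using q L s by (auto simp: reduced_subring_def)
  qed
  ultimately have red: "reduced_subring ?L" unfolding reduced_subring_def by blast
  have "q \<in> ?L" if "q \<in> L" for q
    using that subringE(3)[OF sL] one_not_zero LR
    by (intro CollectI exI[of _ q] exI[of _ \<one>]) auto
  then have "?L = L" using max[OF red] by blast
  moreover have "inv x \<in> ?L" using x subringE(3)[OF sL] U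
    by (intro CollectI exI[of _ \<one>] exI[of _ x]) auto
  ultimately show ?thesis by simp
qed

text \<open>Maximality forces \<open>L\<close> onto the residue field. If no monic polynomial over
  \<open>L\<close> has a nilpotent value at \<open>x\<close>, then \<open>L[x]\<close> is reduced
  and \<open>x\<close> lies in \<open>L\<close>. Otherwise take a monic one of least degree:
  characteristic zero makes its derivative at \<open>x\<close> a unit, Newton iteration moves
  \<open>x\<close> by a nilpotent to a root \<open>y\<close>, and least degree makes
  \<open>L[y]\<close> reduced, so \<open>y \<in> L\<close>.\<close>

lemma coefficient_field:
  assumes L: "reduced_subring L" and max: "\<And>L'. reduced_subring L' \<Longrightarrow> L \<subseteq> L' \<Longrightarrow> L' = L"
    and char0: "\<And>n::nat. 0 < n \<Longrightarrow> add_pow R n \<one> \<noteq> \<zero>"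
    and x: "x \<in> carrier R"
  shows "\<exists>y\<in>L. nilpotent_elem R (x \<ominus> y)"
proof -
  have sL: "subring L R" using L reduced_subring_def by blast
  note LR = subsetD[OF subringE(1)[OF sL]]
  have LR': "set p \<subseteq> carrier R" if "set p \<subseteq> L" for p using that LR by blast
  \<comment> \<open>A nonzero \<open>q\<close> becomes monic on division by its leading coefficient.
    Its degree is below \<open>length q\<close>, so it suffices to exclude monic polynomials of
    degree less than \<open>length q\<close>.\<close>
  have zeros: "set q \<subseteq> {\<zero>}"
    if q: "set q \<subseteq> L" "nilpotent_elem R (horner q z)" and z: "z \<in> carrier R"
      and no: "\<And>p. set p \<subseteq> L \<Longrightarrow> length p < length q \<Longrightarrow> \<not> nilpotent_elem R (horner (p @ [\<one>]) z)" for q z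
    using q no
  proof (induction q rule: rev_induct)
    case Nil then show ?case by simp
  next
    case (snoc c q)
    show ?case
    proof (cases "c = \<zero>")
      case True
      then have "horner (q @ [c]) z = horner q z" using snoc.prems z LR' by (simp add: horner_snoc)
      then show ?thesis using snoc True by auto
    next
      case False
      then have cu: "c \<in> Units R" "inv c \<in> L"
        using reduced_subring_Units[OF L] maximal_reduced_subring_inv[OF L max] snoc.prems by auto
      let ?p = "map ((\<otimes>) (inv c)) q"
      have "horner (?p @ [\<one>]) z = horner (map ((\<otimes>) (inv c)) (q @ [c])) z" using cu by simp
      also have "\<dots> = inv c \<otimes> horner (q @ [c]) z"
        using snoc.prems z cu LR' LR by (intro horner_scale) auto
      finally have "horner (?p @ [\<one>]) z = horner (q @ [c]) z \<otimes> inv c"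
        using cu snoc.prems(1) z LR'[of "q @ [c]"] by (metis m_comm horner_closed Units_inv_closed)
      then have "nilpotent_elem R (horner (?p @ [\<one>]) z)"
        using snoc.prems(1,2) cu z LR'[of "q @ [c]"] nilpotent_mult by (metis horner_closed Units_inv_closed)
      moreover have "set ?p \<subseteq> L" using cu snoc.prems(1) subringE(6)[OF sL] by auto
      ultimately show ?thesis using snoc.prems(3)[of ?p] by simp
    qed
  qed
  have extend: "z \<in> L" if z: "z \<in> carrier R"
    and red: "\<And>y. y \<in> adjoin L z \<Longrightarrow> nilpotent_elem R y \<Longrightarrow> y = \<zero>" for z
  proof -
    have "reduced_subring (adjoin L z)"
      unfolding reduced_subring_def using red adjoin_subring[OF sL z] by blast
    then have "adjoin L z = L"
      using max adjoin_incl[OF subringE(1)[OF sL] z] by blast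
    then show ?thesis using adjoin_mem[OF sL z] by simp
  qed
  let ?P = "\<lambda>n. \<exists>p. set p \<subseteq> L \<and> length p = n \<and> nilpotent_elem R (horner (p @ [\<one>]) x)"
  have "\<exists>n. ?P n"
  proof (rule ccontr)
    assume "\<not> ?thesis"
    then have no: "\<And>p. set p \<subseteq> L \<Longrightarrow> \<not> nilpotent_elem R (horner (p @ [\<one>]) x)" by blast
    have "x \<in> L"
    proof (rule extend[OF x])
      fix y assume "y \<in> adjoin L x" and n: "nilpotent_elem R y"
      then obtain q where q: "set q \<subseteq> L" "y = horner q x" by (auto simp: adjoin_def)
      then show "y = \<zero>" using zeros[of q x] n x no horner_zeros by auto
    qed
    \<comment> \<open>The linear polynomial with root \<open>x\<close> is now monic over
      \<open>L\<close>, against \<open>no\<close>.\<close>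
    then have "set [\<ominus> x] \<subseteq> L" using subringE(5)[OF sL] by simp
    moreover have "horner ([\<ominus> x] @ [\<one>]) x = \<zero>" using x by (simp add: l_neg)
    ultimately show False using no nilpotent_zero by metis
  qed
  define n where "n = (LEAST n. ?P n)"
  have "?P n" unfolding n_def by (rule LeastI_ex) fact
  then obtain p where p: "set p \<subseteq> L" "length p = n" "nilpotent_elem R (horner (p @ [\<one>]) x)" by blast
  have min: "\<not> nilpotent_elem R (horner (q @ [\<one>]) x)" if "set q \<subseteq> L" "length q < n" for q
    using that not_less_Least[of "length q" ?P] unfolding n_def by blast
  have pne: "p \<noteq> []"
  proof
    assume "p = []"
    then have "nilpotent_elem R \<one>" using p x by simp
    then show False using unit_not_nilpotent by blast
  qed
  let ?p = "p @ [\<one>]"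
  have pR: "set ?p \<subseteq> carrier R" using p LR by auto
  obtain d where d: "length d = n" "set d \<subseteq> L" "horner_deriv ?p x = horner d x" "last d = add_pow R n \<one>"
    using horner_deriv_snoc[OF sL p(1) subringE(3)[OF sL] x] p(2) pne by auto
  \<comment> \<open>The list \<open>d\<close> has length \<open>n\<close>, hence degree below the
    minimal one. If its value were nilpotent, all its coefficients would vanish, among them the
    leading coefficient \<open>n\<close>.\<close>
  have "\<not> nilpotent_elem R (horner_deriv ?p x)"
  proof
    assume "nilpotent_elem R (horner_deriv ?p x)"
    then have "set d \<subseteq> {\<zero>}" using zeros[of d x] d x min by simp
    then have "last d = \<zero>" using d(1) p(2) pne by (metis last_in_set length_0_conv singletonD subsetD)
    then show False using char0[of n] d(4) p(2) pne by auto
  qed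
  then have du: "horner_deriv ?p x \<in> Units R"
    using unit_or_nilpotent[OF horner_deriv_closed[OF pR x]] by blast
  have eR: "horner ?p x \<in> carrier R" using pR x by (rule horner_closed)
  obtain z where z: "z \<in> carrier R" "horner ?p (x \<oplus> horner ?p x \<otimes> z) = \<zero>"
    using horner_root_lift[OF pR x p(3) unit_add_nilpotent[OF du]] nilpotent_mult[OF eR _ p(3)] eR
    by blast
  let ?h = "horner ?p x \<otimes> z" let ?y = "x \<oplus> ?h"
  have h: "?h \<in> carrier R" "nilpotent_elem R ?h" and y: "?y \<in> carrier R"
    using eR z x nilpotent_mult p(3) by auto
  \<comment> \<open>Minimality is stated at \<open>x\<close>. Since \<open>?y\<close> differs from
    \<open>x\<close> by a nilpotent, it can be used at \<open>?y\<close> as well.\<close>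
  have transfer: "nilpotent_elem R (horner q x)"
    if q: "set q \<subseteq> L" "nilpotent_elem R (horner q ?y)" for q
  proof -
    obtain r where r: "r \<in> carrier R" "horner q ?y = horner q x \<oplus> ?h \<otimes> r"
      using horner_diff[OF LR'[OF q(1)] x h(1)] by blast
    have "horner q x = horner q ?y \<oplus> \<ominus> (?h \<otimes> r)"
      using r h(1) x LR'[OF q(1)] by (simp add: a_assoc r_neg)
    then show ?thesis using q r h y LR'[OF q(1)]
      by (metis nilpotent_add nilpotent_uminus nilpotent_mult m_closed a_inv_closed horner_closed)
  qed
  have "?y \<in> L"
  proof (rule extend[OF y])
    fix w assume w: "w \<in> adjoin L ?y" and nw: "nilpotent_elem R w"
    \<comment> \<open>This is the gain from an exact root: every element of \<open>L[?y]\<close> is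
      the value of a list of length \<open>n\<close>, to which minimality applies.\<close>
    obtain q where q: "set q \<subseteq> L" "length q = n" "w = horner q ?y"
      using w horner_reduce_monic[OF sL y _ p(1) z(2) pne] p(2) by (force simp: adjoin_def)
    have "set q \<subseteq> {\<zero>}" using zeros[of q x] transfer[of q] q nw x min by simp
    then show "w = \<zero>" using q y horner_zeros by simp
  qed
  moreover have "x \<ominus> ?y = \<ominus> ?h" using x h(1) by algebra
  ultimately show ?thesis using nilpotent_uminus[OF h] by metis
qed

end

section \<open>Finite dimensionality\<close>

context cring begin

definition lincomb :: "'a set \<Rightarrow> ('a \<Rightarrow> 'a) \<Rightarrow> 'a"
  where "lincomb E c = (\<Oplus>e\<in>E. c e \<otimes> e)"

definition lspan :: "'a set \<Rightarrow> 'a set \<Rightarrow> 'a set"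
  where "lspan L E = {lincomb E c | c. c \<in> E \<rightarrow> L}"

lemma lincomb_closed [simp]:
  "c \<in> E \<rightarrow> carrier R \<Longrightarrow> E \<subseteq> carrier R \<Longrightarrow> lincomb E c \<in> carrier R"
  unfolding lincomb_def by (intro finsum_closed) auto

lemma lincomb_add:
  assumes "c \<in> E \<rightarrow> carrier R" "d \<in> E \<rightarrow> carrier R" "E \<subseteq> carrier R"
  shows "lincomb E (\<lambda>e. c e \<oplus> d e) = lincomb E c \<oplus> lincomb E d"
proof -
  have "lincomb E (\<lambda>e. c e \<oplus> d e) = (\<Oplus>e\<in>E. c e \<otimes> e \<oplus> d e \<otimes> e)"
    unfolding lincomb_def using assms by (intro finsum_cong') (auto simp: l_distr Pi_iff subset_iff)
  also have "\<dots> = lincomb E c \<oplus> lincomb E d"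
    unfolding lincomb_def using assms by (intro finsum_addf) (auto simp: Pi_iff subset_iff)
  finally show ?thesis .
qed

lemma lincomb_smult:
  assumes "c \<in> E \<rightarrow> carrier R" "l \<in> carrier R" "E \<subseteq> carrier R" "finite E"
  shows "lincomb E (\<lambda>e. l \<otimes> c e) = l \<otimes> lincomb E c"
proof -
  have "lincomb E (\<lambda>e. l \<otimes> c e) = (\<Oplus>e\<in>E. l \<otimes> (c e \<otimes> e))"
    unfolding lincomb_def using assms by (intro finsum_cong') (auto simp: m_assoc Pi_iff subset_iff)
  also have "\<dots> = l \<otimes> lincomb E c"
    unfolding lincomb_def using assms by (intro finsum_rdistr[symmetric]) (auto simp: Pi_iff subset_iff)
  finally show ?thesis .
qed

lemma lincomb_zero: "E \<subseteq> carrier R \<Longrightarrow> lincomb E (\<lambda>_. \<zero>) = \<zero>"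
  unfolding lincomb_def by (intro add.finprod_one_eqI) auto

lemma lincomb_unit:
  assumes "e \<in> E" "E \<subseteq> carrier R" "finite E"
  shows "lincomb E (\<lambda>f. if e = f then \<one> else \<zero>) = e"
proof -
  have "lincomb E (\<lambda>f. if e = f then \<one> else \<zero>) = (\<Oplus>f\<in>E. if e = f then f else \<zero>)"
    unfolding lincomb_def using assms by (intro finsum_cong') auto
  also have "\<dots> = e" using assms by (intro add.finprod_singleton) auto
  finally show ?thesis .
qed

lemma lspan_least:
  assumes "E \<subseteq> V" "finite E" "V \<subseteq> carrier R" "\<zero> \<in> V" "L \<subseteq> carrier R"
    and add: "\<And>x y. x \<in> V \<Longrightarrow> y \<in> V \<Longrightarrow> x \<oplus> y \<in> V"
    and smult: "\<And>l x. l \<in> L \<Longrightarrow> x \<in> V \<Longrightarrow> l \<otimes> x \<in> V"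
  shows "lspan L E \<subseteq> V"
proof
  fix v assume "v \<in> lspan L E"
  then obtain c where c: "c \<in> E \<rightarrow> L" and v: "v = (\<Oplus>e\<in>E. c e \<otimes> e)"
    by (auto simp: lspan_def lincomb_def)
  have "(\<Oplus>e\<in>E. c e \<otimes> e) \<in> V" using \<open>finite E\<close> \<open>E \<subseteq> V\<close> c
  proof (induction E rule: finite_induct)
    case empty
    then show ?case using assms by simp
  next
    case (insert e E)
    have "(\<lambda>e. c e \<otimes> e) \<in> E \<rightarrow> carrier R"
    proof
      fix f assume "f \<in> E"
      then have "c f \<in> carrier R" "f \<in> carrier R" using insert.prems assms(3,5) by (auto simp: Pi_iff)
      then show "c f \<otimes> f \<in> carrier R" by simp
    qed
    moreover have ce: "c e \<otimes> e \<in> V" using insert.prems smult by simp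
    ultimately have "(\<Oplus>e\<in>insert e E. c e \<otimes> e) = c e \<otimes> e \<oplus> (\<Oplus>e\<in>E. c e \<otimes> e)"
      using insert.hyps assms(3) by (intro finsum_insert) auto
    then show ?case using add[OF ce insert.IH] insert.prems by auto
  qed
  then show "v \<in> V" using v by simp
qed

context
  fixes L E assumes L: "subring L R" and E: "finite E" "E \<subseteq> carrier R"
begin

lemma Pi_closed: "c \<in> E \<rightarrow> L \<Longrightarrow> c \<in> E \<rightarrow> carrier R"
  using subringE(1)[OF L] by (auto simp: Pi_iff)

lemma lspan_closed: "lspan L E \<subseteq> carrier R"
proof
  fix v assume "v \<in> lspan L E"
  then obtain c where "c \<in> E \<rightarrow> L" "v = lincomb E c" by (auto simp: lspan_def)
  then show "v \<in> carrier R" using lincomb_closed[OF Pi_closed E(2)] by simp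
qed

lemma lspan_mem: "e \<in> E \<Longrightarrow> e \<in> lspan L E"
  unfolding lspan_def using lincomb_unit[of e E] E subringE(2,3)[OF L]
  by (intro CollectI exI[of _ "\<lambda>f. if e = f then \<one> else \<zero>"]) auto

lemma lspan_zero: "\<zero> \<in> lspan L E"
  unfolding lspan_def using lincomb_zero[of E] E subringE(2)[OF L]
  by (intro CollectI exI[of _ "\<lambda>_. \<zero>"]) auto

lemma lspan_add:
  assumes "x \<in> lspan L E" "y \<in> lspan L E" shows "x \<oplus> y \<in> lspan L E"
proof -
  obtain c d where "c \<in> E \<rightarrow> L" "d \<in> E \<rightarrow> L" "x = lincomb E c" "y = lincomb E d"
    using assms by (auto simp: lspan_def)
  moreover from this have "(\<lambda>e. c e \<oplus> d e) \<in> E \<rightarrow> L" using subringE(7)[OF L] by (auto simp: Pi_iff)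
  ultimately show ?thesis unfolding lspan_def using lincomb_add[of c E d] Pi_closed E
    by (intro CollectI exI[of _ "\<lambda>e. c e \<oplus> d e"]) auto
qed

lemma lspan_smult:
  assumes "x \<in> lspan L E" "l \<in> L" shows "l \<otimes> x \<in> lspan L E"
proof -
  obtain c where "c \<in> E \<rightarrow> L" "x = lincomb E c"
    using assms by (auto simp: lspan_def)
  moreover from this have "(\<lambda>e. l \<otimes> c e) \<in> E \<rightarrow> L" using subringE(6)[OF L] assms by (auto simp: Pi_iff)
  ultimately show ?thesis unfolding lspan_def
    using lincomb_smult[of c E l] Pi_closed E assms subringE(1)[OF L]
    by (intro CollectI exI[of _ "\<lambda>e. l \<otimes> c e"]) auto
qed

end

section \<open>Finite spans from nilpotent generators\<close>

lemma genideal_insert_decomp: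
  assumes G: "G \<subseteq> carrier R" and x: "x \<in> carrier R" and y: "y \<in> Idl (insert x G)"
  shows "\<exists>z\<in>Idl G. \<exists>t\<in>carrier R. y = z \<oplus> x \<otimes> t"
proof -
  have I: "ideal (Idl G) R" "ideal (PIdl x) R" using G x by (auto intro: genideal_ideal cgenideal_ideal)
  have "insert x G \<subseteq> Idl G <+> PIdl x"
  proof -
    have "x \<in> Idl G <+> PIdl x"
      using additive_subgroup.zero_closed[OF ideal.axioms(1)[OF I(1)]] cgenideal_self[OF x] x
      unfolding set_add_def' by force
    moreover have "G \<subseteq> Idl G <+> PIdl x"
      using additive_subgroup.zero_closed[OF ideal.axioms(1)[OF I(2)]] genideal_self[OF G] G
      unfolding set_add_def' by force
    ultimately show ?thesis by simp
  qed
  then have "Idl (insert x G) \<subseteq> Idl G <+> PIdl x"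
    by (intro genideal_minimal add_ideals I)
  then obtain z w where z: "z \<in> Idl G" "w \<in> PIdl x" "y = z \<oplus> w"
    using y by (auto simp: set_add_def')
  then obtain t where "t \<in> carrier R" "w = t \<otimes> x" by (auto simp: cgenideal_def)
  then show ?thesis using z x m_comm by auto
qed

text \<open>Successive approximation in one generator at a time. If \<open>E\<close> spans modulo
  the ideal of \<open>x\<close> and \<open>G\<close>, substituting this expansion repeatedly into
  its own multiple of \<open>x\<close> shows that the products \<open>x^i e\<close> span modulo the
  ideal of \<open>G\<close>, up to a multiple of \<open>x^N = 0\<close>. Induction removes all
  generators.\<close>

lemma finite_span_of_nilpotent_ideal:
  assumes L: "subring L R" and "finite G" "G \<subseteq> carrier R"
    and nil: "\<And>x. x \<in> G \<Longrightarrow> nilpotent_elem R x"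
    and "finite E" "E \<subseteq> carrier R"
    and "\<And>t. t \<in> carrier R \<Longrightarrow> \<exists>w\<in>lspan L E. \<exists>y\<in>Idl G. t = w \<oplus> y"
  shows "\<exists>E. finite E \<and> E \<subseteq> carrier R \<and> lspan L E = carrier R"
  using assms(2-)
proof (induction G arbitrary: E rule: finite_induct)
  case empty
  have "Idl {} \<subseteq> {\<zero>}" by (rule genideal_minimal) (auto simp: zeroideal)
  then have "t \<in> lspan L E" if t: "t \<in> carrier R" for t
    using empty.prems(5)[OF t] lspan_closed[OF L empty.prems(3,4)] by fastforce
  then show ?case using empty.prems(3,4) lspan_closed[OF L empty.prems(3,4)]
    by (intro exI[of _ E]) auto
next
  case (insert x G)
  have x: "x \<in> carrier R" and G: "G \<subseteq> carrier R" using insert.prems by auto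
  note E = insert.prems(3,4)
  obtain N :: nat where N: "x [^] N = \<zero>" using insert.prems(2)[of x] by (auto simp: nilpotent_elem_def)
  define E' where "E' = (\<lambda>(i, e). x [^] i \<otimes> e) ` ({..<N} \<times> E)"
  have E': "finite E'" "E' \<subseteq> carrier R" using E x by (auto simp: E'_def)
  note LE = lspan_closed[OF L E] and LE' = lspan_closed[OF L E']
  have pow: "x [^] i \<otimes> w \<in> lspan L E'" if i: "i < N" and w: "w \<in> lspan L E" for i w
  proof -
    have xi: "x [^] i \<in> carrier R" using x by simp
    have "lspan L E \<subseteq> {w \<in> carrier R. x [^] i \<otimes> w \<in> lspan L E'}"
    proof (rule lspan_least)
      show "E \<subseteq> {w \<in> carrier R. x [^] i \<otimes> w \<in> lspan L E'}"
        using E i by (auto simp: E'_def intro!: lspan_mem[OF L E', unfolded E'_def])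
      show "\<zero> \<in> {w \<in> carrier R. x [^] i \<otimes> w \<in> lspan L E'}" using lspan_zero[OF L E'] xi by simp
      show "v \<oplus> w \<in> {w \<in> carrier R. x [^] i \<otimes> w \<in> lspan L E'}"
        if "v \<in> {w \<in> carrier R. x [^] i \<otimes> w \<in> lspan L E'}"
          "w \<in> {w \<in> carrier R. x [^] i \<otimes> w \<in> lspan L E'}" for v w
        using that xi lspan_add[OF L E'] by (auto simp: r_distr)
      show "l \<otimes> w \<in> {w \<in> carrier R. x [^] i \<otimes> w \<in> lspan L E'}"
        if "l \<in> L" "w \<in> {w \<in> carrier R. x [^] i \<otimes> w \<in> lspan L E'}" for l w
      proof -
        have "l \<in> carrier R" using that subringE(1)[OF L] by blast
        then show ?thesis using that xi lspan_smult[OF L E', of "x [^] i \<otimes> w" l] by (auto simp: m_lcomm)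
      qed
    qed (use E subringE(1)[OF L] in auto)
    then show ?thesis using w by blast
  qed
  have I: "ideal (Idl G) R" using G by (rule genideal_ideal)
  \<comment> \<open>Expansion to order \<open>j\<close> in \<open>x\<close>; at \<open>j = N\<close>
    the last term vanishes.\<close>
  have step: "\<exists>w\<in>lspan L E'. \<exists>y\<in>Idl G. \<exists>s\<in>carrier R. t = w \<oplus> y \<oplus> x [^] j \<otimes> s"
    if t: "t \<in> carrier R" and "j \<le> N" for t j
    using that(2)
  proof (induction j)
    case 0
    show ?case using lspan_zero[OF L E'] additive_subgroup.zero_closed[OF ideal.axioms(1)[OF I]] t
      by (intro bexI[of _ \<zero>] bexI[of _ t]) auto
  next
    case (Suc j)
    then obtain w y s where w: "w \<in> lspan L E'" and y: "y \<in> Idl G" and s: "s \<in> carrier R"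
      and eq: "t = w \<oplus> y \<oplus> x [^] j \<otimes> s" by auto
    obtain w0 y0 where w0: "w0 \<in> lspan L E" and y0: "y0 \<in> Idl (insert x G)" and s0: "s = w0 \<oplus> y0"
      using insert.prems(5) s by blast
    obtain y1 r where y1: "y1 \<in> Idl G" and r: "r \<in> carrier R" and y01: "y0 = y1 \<oplus> x \<otimes> r"
      using genideal_insert_decomp[OF G x y0] by blast
    have xj: "x [^] j \<in> carrier R" using x by simp
    have 1: "w \<oplus> x [^] j \<otimes> w0 \<in> lspan L E'"
      using w w0 pow[of j w0] Suc.prems lspan_add[OF L E'] by simp
    have 2: "y \<oplus> x [^] j \<otimes> y1 \<in> Idl G"
      using y y1 xj additive_subgroup.a_closed[OF ideal.axioms(1)[OF I]] ideal.I_l_closed[OF I] by simp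
    have "w \<in> carrier R" "w0 \<in> carrier R" "y \<in> carrier R" "y1 \<in> carrier R"
      using w w0 y y1 LE LE' ideal.Icarr[OF I] by auto
    then have "t = (w \<oplus> x [^] j \<otimes> w0) \<oplus> (y \<oplus> x [^] j \<otimes> y1) \<oplus> x [^] Suc j \<otimes> r"
      using x r xj by (simp add: eq s0 y01 r_distr m_ac a_ac)
    then show ?case using 1 2 r by blast
  qed
  have "\<exists>w\<in>lspan L E'. \<exists>y\<in>Idl G. t = w \<oplus> y" if t: "t \<in> carrier R" for t
  proof -
    obtain w y s where w: "w \<in> lspan L E'" and y: "y \<in> Idl G" and s: "s \<in> carrier R"
      and "t = w \<oplus> y \<oplus> x [^] N \<otimes> s" using step[OF t, of N] by auto
    moreover have "w \<in> carrier R" "y \<in> carrier R" using w y LE' ideal.Icarr[OF I] by auto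
    ultimately have "t = w \<oplus> y" using N by simp
    then show ?thesis using w y by blast
  qed
  moreover have "nilpotent_elem R z" if "z \<in> G" for z using insert.prems(2)[of z] that by simp
  ultimately show ?case by (intro insert.IH[OF G _ E'])
qed

end

section \<open>The trace form\<close>

lemma (in abelian_monoid) finsum_swap:
  assumes "finite A" "finite B" and F: "\<And>x y. x \<in> A \<Longrightarrow> y \<in> B \<Longrightarrow> F x y \<in> carrier G"
  shows "(\<Oplus>x\<in>A. \<Oplus>y\<in>B. F x y) = (\<Oplus>y\<in>B. \<Oplus>x\<in>A. F x y)"
  using assms(1) F
proof (induction A rule: finite_induct)
  case empty
  then show ?case by simp
next
  case (insert x A)
  have cl: "(\<Oplus>y\<in>B. F z y) \<in> carrier G" if "z \<in> insert x A" for z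
    using that insert.prems by (intro finsum_closed) auto
  have "(\<Oplus>z\<in>insert x A. \<Oplus>y\<in>B. F z y) = (\<Oplus>y\<in>B. F x y) \<oplus> (\<Oplus>y\<in>B. \<Oplus>z\<in>A. F z y)"
    using insert cl by (subst finsum_insert) auto
  also have "\<dots> = (\<Oplus>y\<in>B. F x y \<oplus> (\<Oplus>z\<in>A. F z y))"
    using insert.prems by (intro finsum_addf[symmetric]) (auto intro!: finsum_closed)
  also have "\<dots> = (\<Oplus>y\<in>B. \<Oplus>z\<in>insert x A. F z y)"
    using insert by (intro finsum_cong') (auto intro!: finsum_closed)
  finally show ?case .
qed

text \<open>By \<open>gen\<close> and \<open>indep\<close>, \<open>E\<close> lifts an
  \<open>L\<close>-basis of \<open>R/aR\<close>. By \<open>ann\<close>, multiplication by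
  \<open>a\<close> is injective from \<open>R/aR\<close> to \<open>aR/a\<^sup>2R\<close>. Together
  they make \<open>R/a\<^sup>2R\<close> free on \<open>E\<close> over \<open>L[a]\<close> with
  \<open>a\<^sup>2 = 0\<close>.\<close>

locale dual_number_frame = cring R for R (structure) +
  fixes L a E
  assumes L: "subring L R" and a [simp]: "a \<in> carrier R" and finE: "finite E" and E: "E \<subseteq> carrier R"
    and gen: "t \<in> carrier R \<Longrightarrow> \<exists>w\<in>lspan L E. \<exists>u\<in>carrier R. t = w \<oplus> a \<otimes> u"
    and indep: "c \<in> E \<rightarrow> L \<Longrightarrow> u \<in> carrier R \<Longrightarrow> lincomb E c = a \<otimes> u \<Longrightarrow> e \<in> E \<Longrightarrow> c e = \<zero>"
    and ann: "x \<in> carrier R \<Longrightarrow> a \<otimes> x = \<zero> \<Longrightarrow> \<exists>u\<in>carrier R. x = a \<otimes> u"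
begin

text \<open>The elements \<open>c e + a d e\<close> are the coordinates of \<open>t\<close> over
  \<open>L[a]\<close> in the basis \<open>E\<close>, modulo \<open>a\<^sup>2\<close>.\<close>

definition expands :: "'a \<Rightarrow> ('a \<Rightarrow> 'a) \<Rightarrow> ('a \<Rightarrow> 'a) \<Rightarrow> bool"
  where "expands t c d \<longleftrightarrow> c \<in> E \<rightarrow> L \<and> d \<in> E \<rightarrow> L \<and>
    (\<exists>u\<in>carrier R. t = lincomb E c \<oplus> a \<otimes> lincomb E d \<oplus> a \<otimes> a \<otimes> u)"

lemma L_closed: "l \<in> L \<Longrightarrow> l \<in> carrier R"
  using subringE(1)[OF L] by blast

lemma E_closed: "e \<in> E \<Longrightarrow> e \<in> carrier R"
  using E by blast

lemma PiL_closed: "c \<in> E \<rightarrow> L \<Longrightarrow> c \<in> E \<rightarrow> carrier R"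
  using L_closed by (auto simp: Pi_iff)

lemma lincombL_closed: "c \<in> E \<rightarrow> L \<Longrightarrow> lincomb E c \<in> carrier R"
  by (rule lincomb_closed[OF PiL_closed E])

lemma lincomb_cong: "c \<in> E \<rightarrow> L \<Longrightarrow> (\<And>e. e \<in> E \<Longrightarrow> c e = d e) \<Longrightarrow> lincomb E d = lincomb E c"
  unfolding lincomb_def using L_closed E_closed by (intro finsum_cong') (auto simp: Pi_iff)

lemma expands_cong:
  assumes "expands t c d" "\<And>e. e \<in> E \<Longrightarrow> c e = c' e" "\<And>e. e \<in> E \<Longrightarrow> d e = d' e"
  shows "expands t c' d'"
proof -
  have "lincomb E c' = lincomb E c" "lincomb E d' = lincomb E d"
    using assms by (auto simp: expands_def intro!: lincomb_cong)
  then show ?thesis using assms by (simp add: expands_def Pi_iff)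
qed

text \<open>\<open>gen\<close> is applied twice, the second time to the cofactor of
  \<open>a\<close>.\<close>

lemma expands_exists: "t \<in> carrier R \<Longrightarrow> \<exists>c d. expands t c d"
proof -
  assume t: "t \<in> carrier R"
  obtain c u where c: "c \<in> E \<rightarrow> L" and u: "u \<in> carrier R" and t': "t = lincomb E c \<oplus> a \<otimes> u"
    using gen[OF t] by (auto simp: lspan_def)
  obtain d v where d: "d \<in> E \<rightarrow> L" and v: "v \<in> carrier R" and u': "u = lincomb E d \<oplus> a \<otimes> v"
    using gen[OF u] by (auto simp: lspan_def)
  have "t = lincomb E c \<oplus> a \<otimes> lincomb E d \<oplus> a \<otimes> a \<otimes> v"
    using v lincombL_closed[OF c] lincombL_closed[OF d] by (simp add: t' u' r_distr m_assoc a_assoc)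
  then show ?thesis using c d v by (auto simp: expands_def)
qed

lemma lincomb_diff:
  assumes "c \<in> E \<rightarrow> L" "c' \<in> E \<rightarrow> L"
  shows "(\<lambda>e. c e \<oplus> \<ominus> \<one> \<otimes> c' e) \<in> E \<rightarrow> L"
    "lincomb E (\<lambda>e. c e \<oplus> \<ominus> \<one> \<otimes> c' e) = lincomb E c \<ominus> lincomb E c'"
proof -
  have m: "\<ominus> \<one> \<in> L" using subringE(3,5)[OF L] by blast
  then have 1: "(\<lambda>e. \<ominus> \<one> \<otimes> c' e) \<in> E \<rightarrow> L"
    using assms subringE(6)[OF L] by (auto simp: Pi_iff)
  then show "(\<lambda>e. c e \<oplus> \<ominus> \<one> \<otimes> c' e) \<in> E \<rightarrow> L"
    using assms subringE(7)[OF L] by (auto simp: Pi_iff)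
  show "lincomb E (\<lambda>e. c e \<oplus> \<ominus> \<one> \<otimes> c' e) = lincomb E c \<ominus> lincomb E c'"
    using lincomb_add[OF PiL_closed[OF assms(1)] PiL_closed[OF 1] E]
      lincomb_smult[OF PiL_closed[OF assms(2)] _ E finE, of "\<ominus> \<one>"] lincombL_closed[OF assms(2)]
    by (simp add: minus_eq l_minus)
qed

lemma coeffs_unique:
  assumes "c \<in> E \<rightarrow> L" "c' \<in> E \<rightarrow> L" "u \<in> carrier R" "u' \<in> carrier R"
    and "lincomb E c \<oplus> a \<otimes> u = lincomb E c' \<oplus> a \<otimes> u'" and e: "e \<in> E"
  shows "c e = c' e"
proof -
  note cl = lincombL_closed[OF assms(1)] lincombL_closed[OF assms(2)]
  have "lincomb E c \<ominus> lincomb E c' = (lincomb E c \<oplus> a \<otimes> u) \<ominus> lincomb E c' \<ominus> a \<otimes> u"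
    using cl assms(3,4) a by algebra
  also have "\<dots> = a \<otimes> (u' \<ominus> u)" unfolding assms(5) using cl assms(3,4) a by algebra
  finally have "lincomb E (\<lambda>e. c e \<oplus> \<ominus> \<one> \<otimes> c' e) = a \<otimes> (u' \<ominus> u)"
    using lincomb_diff[OF assms(1,2)] by simp
  then have "c e \<oplus> \<ominus> \<one> \<otimes> c' e = \<zero>"
    using indep[OF lincomb_diff(1)[OF assms(1,2)] _ _ e] assms(3,4) by blast
  moreover have "c e \<in> carrier R" "c' e \<in> carrier R" using assms(1,2) e L_closed by auto
  ultimately show ?thesis by (simp add: l_minus minus_eq[symmetric])
qed

text \<open>Independence modulo \<open>a\<close> fixes \<open>c\<close>. The cofactors
  \<open>?D\<close> and \<open>?D'\<close> of \<open>a\<close> then have a difference killed by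
  \<open>a\<close>; \<open>ann\<close> makes this difference a multiple of \<open>a\<close>, and
  independence applies again to fix \<open>d\<close>.\<close>

lemma expands_unique:
  assumes 1: "expands t c d" and 2: "expands t c' d'" and e: "e \<in> E"
  shows "c e = c' e" "d e = d' e"
proof -
  obtain u u' where c: "c \<in> E \<rightarrow> L" "d \<in> E \<rightarrow> L" "c' \<in> E \<rightarrow> L" "d' \<in> E \<rightarrow> L"
    and u: "u \<in> carrier R" "t = lincomb E c \<oplus> a \<otimes> lincomb E d \<oplus> a \<otimes> a \<otimes> u"
    and u': "u' \<in> carrier R" "t = lincomb E c' \<oplus> a \<otimes> lincomb E d' \<oplus> a \<otimes> a \<otimes> u'"
    using 1 2 by (auto simp: expands_def)
  note cl = c[THEN lincombL_closed]
  let ?D = "lincomb E d \<oplus> a \<otimes> u" and ?D' = "lincomb E d' \<oplus> a \<otimes> u'"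
  have D: "?D \<in> carrier R" "?D' \<in> carrier R" using cl u u' by auto
  have t: "t = lincomb E c \<oplus> a \<otimes> ?D" "t = lincomb E c' \<oplus> a \<otimes> ?D'"
    using cl u(1) u'(1) by (simp_all only: u(2)) (simp add: r_distr m_assoc a_assoc,
        simp only: u(2)[symmetric] u'(2), simp add: r_distr m_assoc a_assoc)
  then have eq: "c f = c' f" if "f \<in> E" for f
    using coeffs_unique[OF c(1,3) D _ that] by simp
  then show "c e = c' e" using e by simp
  have cc: "lincomb E c = lincomb E c'" by (rule lincomb_cong[OF c(1) eq, symmetric])
  have "a \<otimes> (?D \<ominus> ?D') = (lincomb E c \<oplus> a \<otimes> ?D) \<ominus> (lincomb E c' \<oplus> a \<otimes> ?D')"
    unfolding cc using cl(3) D a by algebra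
  also have "\<dots> = \<zero>" using t cl(3) D by (metis a m_closed a_closed r_neg minus_eq)
  finally obtain v where v: "v \<in> carrier R" "?D \<ominus> ?D' = a \<otimes> v" using ann D by (meson minus_closed)
  have "lincomb E d \<oplus> a \<otimes> u = (?D \<ominus> ?D') \<oplus> ?D'" using D by algebra
  also have "\<dots> = lincomb E d' \<oplus> a \<otimes> (v \<oplus> u')" unfolding v(2) using cl v(1) u'(1) a by algebra
  finally have "lincomb E d \<oplus> a \<otimes> u = lincomb E d' \<oplus> a \<otimes> (v \<oplus> u')" .
  then show "d e = d' e" using coeffs_unique[OF c(2,4) u(1) a_closed[OF v(1) u'(1)] _ e] by simp
qed

lemma expands_add:
  assumes 1: "expands t c d" and 2: "expands t' c' d'"
  shows "expands (t \<oplus> t') (\<lambda>e. c e \<oplus> c' e) (\<lambda>e. d e \<oplus> d' e)"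
proof -
  obtain u u' where c: "c \<in> E \<rightarrow> L" "d \<in> E \<rightarrow> L" "c' \<in> E \<rightarrow> L" "d' \<in> E \<rightarrow> L"
    and u: "u \<in> carrier R" "t = lincomb E c \<oplus> a \<otimes> lincomb E d \<oplus> a \<otimes> a \<otimes> u"
    and u': "u' \<in> carrier R" "t' = lincomb E c' \<oplus> a \<otimes> lincomb E d' \<oplus> a \<otimes> a \<otimes> u'"
    using 1 2 by (auto simp: expands_def)
  note cl = c[THEN lincombL_closed]
  have "t \<oplus> t' = lincomb E (\<lambda>e. c e \<oplus> c' e) \<oplus> a \<otimes> lincomb E (\<lambda>e. d e \<oplus> d' e) \<oplus> a \<otimes> a \<otimes> (u \<oplus> u')"
    unfolding u(2) u'(2) using cl u(1) u'(1)
    by (simp add: lincomb_add[OF PiL_closed PiL_closed E] c r_distr m_ac a_ac)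
  then show ?thesis unfolding expands_def using c u(1) u'(1) subringE(7)[OF L]
    by (auto simp: Pi_iff intro!: bexI[of _ "u \<oplus> u'"])
qed

lemma expands_smult:
  assumes 1: "expands t c d" and l: "l \<in> L"
  shows "expands (l \<otimes> t) (\<lambda>e. l \<otimes> c e) (\<lambda>e. l \<otimes> d e)"
proof -
  obtain u where c: "c \<in> E \<rightarrow> L" "d \<in> E \<rightarrow> L"
    and u: "u \<in> carrier R" "t = lincomb E c \<oplus> a \<otimes> lincomb E d \<oplus> a \<otimes> a \<otimes> u"
    using 1 by (auto simp: expands_def)
  note cl = c[THEN lincombL_closed]
  have lc: "l \<in> carrier R" using l L_closed by blast
  have "l \<otimes> t = lincomb E (\<lambda>e. l \<otimes> c e) \<oplus> a \<otimes> lincomb E (\<lambda>e. l \<otimes> d e) \<oplus> a \<otimes> a \<otimes> (l \<otimes> u)"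
    unfolding u(2) using cl u(1) lc
    by (simp add: lincomb_smult[OF PiL_closed _ E finE] c r_distr m_ac a_ac)
  then show ?thesis unfolding expands_def using c u(1) lc subringE(6)[OF L l]
    by (auto simp: Pi_iff intro!: bexI[of _ "l \<otimes> u"])
qed

lemma zero_in_L: "\<zero> \<in> L" and one_in_L: "\<one> \<in> L"
  using subringE(2,3)[OF L] .

lemma expands_remainder:
  assumes "u \<in> carrier R" shows "expands (a \<otimes> a \<otimes> u) (\<lambda>_. \<zero>) (\<lambda>_. \<zero>)"
  unfolding expands_def using assms zero_in_L lincomb_zero[OF E] by auto

lemma expands_zero: "expands \<zero> (\<lambda>_. \<zero>) (\<lambda>_. \<zero>)"
  using expands_remainder[of \<zero>] by simp

text \<open>In \<open>L[a]\<close>, \<open>a (c + a d) = a c\<close>.\<close>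

lemma expands_mult_a:
  assumes "expands t c d" shows "expands (a \<otimes> t) (\<lambda>_. \<zero>) c"
proof -
  obtain u where c: "c \<in> E \<rightarrow> L" "d \<in> E \<rightarrow> L"
    and u: "u \<in> carrier R" "t = lincomb E c \<oplus> a \<otimes> lincomb E d \<oplus> a \<otimes> a \<otimes> u"
    using assms by (auto simp: expands_def)
  note cl = c[THEN lincombL_closed]
  have "a \<otimes> t = lincomb E (\<lambda>_. \<zero>) \<oplus> a \<otimes> lincomb E c \<oplus> a \<otimes> a \<otimes> (lincomb E d \<oplus> a \<otimes> u)"
    unfolding u(2) lincomb_zero[OF E] using cl u(1) by (simp add: r_distr m_ac a_ac)
  then show ?thesis unfolding expands_def using c u(1) cl zero_in_L
    by (intro conjI bexI[of _ "lincomb E d \<oplus> a \<otimes> u"]) auto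
qed

lemma expands_finsum:
  assumes "finite F" "\<And>f. f \<in> F \<Longrightarrow> t f \<in> carrier R" "\<And>f. f \<in> F \<Longrightarrow> expands (t f) (c f) (d f)"
  shows "expands (\<Oplus>f\<in>F. t f) (\<lambda>e. \<Oplus>f\<in>F. c f e) (\<lambda>e. \<Oplus>f\<in>F. d f e)"
  using assms
proof (induction F rule: finite_induct)
  case empty
  show ?case using expands_zero by simp
next
  case (insert f F)
  have cl: "c g e \<in> carrier R" "d g e \<in> carrier R" if "g \<in> insert f F" "e \<in> E" for g e
    using insert.prems(2)[OF that(1)] that(2) L_closed by (auto simp: expands_def)
  have "expands (t f \<oplus> (\<Oplus>f\<in>F. t f)) (\<lambda>e. c f e \<oplus> (\<Oplus>f\<in>F. c f e)) (\<lambda>e. d f e \<oplus> (\<Oplus>f\<in>F. d f e))"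
    using insert by (intro expands_add) auto
  also have "t f \<oplus> (\<Oplus>f\<in>F. t f) = (\<Oplus>f\<in>insert f F. t f)"
    using insert by (intro finsum_insert[symmetric]) auto
  finally show ?case
    by (rule expands_cong) (use insert.hyps cl in \<open>auto simp: finsum_insert Pi_iff\<close>)
qed

lemma expands_basis: "e \<in> E \<Longrightarrow> expands e (\<lambda>f. if e = f then \<one> else \<zero>) (\<lambda>_. \<zero>)"
  unfolding expands_def using lincomb_unit[OF _ E finE] lincomb_zero[OF E] E_closed zero_in_L one_in_L
  by (auto intro!: bexI[of _ \<zero>])

text \<open>
  Modulo \<open>a\<^sup>2\<close>, multiplication by \<open>x\<close> is the matrix \<open>mat0 x + a mat1 x\<close> over \<open>L[a]\<close>, with column
  index first.
\<close>

definition coords :: "'a \<Rightarrow> ('a \<Rightarrow> 'a) \<times> ('a \<Rightarrow> 'a)"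
  where "coords t = (SOME p. expands t (fst p) (snd p))"

definition mat0 :: "'a \<Rightarrow> 'a \<Rightarrow> 'a \<Rightarrow> 'a" where "mat0 x e = fst (coords (x \<otimes> e))"
definition mat1 :: "'a \<Rightarrow> 'a \<Rightarrow> 'a \<Rightarrow> 'a" where "mat1 x e = snd (coords (x \<otimes> e))"

lemma expands_mat:
  assumes "x \<in> carrier R" "e \<in> E" shows "expands (x \<otimes> e) (mat0 x e) (mat1 x e)"
proof -
  have "\<exists>p. expands (x \<otimes> e) (fst p) (snd p)"
    using expands_exists[of "x \<otimes> e"] assms E_closed by auto
  then show ?thesis unfolding mat0_def mat1_def coords_def by (rule someI_ex)
qed

lemma mat_eqI:
  assumes "expands (x \<otimes> e) c d" "x \<in> carrier R" "e \<in> E" "f \<in> E"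
  shows "mat0 x e f = c f" "mat1 x e f = d f"
  using expands_unique[OF expands_mat[OF assms(2,3)] assms(1,4)] by auto

lemma mat_in_L:
  assumes "x \<in> carrier R" "e \<in> E" "f \<in> E" shows "mat0 x e f \<in> L" "mat1 x e f \<in> L"
  using expands_mat[OF assms(1,2)] assms(3) by (auto simp: expands_def)

lemmas mat_closed [simp] = mat_in_L[THEN L_closed]

lemma mat_add:
  assumes "x \<in> carrier R" "y \<in> carrier R" "e \<in> E" "f \<in> E"
  shows "mat0 (x \<oplus> y) e f = mat0 x e f \<oplus> mat0 y e f" "mat1 (x \<oplus> y) e f = mat1 x e f \<oplus> mat1 y e f"
proof -
  have "expands ((x \<oplus> y) \<otimes> e) (\<lambda>f. mat0 x e f \<oplus> mat0 y e f) (\<lambda>f. mat1 x e f \<oplus> mat1 y e f)"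
    using expands_add[OF expands_mat expands_mat] assms E_closed by (simp add: l_distr)
  then show "mat0 (x \<oplus> y) e f = mat0 x e f \<oplus> mat0 y e f" "mat1 (x \<oplus> y) e f = mat1 x e f \<oplus> mat1 y e f"
    using mat_eqI assms by auto
qed

lemma mat_const:
  assumes "l \<in> L" "e \<in> E" "f \<in> E"
  shows "mat0 l e f = (if e = f then l else \<zero>)" "mat1 l e f = \<zero>"
  using mat_eqI[OF expands_smult[OF expands_basis[OF assms(2)] assms(1)] _ assms(2,3)]
    L_closed[OF assms(1)] by auto

lemma mat_a:
  assumes "e \<in> E" "f \<in> E" shows "mat1 a e f = (if e = f then \<one> else \<zero>)"
  using mat_eqI(2)[OF expands_mult_a[OF expands_basis[OF assms(1)]] _ assms] by simp

text \<open>Applying \<open>x\<close> to the expansion of \<open>y e\<close> is matrix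
  multiplication over \<open>L[a]\<close>. Its part in \<open>a\<close> is the product rule
  \<open>\<delta>(XY) = X \<delta>Y + \<delta>X Y\<close> at \<open>a = 0\<close>; column-first
  indexing puts the entries of \<open>y\<close> before those of \<open>x\<close>.\<close>

lemma mat_mult:
  assumes x: "x \<in> carrier R" and y: "y \<in> carrier R" and e: "e \<in> E" and g: "g \<in> E"
  shows "mat0 (x \<otimes> y) e g = (\<Oplus>f\<in>E. mat0 y e f \<otimes> mat0 x f g)"
    and "mat1 (x \<otimes> y) e g =
      (\<Oplus>f\<in>E. mat0 y e f \<otimes> mat1 x f g) \<oplus> (\<Oplus>f\<in>E. mat1 y e f \<otimes> mat0 x f g)"
proof -
  have ec: "e \<in> carrier R" using e E_closed by blast
  obtain u where u: "u \<in> carrier R" and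
    "y \<otimes> e = lincomb E (mat0 y e) \<oplus> a \<otimes> lincomb E (mat1 y e) \<oplus> a \<otimes> a \<otimes> u"
    using expands_mat[OF y e] by (auto simp: expands_def)
  moreover have m: "mat0 y e \<in> E \<rightarrow> L" "mat1 y e \<in> E \<rightarrow> L" using mat_in_L y e by auto
  moreover have lc: "x \<otimes> lincomb E c = (\<Oplus>f\<in>E. c f \<otimes> (x \<otimes> f))" if c: "c \<in> E \<rightarrow> L" for c
  proof -
    have "x \<otimes> lincomb E c = (\<Oplus>f\<in>E. x \<otimes> (c f \<otimes> f))"
      unfolding lincomb_def using c finE x E_closed L_closed
      by (intro finsum_rdistr) (auto simp: Pi_iff)
    also have "\<dots> = (\<Oplus>f\<in>E. c f \<otimes> (x \<otimes> f))"
      using c x E_closed L_closed by (intro finsum_cong') (auto simp: Pi_iff m_lcomm)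
    finally show ?thesis .
  qed
  ultimately have "x \<otimes> y \<otimes> e = x \<otimes> lincomb E (mat0 y e) \<oplus> a \<otimes> (x \<otimes> lincomb E (mat1 y e))
      \<oplus> a \<otimes> a \<otimes> (x \<otimes> u)"
    using x y ec lincombL_closed by (simp add: m_assoc r_distr m_lcomm[of x a])
  then have eq: "x \<otimes> y \<otimes> e = (\<Oplus>f\<in>E. mat0 y e f \<otimes> (x \<otimes> f)) \<oplus> a \<otimes> (\<Oplus>f\<in>E. mat1 y e f \<otimes> (x \<otimes> f))
      \<oplus> a \<otimes> a \<otimes> (x \<otimes> u)"
    using lc m by simp
  have ex: "expands (\<Oplus>f\<in>E. c f \<otimes> (x \<otimes> f)) (\<lambda>g. \<Oplus>f\<in>E. c f \<otimes> mat0 x f g) (\<lambda>g. \<Oplus>f\<in>E. c f \<otimes> mat1 x f g)"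
    if c: "c \<in> E \<rightarrow> L" for c
    using c finE x E_closed L_closed
    by (intro expands_finsum expands_smult expands_mat) (auto simp: Pi_iff)
  have cl: "(\<Oplus>f\<in>E. mat0 y e f \<otimes> mat0 x f h) \<in> carrier R" "(\<Oplus>f\<in>E. mat0 y e f \<otimes> mat1 x f h) \<in> carrier R"
    "(\<Oplus>f\<in>E. mat1 y e f \<otimes> mat0 x f h) \<in> carrier R" if "h \<in> E" for h
    using that x y e by (auto intro!: finsum_closed)
  \<comment> \<open>The zeros are kept so that the coordinates match \<open>expands_add\<close> term
    by term: the summand with factor \<open>a\<close> has no constant part, and the multiple of
    \<open>a \<otimes> a\<close> contributes nothing.\<close>
  have "expands (x \<otimes> y \<otimes> e) (\<lambda>g. (\<Oplus>f\<in>E. mat0 y e f \<otimes> mat0 x f g) \<oplus> \<zero> \<oplus> \<zero>)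
     (\<lambda>g. (\<Oplus>f\<in>E. mat0 y e f \<otimes> mat1 x f g) \<oplus> (\<Oplus>f\<in>E. mat1 y e f \<otimes> mat0 x f g) \<oplus> \<zero>)"
    unfolding eq using m u x
    by (intro expands_add expands_remainder expands_mult_a[OF ex] ex) auto
  then show "mat0 (x \<otimes> y) e g = (\<Oplus>f\<in>E. mat0 y e f \<otimes> mat0 x f g)"
    "mat1 (x \<otimes> y) e g = (\<Oplus>f\<in>E. mat0 y e f \<otimes> mat1 x f g) \<oplus> (\<Oplus>f\<in>E. mat1 y e f \<otimes> mat0 x f g)"
    using mat_eqI[OF _ _ e g] x y cl[OF g] by auto
qed

text \<open>The trace of \<open>X \<cdot> \<delta>Y\<close>, where \<open>X\<close>, \<open>Y\<close> are the matrices of \<open>x\<close>, \<open>y\<close> and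
  \<open>\<delta>(M + a M') = M'\<close>.\<close>

definition trace_form :: "'a \<Rightarrow> 'a \<Rightarrow> 'a"
  where "trace_form x y = (\<Oplus>e\<in>E. \<Oplus>f\<in>E. mat0 x f e \<otimes> mat1 y e f)"

lemma trace_form_closed: "x \<in> carrier R \<Longrightarrow> y \<in> carrier R \<Longrightarrow> trace_form x y \<in> carrier R"
  unfolding trace_form_def by (auto intro!: finsum_closed)

lemma trace_form_add_right:
  assumes "t \<in> carrier R" "x \<in> carrier R" "y \<in> carrier R"
  shows "trace_form t (x \<oplus> y) = trace_form t x \<oplus> trace_form t y"
proof -
  have "trace_form t (x \<oplus> y) =
      (\<Oplus>e\<in>E. (\<Oplus>f\<in>E. mat0 t f e \<otimes> mat1 x e f) \<oplus> (\<Oplus>f\<in>E. mat0 t f e \<otimes> mat1 y e f))"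
    unfolding trace_form_def
  proof (intro finsum_cong' refl)
    fix e assume e: "e \<in> E"
    have "(\<Oplus>f\<in>E. mat0 t f e \<otimes> mat1 (x \<oplus> y) e f) =
        (\<Oplus>f\<in>E. mat0 t f e \<otimes> mat1 x e f \<oplus> mat0 t f e \<otimes> mat1 y e f)"
      using e assms by (intro finsum_cong') (auto simp: mat_add r_distr)
    also have "\<dots> = (\<Oplus>f\<in>E. mat0 t f e \<otimes> mat1 x e f) \<oplus> (\<Oplus>f\<in>E. mat0 t f e \<otimes> mat1 y e f)"
      using e assms by (intro finsum_addf) auto
    finally show "(\<Oplus>f\<in>E. mat0 t f e \<otimes> mat1 (x \<oplus> y) e f) = \<dots>" .
  qed (use assms in \<open>auto intro!: finsum_closed\<close>)
  also have "\<dots> = trace_form t x \<oplus> trace_form t y"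
    unfolding trace_form_def using assms by (intro finsum_addf) (auto intro!: finsum_closed)
  finally show ?thesis .
qed

lemma trace_form_add_left:
  assumes "t \<in> carrier R" "x \<in> carrier R" "y \<in> carrier R"
  shows "trace_form (x \<oplus> y) t = trace_form x t \<oplus> trace_form y t"
proof -
  have "trace_form (x \<oplus> y) t =
      (\<Oplus>e\<in>E. (\<Oplus>f\<in>E. mat0 x f e \<otimes> mat1 t e f) \<oplus> (\<Oplus>f\<in>E. mat0 y f e \<otimes> mat1 t e f))"
    unfolding trace_form_def
  proof (intro finsum_cong' refl)
    fix e assume e: "e \<in> E"
    have "(\<Oplus>f\<in>E. mat0 (x \<oplus> y) f e \<otimes> mat1 t e f) =
        (\<Oplus>f\<in>E. mat0 x f e \<otimes> mat1 t e f \<oplus> mat0 y f e \<otimes> mat1 t e f)"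
      using e assms by (intro finsum_cong') (auto simp: mat_add l_distr)
    also have "\<dots> = (\<Oplus>f\<in>E. mat0 x f e \<otimes> mat1 t e f) \<oplus> (\<Oplus>f\<in>E. mat0 y f e \<otimes> mat1 t e f)"
      using e assms by (intro finsum_addf) auto
    finally show "(\<Oplus>f\<in>E. mat0 (x \<oplus> y) f e \<otimes> mat1 t e f) = \<dots>" .
  qed (use assms in \<open>auto intro!: finsum_closed\<close>)
  also have "\<dots> = trace_form x t \<oplus> trace_form y t"
    unfolding trace_form_def using assms by (intro finsum_addf) (auto intro!: finsum_closed)
  finally show ?thesis .
qed

text \<open>Elements of \<open>L\<close> act by scalar matrices without a part in \<open>a\<close>.
  As \<open>k\<close> maps into \<open>L\<close>, this yields the vanishing on constants required of
  a \<open>k\<close>-derivation.\<close>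

lemma trace_form_const:
  assumes "t \<in> carrier R" "l \<in> L" shows "trace_form t l = \<zero>"
  unfolding trace_form_def using assms by (intro add.finprod_one_eqI) (auto simp: mat_const)

text \<open>The matrix of \<open>a\<close> is \<open>a\<close> times the identity, so
  \<open>\<delta>\<close> sends it to the identity and the trace counts the basis.\<close>

lemma trace_form_one_a: "trace_form \<one> a = add_pow R (card E) \<one>"
proof -
  have "trace_form \<one> a = (\<Oplus>e\<in>E. \<one>)"
    unfolding trace_form_def
  proof (intro finsum_cong' refl)
    fix e assume e: "e \<in> E"
    have "(\<Oplus>f\<in>E. mat0 \<one> f e \<otimes> mat1 a e f) = (\<Oplus>f\<in>E. if e = f then \<one> else \<zero>)"
      using e by (intro finsum_cong') (auto simp: mat_a mat_const one_in_L)
    also have "\<dots> = \<one>" using finE e by (intro finsum_singleton) auto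
    finally show "(\<Oplus>f\<in>E. mat0 \<one> f e \<otimes> mat1 a e f) = \<one>" .
  qed auto
  then show ?thesis using add.finprod_const[of \<one> E] by simp
qed

text \<open>With \<open>T\<close> the matrix of \<open>t\<close>, the product rule for
  \<open>\<delta>(XY)\<close> gives \<open>tr(T X \<delta>Y) + tr(T \<delta>X Y)\<close>, and
  cyclicity turns the second trace into \<open>tr(Y T \<delta>X)\<close>.\<close>

lemma trace_form_leibniz:
  assumes t: "t \<in> carrier R" and x: "x \<in> carrier R" and y: "y \<in> carrier R"
  shows "trace_form t (x \<otimes> y) = trace_form (t \<otimes> x) y \<oplus> trace_form (y \<otimes> t) x"
proof -
  \<comment> \<open>\<open>?P\<close> collects the terms in which \<open>\<delta>\<close> falls on
    \<open>x\<close>, \<open>?Q\<close> those in which it falls on \<open>y\<close>.\<close>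
  let ?P = "\<lambda>e g f. mat0 t g e \<otimes> mat0 y e f \<otimes> mat1 x f g"
  let ?Q = "\<lambda>e g f. mat0 t g e \<otimes> mat1 y e f \<otimes> mat0 x f g"
  have cl: "?P e g f \<in> carrier R" "?Q e g f \<in> carrier R" if "e \<in> E" "g \<in> E" "f \<in> E" for e g f
    using that assms by auto
  note sum_cl = cl finsum_closed
  have "trace_form t (x \<otimes> y) = (\<Oplus>e\<in>E. \<Oplus>g\<in>E. (\<Oplus>f\<in>E. ?P e g f) \<oplus> (\<Oplus>f\<in>E. ?Q e g f))"
    unfolding trace_form_def
  proof (intro finsum_cong' refl)
    fix e g assume e: "e \<in> E" and g: "g \<in> E"
    have "mat0 t g e \<otimes> (\<Oplus>f\<in>E. mat0 y e f \<otimes> mat1 x f g) = (\<Oplus>f\<in>E. mat0 t g e \<otimes> (mat0 y e f \<otimes> mat1 x f g))"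
         "mat0 t g e \<otimes> (\<Oplus>f\<in>E. mat1 y e f \<otimes> mat0 x f g) = (\<Oplus>f\<in>E. mat0 t g e \<otimes> (mat1 y e f \<otimes> mat0 x f g))"
      using e g assms finE by (auto intro!: finsum_rdistr)
    moreover have "(\<Oplus>f\<in>E. mat0 t g e \<otimes> (mat0 y e f \<otimes> mat1 x f g)) = (\<Oplus>f\<in>E. ?P e g f)"
        "(\<Oplus>f\<in>E. mat0 t g e \<otimes> (mat1 y e f \<otimes> mat0 x f g)) = (\<Oplus>f\<in>E. ?Q e g f)"
      using e g assms by (auto intro!: finsum_cong' simp: m_assoc)
    ultimately show "mat0 t g e \<otimes> mat1 (x \<otimes> y) e g = (\<Oplus>f\<in>E. ?P e g f) \<oplus> (\<Oplus>f\<in>E. ?Q e g f)"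
      using e g assms by (simp add: mat_mult(2) r_distr finsum_closed Pi_iff)
  qed (use assms in \<open>auto intro!: finsum_closed\<close>)
  also have "\<dots> = (\<Oplus>e\<in>E. \<Oplus>g\<in>E. \<Oplus>f\<in>E. ?P e g f) \<oplus> (\<Oplus>e\<in>E. \<Oplus>g\<in>E. \<Oplus>f\<in>E. ?Q e g f)"
  proof -
    have "(\<Oplus>e\<in>E. \<Oplus>g\<in>E. (\<Oplus>f\<in>E. ?P e g f) \<oplus> (\<Oplus>f\<in>E. ?Q e g f)) =
        (\<Oplus>e\<in>E. (\<Oplus>g\<in>E. \<Oplus>f\<in>E. ?P e g f) \<oplus> (\<Oplus>g\<in>E. \<Oplus>f\<in>E. ?Q e g f))"
      using assms by (intro finsum_cong' refl finsum_addf) (auto intro!: finsum_closed)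
    also have "\<dots> = (\<Oplus>e\<in>E. \<Oplus>g\<in>E. \<Oplus>f\<in>E. ?P e g f) \<oplus> (\<Oplus>e\<in>E. \<Oplus>g\<in>E. \<Oplus>f\<in>E. ?Q e g f)"
      using assms by (intro finsum_addf) (auto intro!: finsum_closed)
    finally show ?thesis .
  qed
  also have "(\<Oplus>e\<in>E. \<Oplus>g\<in>E. \<Oplus>f\<in>E. ?Q e g f) = trace_form (t \<otimes> x) y"
    unfolding trace_form_def
  proof (rule finsum_cong'[OF refl])
    fix e assume e: "e \<in> E"
    have "(\<Oplus>g\<in>E. \<Oplus>f\<in>E. ?Q e g f) = (\<Oplus>f\<in>E. \<Oplus>g\<in>E. ?Q e g f)"
      using finE cl e by (intro finsum_swap) auto
    also have "\<dots> = (\<Oplus>f\<in>E. mat0 (t \<otimes> x) f e \<otimes> mat1 y e f)"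
    proof (intro finsum_cong' refl)
      fix f assume f: "f \<in> E"
      have "(\<Oplus>g\<in>E. mat0 x f g \<otimes> mat0 t g e) \<otimes> mat1 y e f = (\<Oplus>g\<in>E. mat0 x f g \<otimes> mat0 t g e \<otimes> mat1 y e f)"
        using e f assms finE by (intro finsum_ldistr) auto
      also have "\<dots> = (\<Oplus>g\<in>E. ?Q e g f)"
        using e f assms by (intro finsum_cong') (auto simp: m_ac)
      finally show "(\<Oplus>g\<in>E. ?Q e g f) = mat0 (t \<otimes> x) f e \<otimes> mat1 y e f"
        using e f assms by (simp add: mat_mult(1))
    qed (use assms e in auto)
    finally show "(\<Oplus>g\<in>E. \<Oplus>f\<in>E. ?Q e g f) = (\<Oplus>f\<in>E. mat0 (t \<otimes> x) f e \<otimes> mat1 y e f)" .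
  qed (use assms in \<open>auto intro!: finsum_closed\<close>)
  also have "(\<Oplus>e\<in>E. \<Oplus>g\<in>E. \<Oplus>f\<in>E. ?P e g f) = trace_form (y \<otimes> t) x"
  proof -
    \<comment> \<open>Cyclicity: the sum over \<open>e\<close> moves innermost, where it becomes the
      matrix product of \<open>y\<close> and \<open>t\<close>.\<close>
    have "(\<Oplus>e\<in>E. \<Oplus>g\<in>E. \<Oplus>f\<in>E. ?P e g f) = (\<Oplus>g\<in>E. \<Oplus>e\<in>E. \<Oplus>f\<in>E. ?P e g f)"
      using finE cl by (intro finsum_swap) (auto intro!: finsum_closed)
    also have "\<dots> = (\<Oplus>g\<in>E. \<Oplus>f\<in>E. \<Oplus>e\<in>E. ?P e g f)"
      using finE assms by (intro finsum_cong' refl finsum_swap) (auto intro!: finsum_closed)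
    also have "\<dots> = (\<Oplus>f\<in>E. \<Oplus>g\<in>E. \<Oplus>e\<in>E. ?P e g f)"
      using finE cl by (intro finsum_swap) (auto intro!: finsum_closed)
    also have "\<dots> = trace_form (y \<otimes> t) x"
      unfolding trace_form_def
    proof (intro finsum_cong' refl)
      fix f g assume f: "f \<in> E" and g: "g \<in> E"
      have "(\<Oplus>e\<in>E. mat0 t g e \<otimes> mat0 y e f) \<otimes> mat1 x f g = (\<Oplus>e\<in>E. ?P e g f)"
        using f g assms finE by (intro finsum_ldistr) auto
      then show "(\<Oplus>e\<in>E. ?P e g f) = mat0 (y \<otimes> t) g f \<otimes> mat1 x f g"
        using f g assms by (simp add: mat_mult(1))
    qed (use assms in \<open>auto intro!: finsum_closed\<close>)
    finally show ?thesis .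
  qed
  also have "trace_form (y \<otimes> t) x \<oplus> trace_form (t \<otimes> x) y = trace_form (t \<otimes> x) y \<oplus> trace_form (y \<otimes> t) x"
    using assms by (intro a_comm trace_form_closed) auto
  finally show ?thesis .
qed

end

section \<open>Bases modulo \<open>a\<close>\<close>

context unit_or_nilpotent begin

text \<open>A spanning set of \<open>R/aR\<close> of least cardinality over the field
  \<open>L\<close> is a basis: a relation modulo \<open>a\<close> with \<open>c e\<close> nonzero
  can be solved for \<open>e\<close>, so \<open>E - {e}\<close> would still span.\<close>

lemma frame_exists:
  assumes K: "reduced_subring K" and char0: "\<And>n::nat. 0 < n \<Longrightarrow> add_pow R n \<one> \<noteq> \<zero>"
    and G: "finite G" "G \<subseteq> carrier R" "\<And>x. x \<in> G \<Longrightarrow> nilpotent_elem R x"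
    and nil: "\<And>x. x \<in> carrier R \<Longrightarrow> nilpotent_elem R x \<Longrightarrow> x \<in> Idl G"
    and a: "a \<in> carrier R" "nilpotent_elem R a"
    and ann: "\<And>x. x \<in> carrier R \<Longrightarrow> a \<otimes> x = \<zero> \<Longrightarrow> \<exists>u\<in>carrier R. x = a \<otimes> u"
  shows "\<exists>L E. dual_number_frame R L a E \<and> K \<subseteq> L \<and> E \<noteq> {}"
proof -
  obtain L where L: "reduced_subring L" "K \<subseteq> L"
    and max: "\<And>L'. reduced_subring L' \<Longrightarrow> L \<subseteq> L' \<Longrightarrow> L' = L"
    using reduced_subring_maximal[OF K] by metis
  have sL: "subring L R" using L(1) by (simp add: reduced_subring_def)
  note LR = subringE(1)[OF sL]
  \<comment> \<open>By \<open>coefficient_field\<close>, the single element \<open>\<one>\<close>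
    spans modulo the nilradical; this starts the induction over nilpotent generators.\<close>
  have "\<exists>w\<in>lspan L {\<one>}. \<exists>y\<in>Idl G. t = w \<oplus> y" if t: "t \<in> carrier R" for t
  proof -
    obtain l where l: "l \<in> L" "nilpotent_elem R (t \<ominus> l)"
      using coefficient_field[OF L(1) max char0 t] by blast
    have lc: "l \<in> carrier R" using l LR by blast
    have "l \<in> lspan L {\<one>}"
      using lspan_smult[OF sL _ _ lspan_mem[OF sL, of "{\<one>}" \<one>] l(1)] lc by simp
    moreover have "t \<ominus> l \<in> Idl G" using nil l t lc by simp
    moreover have "t = l \<oplus> (t \<ominus> l)" using t lc by algebra
    ultimately show ?thesis by blast
  qed
  then obtain E1 where E1: "finite E1" "E1 \<subseteq> carrier R" "lspan L E1 = carrier R"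
    using finite_span_of_nilpotent_ideal[OF sL G(1,2,3), of "{\<one>}"] by auto
  \<comment> \<open>Spanning is asked for modulo \<open>a\<close>, so that least cardinality yields
    a basis of \<open>R/aR\<close> rather than of \<open>R\<close>.\<close>
  define gens where "gens E \<longleftrightarrow> finite E \<and> E \<subseteq> carrier R \<and>
    (\<forall>t\<in>carrier R. \<exists>w\<in>lspan L E. \<exists>u\<in>carrier R. t = w \<oplus> a \<otimes> u)" for E
  have "t = t \<oplus> a \<otimes> \<zero>" if "t \<in> carrier R" for t using that a by simp
  then have "gens E1" unfolding gens_def using E1 by blast
  then obtain E where E: "gens E" and min: "\<And>E'. gens E' \<Longrightarrow> card E \<le> card E'"
    using ex_has_least_nat[of gens E1 card] by blast
  have fE: "finite E" "E \<subseteq> carrier R" using E by (auto simp: gens_def)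
  \<comment> \<open>Otherwise \<open>\<one>\<close> would be a multiple of the nilpotent
    \<open>a\<close>. This is what makes the rank positive.\<close>
  have "E \<noteq> {}"
  proof
    assume "E = {}"
    then have "lspan L E = {\<zero>}" by (auto simp: lspan_def lincomb_def)
    moreover obtain w u where "w \<in> lspan L E" and u: "u \<in> carrier R" and "\<one> = w \<oplus> a \<otimes> u"
      using E one_closed unfolding gens_def by blast
    ultimately have "\<one> = a \<otimes> u" using a by simp
    then have "nilpotent_elem R \<one>" using nilpotent_mult[OF a(1) u a(2)] by simp
    then show False using unit_not_nilpotent[of \<one>] by simp
  qed
  moreover have "dual_number_frame R L a E"
  proof (intro dual_number_frame.intro dual_number_frame_axioms.intro is_cring)
    fix c u e assume c: "c \<in> E \<rightarrow> L" and u: "u \<in> carrier R" and eq: "lincomb E c = a \<otimes> u" and e: "e \<in> E"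
    show "c e = \<zero>"
    proof (rule ccontr)
      assume ne: "c e \<noteq> \<zero>"
      have ceL: "c e \<in> L" using c e by blast
      let ?v = "inv (c e)"
      have U: "c e \<in> Units R" by (rule reduced_subring_Units[OF L(1) ceL ne])
      have v: "?v \<in> L" by (rule maximal_reduced_subring_inv[OF L(1) max ceL ne])
      have vc: "?v \<in> carrier R" "c e \<in> carrier R" "e \<in> carrier R" using U e fE by auto
      let ?E = "E - {e}"
      have E': "finite ?E" "?E \<subseteq> carrier R" using fE by auto
      have c': "c \<in> ?E \<rightarrow> L" using c by auto
      have w: "lincomb ?E c \<in> lspan L ?E" using c' by (auto simp: lspan_def)
      have wc: "lincomb ?E c \<in> carrier R" using w lspan_closed[OF sL E'] by blast
      have "lincomb (insert e ?E) c = c e \<otimes> e \<oplus> lincomb ?E c"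
        unfolding lincomb_def using E' c LR vc by (intro finsum_insert) (auto simp: Pi_iff subset_iff)
      then have "c e \<otimes> e \<oplus> lincomb ?E c = a \<otimes> u" using eq e by (simp add: insert_absorb)
      then have "c e \<otimes> e = \<ominus> lincomb ?E c \<oplus> a \<otimes> u"
        using wc vc u a by (metis a_comm m_closed r_neg1)
      then have "?v \<otimes> (c e \<otimes> e) = ?v \<otimes> (\<ominus> lincomb ?E c \<oplus> a \<otimes> u)" by simp
      moreover have "?v \<otimes> (c e \<otimes> e) = e" using U vc by (simp add: m_assoc[symmetric])
      ultimately have e_eq: "e = (\<ominus> ?v) \<otimes> lincomb ?E c \<oplus> a \<otimes> (?v \<otimes> u)"
        using vc wc u a by (simp add: r_distr l_minus r_minus m_lcomm)
      let ?V = "{t \<in> carrier R. \<exists>w\<in>lspan L ?E. \<exists>u\<in>carrier R. t = w \<oplus> a \<otimes> u}"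
      have inV: "w \<oplus> a \<otimes> u \<in> ?V" if "w \<in> lspan L ?E" "u \<in> carrier R" for w u
        using that lspan_closed[OF sL E'] a by blast
      have "lspan L E \<subseteq> ?V"
      proof (rule lspan_least)
        show "E \<subseteq> ?V"
        proof
          fix f assume f: "f \<in> E"
          show "f \<in> ?V"
          proof (cases "f = e")
            case True
            have "\<ominus> ?v \<otimes> lincomb ?E c \<in> lspan L ?E"
              using lspan_smult[OF sL E' w] subringE(5)[OF sL v] by blast
            then show ?thesis using inV[of "\<ominus> ?v \<otimes> lincomb ?E c" "?v \<otimes> u"] u vc e_eq True by simp
          next
            case False
            then have "f \<in> lspan L ?E" using f by (intro lspan_mem[OF sL E']) auto
            then have "f \<oplus> a \<otimes> \<zero> \<in> ?V" by (rule inV) simp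
            moreover have "f \<oplus> a \<otimes> \<zero> = f" using f fE a by auto
            ultimately show ?thesis by simp
          qed
        qed
        show "\<zero> \<in> ?V" using inV[OF lspan_zero[OF sL E'] zero_closed] a by simp
        show "x \<oplus> y \<in> ?V" if xy: "x \<in> ?V" "y \<in> ?V" for x y
        proof -
          obtain w u w' u' where w: "w \<in> lspan L ?E" "w' \<in> lspan L ?E"
            and u: "u \<in> carrier R" "u' \<in> carrier R" and "x = w \<oplus> a \<otimes> u" "y = w' \<oplus> a \<otimes> u'"
            using xy by auto
          moreover have "w \<in> carrier R" "w' \<in> carrier R" using w lspan_closed[OF sL E'] by auto
          ultimately have "x \<oplus> y = (w \<oplus> w') \<oplus> a \<otimes> (u \<oplus> u')" using a by (simp add: r_distr a_ac)
          then show ?thesis using inV[OF lspan_add[OF sL E' w] a_closed[OF u]] by simp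
        qed
        show "l \<otimes> x \<in> ?V" if l: "l \<in> L" and x: "x \<in> ?V" for l x
        proof -
          obtain w u where w: "w \<in> lspan L ?E" and u: "u \<in> carrier R" and "x = w \<oplus> a \<otimes> u"
            using x by auto
          moreover have "w \<in> carrier R" and lc: "l \<in> carrier R" using w lspan_closed[OF sL E'] l LR by auto
          ultimately have "l \<otimes> x = l \<otimes> w \<oplus> a \<otimes> (l \<otimes> u)" using a by (simp add: r_distr m_lcomm)
          then show ?thesis using inV[OF lspan_smult[OF sL E' w l] m_closed[OF lc u]] by simp
        qed
      qed (use fE LR in auto)
      have "\<exists>w\<in>lspan L ?E. \<exists>u\<in>carrier R. t = w \<oplus> a \<otimes> u" if t: "t \<in> carrier R" for t
      proof -
        obtain w u where w: "w \<in> lspan L E" and u: "u \<in> carrier R" and t': "t = w \<oplus> a \<otimes> u"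
          using E t unfolding gens_def by blast
        obtain w' u' where w': "w' \<in> lspan L ?E" and u': "u' \<in> carrier R" and w'': "w = w' \<oplus> a \<otimes> u'"
          using w \<open>lspan L E \<subseteq> ?V\<close> by auto
        have "w' \<in> carrier R" using w' lspan_closed[OF sL E'] by blast
        then have "t = w' \<oplus> a \<otimes> (u' \<oplus> u)" using u u' a by (simp add: t' w'' r_distr a_assoc)
        then show ?thesis using w' a_closed[OF u' u] by blast
      qed
      then have "gens ?E" unfolding gens_def using E' by blast
      then have "card E \<le> card ?E" by (rule min)
      then show False using card_Diff1_less[OF fE(1) e] by linarith
    qed
  next
    show "\<exists>w\<in>lspan L E. \<exists>u\<in>carrier R. t = w \<oplus> a \<otimes> u" if "t \<in> carrier R" for t
      using E that unfolding gens_def by blast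
  qed (rule sL a(1) fE ann | assumption)+
  ultimately show ?thesis using L(2) by (intro exI conjI)
qed

end

text \<open>
  Additive maps \<open>T \<rightarrow> T\<close>, with the action of \<open>A\<close> through \<open>h : A \<rightarrow> T\<close> by precomposition. They are set
  to zero outside the carrier, since the module axioms require equality of functions there too.
\<close>

definition fun_module ::
    "('b, 'n) ring_scheme \<Rightarrow> ('a \<Rightarrow> 'b) \<Rightarrow> ('a, 'b \<Rightarrow> 'b) module"
  where "fun_module T h =
    \<lparr>carrier = {m. (\<forall>t\<in>carrier T. m t \<in> carrier T) \<and> (\<forall>t. t \<notin> carrier T \<longrightarrow> m t = \<zero>\<^bsub>T\<^esub>) \<and>
        (\<forall>s\<in>carrier T. \<forall>t\<in>carrier T. m (s \<oplus>\<^bsub>T\<^esub> t) = m s \<oplus>\<^bsub>T\<^esub> m t)},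
     monoid.mult = undefined, one = undefined,
     ring.zero = (\<lambda>_. \<zero>\<^bsub>T\<^esub>), ring.add = (\<lambda>m n t. m t \<oplus>\<^bsub>T\<^esub> n t),
     module.smult = (\<lambda>x m t. if t \<in> carrier T then m (h x \<otimes>\<^bsub>T\<^esub> t) else \<zero>\<^bsub>T\<^esub>)\<rparr>"

lemma fun_module_carrier:
  "m \<in> carrier (fun_module T h) \<longleftrightarrow>
    (\<forall>t\<in>carrier T. m t \<in> carrier T) \<and> (\<forall>t. t \<notin> carrier T \<longrightarrow> m t = \<zero>\<^bsub>T\<^esub>) \<and>
    (\<forall>s\<in>carrier T. \<forall>t\<in>carrier T. m (s \<oplus>\<^bsub>T\<^esub> t) = m s \<oplus>\<^bsub>T\<^esub> m t)"
  by (simp add: fun_module_def)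

lemma fun_module_simps:
  "\<zero>\<^bsub>fun_module T h\<^esub> = (\<lambda>_. \<zero>\<^bsub>T\<^esub>)"
  "m \<oplus>\<^bsub>fun_module T h\<^esub> n = (\<lambda>t. m t \<oplus>\<^bsub>T\<^esub> n t)"
  "x \<odot>\<^bsub>fun_module T h\<^esub> m = (\<lambda>t. if t \<in> carrier T then m (h x \<otimes>\<^bsub>T\<^esub> t) else \<zero>\<^bsub>T\<^esub>)"
  by (simp_all add: fun_module_def)

lemma fun_module_is_module:
  assumes A: "cring A" and T: "cring T" and h: "h \<in> ring_hom A T"
  shows "module A (fun_module T h)"
proof -
  let ?M = "fun_module T h"
  interpret A: cring A by fact
  interpret T: cring T by fact
  note hc = ring_hom_closed[OF h]
  have val: "m t \<in> carrier T" if "m \<in> carrier ?M" for m t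
    using that by (cases "t \<in> carrier T") (auto simp: fun_module_carrier)
  have out: "m t = \<zero>\<^bsub>T\<^esub>" if "m \<in> carrier ?M" "t \<notin> carrier T" for m t
    using that by (auto simp: fun_module_carrier)
  have add: "m (s \<oplus>\<^bsub>T\<^esub> t) = m s \<oplus>\<^bsub>T\<^esub> m t"
    if "m \<in> carrier ?M" "s \<in> carrier T" "t \<in> carrier T" for m s t
    using that by (simp add: fun_module_carrier)
  show ?thesis
  proof (rule moduleI)
    show "abelian_group ?M"
    proof (rule abelian_groupI)
      show "\<exists>n\<in>carrier ?M. n \<oplus>\<^bsub>?M\<^esub> m = \<zero>\<^bsub>?M\<^esub>" if m: "m \<in> carrier ?M" for m
        using val[OF m] out[OF m] add[OF m] by (intro bexI[of _ "\<lambda>t. \<ominus>\<^bsub>T\<^esub> m t"])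
          (auto simp: fun_module_simps fun_module_carrier T.l_neg T.minus_add)
      show "m \<oplus>\<^bsub>?M\<^esub> n \<in> carrier ?M" if "m \<in> carrier ?M" "n \<in> carrier ?M" for m n
        using that by (simp add: fun_module_simps fun_module_carrier T.a_ac)
      show "m \<oplus>\<^bsub>?M\<^esub> n = n \<oplus>\<^bsub>?M\<^esub> m" if "m \<in> carrier ?M" "n \<in> carrier ?M" for m n
        using val[OF that(1)] val[OF that(2)] by (simp add: fun_module_simps T.a_comm)
      show "m \<oplus>\<^bsub>?M\<^esub> n \<oplus>\<^bsub>?M\<^esub> p = m \<oplus>\<^bsub>?M\<^esub> (n \<oplus>\<^bsub>?M\<^esub> p)"
        if "m \<in> carrier ?M" "n \<in> carrier ?M" "p \<in> carrier ?M" for m n p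
        using val[OF that(1)] val[OF that(2)] val[OF that(3)] by (simp add: fun_module_simps T.a_assoc)
      show "\<zero>\<^bsub>?M\<^esub> \<oplus>\<^bsub>?M\<^esub> m = m" if "m \<in> carrier ?M" for m
        using val[OF that] by (simp add: fun_module_simps)
      show "\<zero>\<^bsub>?M\<^esub> \<in> carrier ?M" by (simp add: fun_module_simps fun_module_carrier)
    qed
    show "x \<odot>\<^bsub>?M\<^esub> m \<in> carrier ?M" if x: "x \<in> carrier A" and m: "m \<in> carrier ?M" for x m
      using val[OF m] hc[OF x] add[OF m] by (simp add: fun_module_simps fun_module_carrier T.r_distr)
    show "(x \<oplus>\<^bsub>A\<^esub> y) \<odot>\<^bsub>?M\<^esub> m = x \<odot>\<^bsub>?M\<^esub> m \<oplus>\<^bsub>?M\<^esub> y \<odot>\<^bsub>?M\<^esub> m"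
      if xy: "x \<in> carrier A" "y \<in> carrier A" and m: "m \<in> carrier ?M" for x y m
      using hc[OF xy(1)] hc[OF xy(2)] add[OF m]
      by (auto simp: fun_module_simps ring_hom_add[OF h xy] T.l_distr)
    show "x \<odot>\<^bsub>?M\<^esub> (m \<oplus>\<^bsub>?M\<^esub> n) = x \<odot>\<^bsub>?M\<^esub> m \<oplus>\<^bsub>?M\<^esub> x \<odot>\<^bsub>?M\<^esub> n" for x m n
      by (auto simp: fun_module_simps)
    show "(x \<otimes>\<^bsub>A\<^esub> y) \<odot>\<^bsub>?M\<^esub> m = x \<odot>\<^bsub>?M\<^esub> (y \<odot>\<^bsub>?M\<^esub> m)"
      if xy: "x \<in> carrier A" "y \<in> carrier A" for x y m
      using hc[OF xy(1)] hc[OF xy(2)]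
      by (auto simp: fun_module_simps ring_hom_mult[OF h xy] T.m_ac)
    show "\<one>\<^bsub>A\<^esub> \<odot>\<^bsub>?M\<^esub> m = m" if m: "m \<in> carrier ?M" for m
      using out[OF m] by (auto simp: fun_module_simps ring_hom_one[OF h])
  qed (rule A)
qed

text \<open>Since \<open>x\<close> acts on a map \<open>m\<close> by
  \<open>t \<mapsto> m (h x t)\<close>, the identity of \<open>trace_form_leibniz\<close> is the
  Leibniz rule in this module.\<close>

lemma trace_derivation:
  fixes A :: "('c, 'a, 'n) module_scheme"
  assumes A: "cring A" and h: "h \<in> ring_hom A T" and frame: "dual_number_frame T L b E"
    and L: "\<And>c. c \<in> carrier k \<Longrightarrow> h (c \<odot>\<^bsub>A\<^esub> \<one>\<^bsub>A\<^esub>) \<in> L"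
  shows "derivation k A (fun_module T h)
    (\<lambda>x t. if t \<in> carrier T then dual_number_frame.trace_form T L b E t (h x) else \<zero>\<^bsub>T\<^esub>)"
proof -
  interpret A: cring A by fact
  interpret T: dual_number_frame T L b E by fact
  note hc = ring_hom_closed[OF h]
  show ?thesis
    unfolding derivation_def
  proof (intro conjI ballI)
    show "(\<lambda>x t. if t \<in> carrier T then T.trace_form t (h x) else \<zero>\<^bsub>T\<^esub>) \<in> carrier A \<rightarrow> carrier (fun_module T h)"
      using hc by (auto simp: fun_module_carrier T.trace_form_closed T.trace_form_add_left)
    fix x y assume x: "x \<in> carrier A" and y: "y \<in> carrier A"
    show "(\<lambda>t. if t \<in> carrier T then T.trace_form t (h (x \<oplus>\<^bsub>A\<^esub> y)) else \<zero>\<^bsub>T\<^esub>) =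
        (\<lambda>t. if t \<in> carrier T then T.trace_form t (h x) else \<zero>\<^bsub>T\<^esub>) \<oplus>\<^bsub>fun_module T h\<^esub>
        (\<lambda>t. if t \<in> carrier T then T.trace_form t (h y) else \<zero>\<^bsub>T\<^esub>)"
      using hc[OF x] hc[OF y]
      by (auto simp: fun_module_simps ring_hom_add[OF h x y] T.trace_form_add_right)
    show "(\<lambda>t. if t \<in> carrier T then T.trace_form t (h (x \<otimes>\<^bsub>A\<^esub> y)) else \<zero>\<^bsub>T\<^esub>) =
        x \<odot>\<^bsub>fun_module T h\<^esub> (\<lambda>t. if t \<in> carrier T then T.trace_form t (h y) else \<zero>\<^bsub>T\<^esub>) \<oplus>\<^bsub>fun_module T h\<^esub>
        y \<odot>\<^bsub>fun_module T h\<^esub> (\<lambda>t. if t \<in> carrier T then T.trace_form t (h x) else \<zero>\<^bsub>T\<^esub>)"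
    proof
      fix t
      show "(if t \<in> carrier T then T.trace_form t (h (x \<otimes>\<^bsub>A\<^esub> y)) else \<zero>\<^bsub>T\<^esub>) =
        (x \<odot>\<^bsub>fun_module T h\<^esub> (\<lambda>t. if t \<in> carrier T then T.trace_form t (h y) else \<zero>\<^bsub>T\<^esub>) \<oplus>\<^bsub>fun_module T h\<^esub>
        y \<odot>\<^bsub>fun_module T h\<^esub> (\<lambda>t. if t \<in> carrier T then T.trace_form t (h x) else \<zero>\<^bsub>T\<^esub>)) t"
        \<comment> \<open>The trace form produces the argument \<open>t (h x)\<close>, the module
          action \<open>(h x) t\<close>.\<close>
        using hc[OF x] hc[OF y] T.m_comm[OF hc[OF x], of t]
        by (cases "t \<in> carrier T")
          (simp_all add: fun_module_simps ring_hom_mult[OF h x y] T.trace_form_leibniz)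
    qed
  next
    fix c assume "c \<in> carrier k"
    then show "(\<lambda>t. if t \<in> carrier T then T.trace_form t (h (c \<odot>\<^bsub>A\<^esub> \<one>\<^bsub>A\<^esub>)) else \<zero>\<^bsub>T\<^esub>) =
        \<zero>\<^bsub>fun_module T h\<^esub>"
      using L by (auto simp: fun_module_simps T.trace_form_const)
  qed
qed

text \<open>The form of the claim in \<open>A = R/I\<close>, where \<open>I : f\<close> becomes
  \<open>Ann(a)\<close> and \<open>(I, f)\<close> becomes \<open>aA\<close>.\<close>

theorem annihilator_not_in_principal_ideal:
  assumes k: "field k" and char0: "char_zero k" and alg: "algebra k A"
    and noeth: "noetherian_ring A" and nontriv: "\<one>\<^bsub>A\<^esub> \<noteq> \<zero>\<^bsub>A\<^esub>"
    and a: "a \<in> carrier A" and nil: "nilpotent_elem A a"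
    and da: "kaehler_d k A a = \<zero>\<^bsub>kaehler k A\<^esub>"
  shows "\<exists>x\<in>carrier A. a \<otimes>\<^bsub>A\<^esub> x = \<zero>\<^bsub>A\<^esub> \<and> (\<forall>u\<in>carrier A. x \<noteq> a \<otimes>\<^bsub>A\<^esub> u)"
proof (rule ccontr)
  assume "\<not> ?thesis"
  then have ann: "\<And>x. x \<in> carrier A \<Longrightarrow> a \<otimes>\<^bsub>A\<^esub> x = \<zero>\<^bsub>A\<^esub> \<Longrightarrow> \<exists>u\<in>carrier A. x = a \<otimes>\<^bsub>A\<^esub> u"
    by blast
  interpret k: field k by fact
  interpret A: algebra k A by fact
  obtain S where S: "submonoid S A" "\<zero>\<^bsub>A\<^esub> \<notin> S"
    and max: "\<And>x. x \<in> carrier A \<Longrightarrow> x \<notin> S \<Longrightarrow> \<exists>s\<in>S. \<exists>n::nat. s \<otimes>\<^bsub>A\<^esub> x [^]\<^bsub>A\<^esub> n = \<zero>\<^bsub>A\<^esub>"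
    using A.maximal_submonoid_avoiding_zero[OF nontriv] by metis
  interpret loc: localization A S
    by (intro localization.intro localization_axioms.intro S A.is_cring)
  let ?T = "loc.loc" and ?h = "\<lambda>x. loc.frac x \<one>\<^bsub>A\<^esub>"
  interpret T: unit_or_nilpotent ?T by (rule loc.loc_unit_or_nilpotent[OF S(2) max])
  note h = loc.frac_hom
  have hk: "(\<lambda>c. ?h (c \<odot>\<^bsub>A\<^esub> \<one>\<^bsub>A\<^esub>)) \<in> ring_hom k ?T"
  proof (rule ring_hom_memI)
    fix c d assume c: "c \<in> carrier k" and d: "d \<in> carrier k"
    show "?h (c \<odot>\<^bsub>A\<^esub> \<one>\<^bsub>A\<^esub>) \<in> carrier ?T" using c by (simp add: loc.frac_closed)
    have "(c \<otimes>\<^bsub>k\<^esub> d) \<odot>\<^bsub>A\<^esub> \<one>\<^bsub>A\<^esub> = (c \<odot>\<^bsub>A\<^esub> \<one>\<^bsub>A\<^esub>) \<otimes>\<^bsub>A\<^esub> (d \<odot>\<^bsub>A\<^esub> \<one>\<^bsub>A\<^esub>)"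
      using c d by (simp add: A.smult_assoc1 A.smult_assoc2)
    then show "?h ((c \<otimes>\<^bsub>k\<^esub> d) \<odot>\<^bsub>A\<^esub> \<one>\<^bsub>A\<^esub>) = ?h (c \<odot>\<^bsub>A\<^esub> \<one>\<^bsub>A\<^esub>) \<otimes>\<^bsub>?T\<^esub> ?h (d \<odot>\<^bsub>A\<^esub> \<one>\<^bsub>A\<^esub>)"
      using c d by (simp add: ring_hom_mult[OF h])
    show "?h ((c \<oplus>\<^bsub>k\<^esub> d) \<odot>\<^bsub>A\<^esub> \<one>\<^bsub>A\<^esub>) = ?h (c \<odot>\<^bsub>A\<^esub> \<one>\<^bsub>A\<^esub>) \<oplus>\<^bsub>?T\<^esub> ?h (d \<odot>\<^bsub>A\<^esub> \<one>\<^bsub>A\<^esub>)"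
      using c d by (simp add: A.smult_l_distr ring_hom_add[OF h])
  next
    show "?h (\<one>\<^bsub>k\<^esub> \<odot>\<^bsub>A\<^esub> \<one>\<^bsub>A\<^esub>) = \<one>\<^bsub>?T\<^esub>" by (simp add: loc.loc_one)
  qed
  let ?\<iota> = "\<lambda>c. ?h (c \<odot>\<^bsub>A\<^esub> \<one>\<^bsub>A\<^esub>)"
  interpret \<iota>: ring_hom_ring k ?T ?\<iota>
    by (rule ring_hom_ringI2[OF k.ring_axioms T.ring_axioms hk])
  have unit: "?\<iota> c \<in> Units ?T" if c: "c \<in> carrier k" "c \<noteq> \<zero>\<^bsub>k\<^esub>" for c
  proof -
    have cu: "c \<in> Units k" using c k.field_Units by simp
    then have "?\<iota> c \<otimes>\<^bsub>?T\<^esub> ?\<iota> (inv\<^bsub>k\<^esub> c) = \<one>\<^bsub>?T\<^esub>"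
      using c \<iota>.hom_mult[of c "inv\<^bsub>k\<^esub> c"] \<iota>.hom_one by simp
    then show ?thesis using cu c T.m_comm[of "?\<iota> c" "?\<iota> (inv\<^bsub>k\<^esub> c)"] \<iota>.hom_closed
      unfolding Units_def[of ?T] by (intro CollectI conjI bexI[of _ "?\<iota> (inv\<^bsub>k\<^esub> c)"]) simp_all
  qed
  \<comment> \<open>Zorn's lemma starts from the image of \<open>k\<close>, whose nonzero elements
    are units, so that the coefficient field contains it and the trace form vanishes on
    constants.\<close>
  have K: "T.reduced_subring (?\<iota> ` carrier k)"
    unfolding T.reduced_subring_def
  proof (intro conjI ballI impI)
    show "subring (?\<iota> ` carrier k) ?T" by (rule \<iota>.img_is_subring[OF k.carrier_is_subring])
    fix x assume "x \<in> ?\<iota> ` carrier k" "nilpotent_elem ?T x"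
    then show "x = \<zero>\<^bsub>?T\<^esub>" using unit T.unit_not_nilpotent \<iota>.hom_zero by blast
  qed
  \<comment> \<open>A positive integer is nonzero in \<open>k\<close>, hence invertible there and in
    the localization.\<close>
  have char: "add_pow ?T n \<one>\<^bsub>?T\<^esub> \<noteq> \<zero>\<^bsub>?T\<^esub>" if n: "0 < n" for n :: nat
  proof -
    have "add_pow ?T m \<one>\<^bsub>?T\<^esub> = ?\<iota> (add_pow k m \<one>\<^bsub>k\<^esub>)" for m :: nat
      using \<iota>.hom_zero \<iota>.hom_one by (induction m) (simp_all add: \<iota>.hom_add)
    moreover have "?\<iota> (add_pow k n \<one>\<^bsub>k\<^esub>) \<in> Units ?T"
      using char0 n by (intro unit) (auto simp: char_zero_def)
    ultimately show ?thesis using T.unit_not_nilpotent T.nilpotent_zero by metis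
  qed
  obtain n :: nat where "a [^]\<^bsub>A\<^esub> n = \<zero>\<^bsub>A\<^esub>" using nil by (auto simp: nilpotent_elem_def)
  then have "?h a [^]\<^bsub>?T\<^esub> n = \<zero>\<^bsub>?T\<^esub>" using a by (simp add: loc.frac_pow loc.loc_zero)
  then have nil': "nilpotent_elem ?T (?h a)" unfolding nilpotent_elem_def ..
  have ha: "?h a \<in> carrier ?T" using a by (simp add: loc.frac_closed)
  obtain G where G: "finite G" "G \<subseteq> carrier ?T" "\<And>x. x \<in> G \<Longrightarrow> nilpotent_elem ?T x"
    "\<And>x. x \<in> carrier ?T \<Longrightarrow> nilpotent_elem ?T x \<Longrightarrow> x \<in> Idl\<^bsub>?T\<^esub> G"
    using loc.loc_nilradical_finitely_generated[OF noeth T.unit_or_nilpotent_axioms] by blast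
  obtain L E where frame: "dual_number_frame ?T L (?h a) E" and L: "?\<iota> ` carrier k \<subseteq> L" and E: "E \<noteq> {}"
    using T.frame_exists[OF K char G ha nil' loc.loc_annihilator[OF a ann]] by blast
  interpret frame: dual_number_frame ?T L "?h a" E by fact
  let ?M = "fun_module ?T ?h"
  define D where "D x t = (if t \<in> carrier ?T then frame.trace_form t (?h x) else \<zero>\<^bsub>?T\<^esub>)" for x t
  have M: "module A ?M" by (rule fun_module_is_module[OF A.is_cring T.is_cring h])
  have "derivation k A ?M D"
    using trace_derivation[OF A.is_cring h frame, of k] L unfolding D_def by blast
  then obtain g where g: "g \<in> linear_maps A (kaehler k A) ?M"
    and gd: "\<And>x. x \<in> carrier A \<Longrightarrow> g (kaehler_d k A x) = D x"
    using kaehler_universal[OF alg M] by blast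
  have "D a = \<zero>\<^bsub>?M\<^esub>"
    using gd[OF a] da linear_maps_zero[OF kaehler_module[OF alg] M g] by simp
  \<comment> \<open>At \<open>\<one>\<close> the function \<open>D a\<close> takes the trace of the
    identity matrix, that is \<open>card E\<close>.\<close>
  then have "D a \<one>\<^bsub>?T\<^esub> = \<zero>\<^bsub>?T\<^esub>" by (simp add: fun_module_simps)
  then have "add_pow ?T (card E) \<one>\<^bsub>?T\<^esub> = \<zero>\<^bsub>?T\<^esub>"
    unfolding D_def using frame.trace_form_one_a by simp
  then show False using char[of "card E"] E frame.finE by (simp add: card_gt_0_iff)
qed

theorem theorem1p1:
  fixes k :: "('c, 'm) ring_scheme"
    and R :: "('c, 'a, 'n) module_scheme"
    and I :: "'a set" and f :: 'a
    and A :: "('c, 'a set) module" and a :: "'a set"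
  assumes "field k" and "char_zero k"
    and "algebra k R"
    and "ideal I R" and "I \<noteq> carrier R"
    and "A = R MQuot I"
    and "noetherian_ring A"
    and "f \<in> carrier R"
    and "a = I +>\<^bsub>R\<^esub> f"
    and "nilpotent_elem A a"
    and "kaehler_d k A a = \<zero>\<^bsub>kaehler k A\<^esub>"
  shows "\<not> colon_ideal R I f \<subseteq> I <+>\<^bsub>R\<^esub> PIdl\<^bsub>R\<^esub> f"
proof
  assume sub: "colon_ideal R I f \<subseteq> I <+>\<^bsub>R\<^esub> PIdl\<^bsub>R\<^esub> f"
  interpret R: algebra k R by fact
  interpret I: ideal I R by fact
  have A: "carrier A = a_rcosets\<^bsub>R\<^esub> I" "\<zero>\<^bsub>A\<^esub> = I" "\<one>\<^bsub>A\<^esub> = I +>\<^bsub>R\<^esub> \<one>\<^bsub>R\<^esub>"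
    by (simp_all add: \<open>A = R MQuot I\<close> quot_module_simps)
  have carr: "B \<in> carrier A \<longleftrightarrow> (\<exists>x\<in>carrier R. B = I +>\<^bsub>R\<^esub> x)" for B
    unfolding \<open>A = R MQuot I\<close> by (rule quot_module_carrier)
  have mult: "(I +>\<^bsub>R\<^esub> x) \<otimes>\<^bsub>A\<^esub> (I +>\<^bsub>R\<^esub> y) = I +>\<^bsub>R\<^esub> (x \<otimes>\<^bsub>R\<^esub> y)"
    if "x \<in> carrier R" "y \<in> carrier R" for x y
    using that by (simp add: \<open>A = R MQuot I\<close> quot_module_simps I.rcoset_mult_add)
  have zero_iff: "I +>\<^bsub>R\<^esub> x = I \<longleftrightarrow> x \<in> I" if "x \<in> carrier R" for x
    using that I.a_rcos_const I.a_rcos_self by metis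
  have alg: "algebra k A" unfolding \<open>A = R MQuot I\<close> by (rule R.quot_is_algebra) fact
  have nontriv: "\<one>\<^bsub>A\<^esub> \<noteq> \<zero>\<^bsub>A\<^esub>"
    using \<open>I \<noteq> carrier R\<close> I.one_imp_carrier zero_iff[of "\<one>\<^bsub>R\<^esub>"] by (auto simp: A)
  have a: "a \<in> carrier A" using assms(8,9) unfolding carr by blast
  obtain B where B: "B \<in> carrier A" "a \<otimes>\<^bsub>A\<^esub> B = \<zero>\<^bsub>A\<^esub>" "\<And>u. u \<in> carrier A \<Longrightarrow> B \<noteq> a \<otimes>\<^bsub>A\<^esub> u"
    using annihilator_not_in_principal_ideal[OF assms(1,2) alg assms(7) nontriv a assms(10,11)]
    by blast
  obtain g where g: "g \<in> carrier R" "B = I +>\<^bsub>R\<^esub> g" using B(1) carr by blast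
  have "f \<otimes>\<^bsub>R\<^esub> g \<in> I"
    using B(2) g assms(8,9) mult[of f g] zero_iff[of "f \<otimes>\<^bsub>R\<^esub> g"] by (simp add: A)
  then have "g \<in> colon_ideal R I f"
    using g assms(8) R.m_comm by (simp add: colon_ideal_def)
  then obtain i p where i: "i \<in> I" and p: "p \<in> PIdl\<^bsub>R\<^esub> f" and gip: "g = i \<oplus>\<^bsub>R\<^esub> p"
    using sub by (auto simp: set_add_def')
  then obtain r where r: "r \<in> carrier R" "p = r \<otimes>\<^bsub>R\<^esub> f" by (auto simp: cgenideal_def)
  \<comment> \<open>Modulo \<open>I\<close> the decomposition \<open>g = i + r f\<close> exhibits
    \<open>B\<close> as a multiple of \<open>a\<close>, against the choice of
    \<open>B\<close>.\<close>
  have "g \<in> I +>\<^bsub>R\<^esub> p" using i gip by (auto simp: a_r_coset_def')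
  then have "B = I +>\<^bsub>R\<^esub> p" using I.a_repr_independence'[of g p] g r assms(8) by simp
  also have "\<dots> = a \<otimes>\<^bsub>A\<^esub> (I +>\<^bsub>R\<^esub> r)" using r assms(8,9) mult[of f r] by (simp add: R.m_comm)
  finally show False using B(3) r carr by blast
qed

end
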